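(* For all integers $g\ge0$, $n\ge1$ with $2g-1+n\ge1$, the function $V^\circ_{g,n}$ is a homogeneous polynomial of degree $4g-2+n$. Moreover, if $2g-1+n\ge2$, then $$\begin{aligned}(2g+n-1)V^\circ_{g,n}(L)=&\ \tfrac12\sum_{i\ne j}(L_i+L_j)\,V^\circ_{g,n-1}(L_i+L_j,L_{\{i,j\}^c})\\&+\tfrac12\sum_i\int_0^{L_i}V^\circ_{g-1,n+1}(x,L_i-x,L_{\{i\}^c})\,x(L_i-x)\,dx,\end{aligned}$$ where the first sum is over ordered pairs of distinct indices in $\{1,\dots,n\}$, $L_{J^c}$ denotes the vector of the entries of $L$ with index not in $J$, and the second sum is $0$ when $g=0$.
   Context: A ribbon graph $R$ is a finite set $XR$ (half-edges) with permutations $s_0,s_1,s_2$ of $XR$ such that $s_1$ is an involution without fixed points and $s_2s_1s_0=\mathrm{id}$. The sets $X_0R,X_1R,X_2R$ of orbits of $s_0,s_1,s_2$ are the vertices, edges and boundary components of $R$; $[e]_i$ is the orbit of $e\in XR$ under $s_i$; the degree of a vertex is its number of half-edges. $R$ is connected if $\langle s_0,s_1,s_2\rangle$ acts transitively on $XR$, and then its genus $g$ is defined by $2-2g=\#X_0R-\#X_1R+\#X_2R$. A direction is a map $\epsilon:XR\to\{\pm1\}$ with $\epsilon\circ s_2=\epsilon$ and $\epsilon\circ s_1=-\epsilon$; a directed ribbon graph is $R^\circ=(R,\epsilon)$. As $\epsilon$ is constant on boundary components, these split into positive and negative ones. $R^\circ$ is of type $(g,n^+,n^-)$ if it is connected of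 genus $g$ with $n^+$ positive boundary components labelled $1,\dots,n^+$ and $n^-$ negative ones labelled $1,\dots,n^-$; isomorphisms are bijections of half-edges commuting with all $s_i$ and preserving $\epsilon$ and the labels, and $\mathrm{Aut}(R^\circ)$ is the corresponding automorphism group. A metric is a map $m:X_1R\to\mathbb R_{>0}$; the length of $\beta\in X_2R$ is $\sum_{e\in XR,\,[e]_2=\beta}m_{[e]_1}$. For $L^\pm\in\mathbb R_{>0}^{n^\pm}$ with $\sum_iL_i^+=\sum_jL_j^-$, $\mathrm{Met}(R^\circ,L)$ is the set of metrics whose positive (negative) boundary lengths are $L^+$ (resp. $L^-$). It lies in an affine space directed by the kernel $K_R\subset\mathbb R^{X_1R}$ of the linear boundary-length map $\mathbb R^{X_1R}\to\mathbb R^{X_2R}$, and it carries the Lebesgue measure for which $K_R\cap\mathbb Z^{X_1R}$ has covolume one (counting measure if $K_R=0$). Put $$V_{g,n^+,n^-}(L^+|L^-)=\sum_{R^\circ}\frac{1}{\#\mathrm{Aut}(R^\circ)}\mathrm{vol}(\mathrm{Met}(R^\circ,L)),$$ the sum being over isomorphism classes of directed ribbon graphs of type $(g,n^+,n^-)$ all of whose vertices have degree $4$. For one negative boundary component, set $V^\circ_{g,n}(L)=V_{g,n,1}(L\,|\,\sum_iL_i)$ for $L\in\mathbb R_{>0}^n$. (One has $V^\circ_{0,2}=1$, the initial condition of the recursion.) *)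

theory Defs
  imports "HOL-Analysis.Analysis" "HOL-Combinatorics.Combinatorics"
begin

section \<open>Ribbon graphs\<close>

record 'h ribbon_graph =
  half_edges :: "'h set"
  s0 :: "'h \<Rightarrow> 'h"
  s1 :: "'h \<Rightarrow> 'h"
  s2 :: "'h \<Rightarrow> 'h"

definition ribbon_graph :: "('h, 'z) ribbon_graph_scheme \<Rightarrow> bool" where
  "ribbon_graph R \<longleftrightarrow>
     finite (half_edges R) \<and>
     s0 R permutes half_edges R \<and> s1 R permutes half_edges R \<and> s2 R permutes half_edges R \<and>
     (\<forall>x\<in>half_edges R. s1 R (s1 R x) = x \<and> s1 R x \<noteq> x) \<and>
     s2 R \<circ> s1 R \<circ> s0 R = id"

definition vertices :: "('h, 'z) ribbon_graph_scheme \<Rightarrow> 'h set set" where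
  "vertices R = orbit (s0 R) ` half_edges R"

definition edges :: "('h, 'z) ribbon_graph_scheme \<Rightarrow> 'h set set" where
  "edges R = orbit (s1 R) ` half_edges R"

definition boundaries :: "('h, 'z) ribbon_graph_scheme \<Rightarrow> 'h set set" where
  "boundaries R = orbit (s2 R) ` half_edges R"

definition four_valent :: "('h, 'z) ribbon_graph_scheme \<Rightarrow> bool" where
  "four_valent R \<longleftrightarrow> (\<forall>v\<in>vertices R. card v = 4)"

inductive_set generated_group :: "('h \<Rightarrow> 'h) set \<Rightarrow> ('h \<Rightarrow> 'h) set" for S where
  one: "id \<in> generated_group S"
| gen: "s \<in> S \<Longrightarrow> f \<in> generated_group S \<Longrightarrow> s \<circ> f \<in> generated_group S"
| inv_gen: "s \<in> S \<Longrightarrow> f \<in> generated_group S \<Longrightarrow> inv s \<circ> f \<in> generated_group S"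

definition connected_ribbon :: "('h, 'z) ribbon_graph_scheme \<Rightarrow> bool" where
  "connected_ribbon R \<longleftrightarrow>
     (\<forall>x\<in>half_edges R. \<forall>y\<in>half_edges R. \<exists>f\<in>generated_group {s0 R, s1 R, s2 R}. f x = y)"

definition has_genus :: "('h, 'z) ribbon_graph_scheme \<Rightarrow> nat \<Rightarrow> bool" where
  "has_genus R g \<longleftrightarrow> connected_ribbon R \<and>
     2 - 2 * int g = int (card (vertices R)) - int (card (edges R)) + int (card (boundaries R))"


section \<open>Directed ribbon graphs with labelled boundary components\<close>

record 'h directed_ribbon_graph = "'h ribbon_graph" +
  direction :: "'h \<Rightarrow> int"
  label :: "'h set \<Rightarrow> nat"

definition is_direction :: "('h, 'z) directed_ribbon_graph_scheme \<Rightarrow> bool" where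
  "is_direction R \<longleftrightarrow> (\<forall>x\<in>half_edges R. direction R x \<in> {1, -1} \<and>
     direction R (s2 R x) = direction R x \<and> direction R (s1 R x) = - direction R x)"

definition pos_boundaries :: "('h, 'z) directed_ribbon_graph_scheme \<Rightarrow> 'h set set" where
  "pos_boundaries R = {\<beta> \<in> boundaries R. \<forall>x\<in>\<beta>. direction R x = 1}"

definition neg_boundaries :: "('h, 'z) directed_ribbon_graph_scheme \<Rightarrow> 'h set set" where
  "neg_boundaries R = {\<beta> \<in> boundaries R. \<forall>x\<in>\<beta>. direction R x = -1}"

text \<open>
  Labels start at 0 rather than 1, so that the boundary component labelled \<open>i\<close> gets as its
  length the \<open>i\<close>-th entry of a list of lengths.
\<close>

definition of_type :: "nat \<Rightarrow> nat \<Rightarrow> nat \<Rightarrow> ('h, 'z) directed_ribbon_graph_scheme \<Rightarrow> bool" where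
  "of_type g np nm R \<longleftrightarrow> ribbon_graph R \<and> is_direction R \<and> has_genus R g \<and>
     bij_betw (label R) (pos_boundaries R) {..<np} \<and>
     bij_betw (label R) (neg_boundaries R) {..<nm}"

definition is_iso ::
  "('h \<Rightarrow> 'k) \<Rightarrow> ('h, 'y) directed_ribbon_graph_scheme \<Rightarrow> ('k, 'z) directed_ribbon_graph_scheme \<Rightarrow> bool"
  where
  "is_iso \<phi> R S \<longleftrightarrow> bij_betw \<phi> (half_edges R) (half_edges S) \<and>
     (\<forall>x\<in>half_edges R. \<phi> (s0 R x) = s0 S (\<phi> x) \<and> \<phi> (s1 R x) = s1 S (\<phi> x) \<and>
        \<phi> (s2 R x) = s2 S (\<phi> x) \<and> direction S (\<phi> x) = direction R x) \<and>
     (\<forall>\<beta>\<in>boundaries R. label S (\<phi> ` \<beta>) = label R \<beta>)"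

text \<open>
  Requiring \<open>\<phi>\<close> to be the identity off the half-edges makes each automorphism occur exactly once.
\<close>

definition Aut :: "('h, 'z) directed_ribbon_graph_scheme \<Rightarrow> ('h \<Rightarrow> 'h) set" where
  "Aut R = {\<phi>. \<phi> permutes half_edges R \<and> is_iso \<phi> R R}"


section \<open>Metrics and their volume\<close>

text \<open>
  The space \<open>\<real>\<^bsup>X\<^sub>1R\<^esup>\<close>, realised as the real functions on sets that vanish off the set of edges.
\<close>

definition edge_space :: "('h, 'z) ribbon_graph_scheme \<Rightarrow> ('h set \<Rightarrow> real) set" where
  "edge_space R = {m. \<forall>e. e \<notin> edges R \<longrightarrow> m e = 0}"

definition boundary_length ::
  "('h, 'z) ribbon_graph_scheme \<Rightarrow> ('h set \<Rightarrow> real) \<Rightarrow> 'h set \<Rightarrow> real" where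
  "boundary_length R m \<beta> = (\<Sum>x | x \<in> half_edges R \<and> orbit (s2 R) x = \<beta>. m (orbit (s1 R) x))"

definition Met ::
  "('h, 'z) directed_ribbon_graph_scheme \<Rightarrow> real list \<Rightarrow> real list \<Rightarrow> ('h set \<Rightarrow> real) set" where
  "Met R Lp Lm = {m \<in> edge_space R. (\<forall>e\<in>edges R. m e > 0) \<and>
     (\<forall>\<beta>\<in>pos_boundaries R. boundary_length R m \<beta> = Lp ! label R \<beta>) \<and>
     (\<forall>\<beta>\<in>neg_boundaries R. boundary_length R m \<beta> = Lm ! label R \<beta>)}"

definition length_kernel :: "('h, 'z) ribbon_graph_scheme \<Rightarrow> ('h set \<Rightarrow> real) set" where
  "length_kernel R = {m \<in> edge_space R. \<forall>\<beta>\<in>boundaries R. boundary_length R m \<beta> = 0}"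

text \<open>
  \<open>b 0, \<dots>, b (k - 1)\<close> is a real basis of the kernel that is also an integral basis of its
  lattice of integer points.
\<close>

definition kernel_lattice_basis ::
  "('h, 'z) ribbon_graph_scheme \<Rightarrow> nat \<Rightarrow> (nat \<Rightarrow> 'h set \<Rightarrow> real) \<Rightarrow> bool" where
  "kernel_lattice_basis R k b \<longleftrightarrow>
     (\<forall>i<k. b i \<in> length_kernel R \<and> (\<forall>e. b i e \<in> \<int>)) \<and>
     (\<forall>m\<in>length_kernel R. \<exists>!t. t \<in> {..<k} \<rightarrow>\<^sub>E UNIV \<and> m = (\<lambda>e. \<Sum>i<k. t i * b i e)) \<and>
     (\<forall>m\<in>length_kernel R. (\<forall>e. m e \<in> \<int>) \<longrightarrow>
        (\<exists>t. (\<forall>i<k. t i \<in> \<int>) \<and> m = (\<lambda>e. \<Sum>i<k. t i * b i e)))"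

text \<open>
  Volume of a subset \<open>A\<close> of a translate \<open>p + K\<close> of the kernel \<open>K\<close>, for the Lebesgue measure giving
  the lattice of integer points of \<open>K\<close> covolume one: Lebesgue measure in the coordinates of an
  integral basis, with any point \<open>p\<close> of \<open>A\<close> as origin. The result does not depend on the choices
  of basis and origin. For \<open>K = 0\<close> this is the counting measure, since the product measure over
  the empty index set is a unit point mass.
\<close>

definition kernel_volume :: "('h, 'z) ribbon_graph_scheme \<Rightarrow> ('h set \<Rightarrow> real) set \<Rightarrow> real" where
  "kernel_volume R A =
     (let (k, b) = (SOME (k, b). kernel_lattice_basis R k b); p = (SOME p. p \<in> A) in
        measure (Pi\<^sub>M {..<k} (\<lambda>_. lborel))
          {t \<in> {..<k} \<rightarrow>\<^sub>E UNIV. (\<lambda>e. p e + (\<Sum>i<k. t i * b i e)) \<in> A})"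


section \<open>Volume functions\<close>

text \<open>
  Every finite set of half-edges can be transported into \<^typ>\<open>nat\<close>, so the isomorphism classes of
  all directed ribbon graphs are represented by graphs with half-edges in \<^typ>\<open>nat\<close>.
\<close>

definition four_valent_graphs :: "nat \<Rightarrow> nat \<Rightarrow> nat \<Rightarrow> nat directed_ribbon_graph set" where
  "four_valent_graphs g np nm = {R. of_type g np nm R \<and> four_valent R}"

definition iso_classes :: "nat \<Rightarrow> nat \<Rightarrow> nat \<Rightarrow> nat directed_ribbon_graph set set" where
  "iso_classes g np nm = four_valent_graphs g np nm //
     {(R, S). R \<in> four_valent_graphs g np nm \<and> S \<in> four_valent_graphs g np nm \<and>
              (\<exists>\<phi>. is_iso \<phi> R S)}"

definition V :: "nat \<Rightarrow> nat \<Rightarrow> nat \<Rightarrow> real list \<Rightarrow> real list \<Rightarrow> real" where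
  "V g np nm Lp Lm = (\<Sum>C\<in>iso_classes g np nm.
     let R = (SOME R. R \<in> C) in 1 / real (card (Aut R)) * kernel_volume R (Met R Lp Lm))"

definition Vcirc :: "nat \<Rightarrow> nat \<Rightarrow> real list \<Rightarrow> real" where
  "Vcirc g n L = V g n 1 L [sum_list L]"

definition pos_vectors :: "nat \<Rightarrow> real list set" where
  "pos_vectors n = {L. length L = n \<and> (\<forall>x\<in>set L. x > 0)}"

text \<open>
  The function given on positive vectors of length \<open>n\<close> by \<open>f\<close> is a polynomial of degree \<open>d\<close>,
  in particular not the zero polynomial, all of whose monomials have total degree \<open>d\<close>.
\<close>

definition homogeneous_polynomial :: "nat \<Rightarrow> nat \<Rightarrow> (real list \<Rightarrow> real) \<Rightarrow> bool" where
  "homogeneous_polynomial n d f \<longleftrightarrow>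
     (\<exists>c :: nat list \<Rightarrow> real.
        (\<exists>\<alpha>. length \<alpha> = n \<and> sum_list \<alpha> = d \<and> c \<alpha> \<noteq> 0) \<and>
        (\<forall>L\<in>pos_vectors n.
           f L = (\<Sum>\<alpha> | length \<alpha> = n \<and> sum_list \<alpha> = d. c \<alpha> * (\<Prod>i<n. (L ! i) ^ (\<alpha> ! i)))))"

end

theory Submission
  imports Defs
begin

text \<open>
  Let \<open>R\<close> be four-valent of genus \<open>g\<close> with \<open>n\<close> positive boundary components and one negative one. On the
  set \<open>P\<close> of positive half-edges put \<open>\<sigma> = s\<^sub>2\<close> and \<open>\<gamma> = s\<^sub>1 s\<^sub>2 s\<^sub>1\<close>. The vertices have degree 4 iff
  \<open>\<tau> = \<sigma> \<gamma> = s\<^sub>0\<^bsup>-2\<^esup>\<close> is a fixed point free involution of \<open>P\<close>, and there is one negative boundary iff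
  \<open>\<gamma> = \<sigma>\<^bsup>-1\<^esup> \<tau>\<close> is a full cycle; conversely \<open>(P, \<sigma>, \<tau>)\<close> determines \<open>R\<close>, and \<open>\<sigma>\<close> has \<open>n\<close> cycles on
  \<open>N = 2 (2g - 1 + n)\<close> points. The negative boundary condition on a metric follows from the positive
  ones, so the metrics form a product of open simplices, of volume \<open>\<Prod> L\<^sub>i\<^bsup>k\<^sub>i - 1\<^esup> / (k\<^sub>i - 1)!\<close>, where the
  \<open>k\<^sub>i\<close> are the cycle lengths of \<open>\<sigma>\<close>. Counting orbits of the centraliser of \<open>\<sigma>\<close> gives
  \<open>V = \<Sum>\<^sub>k gl(k) \<Prod> L\<^sub>i\<^bsup>k\<^sub>i - 1\<^esup> / k\<^sub>i!\<close>, where \<open>gl(k)\<close> is the number of possible \<open>\<tau>\<close> for a fixed \<open>\<sigma>\<close>.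
  Deleting a point \<open>x\<close> and its partner \<open>\<tau> x\<close> merges the cycles of \<open>x\<close> and \<open>\<tau> x\<close>, or splits their common
  cycle. Summing the resulting recursion for \<open>gl\<close> over all \<open>N\<close> choices of \<open>x\<close>, the merged cycles give the
  first sum of the theorem by the binomial theorem, and the split cycles give the integrals by
  Euler's beta integral.
\<close>

section \<open>Gluings of permutations\<close>

text \<open>The genus is invisible to \<open>gl\<close> and enters only through \<open>N\<close>.
  Deleting a pair lowers \<open>N\<close> by 2 and changes the number of cycles by -1 or +1, which
  means passing to \<open>(g, n - 1)\<close> or \<open>(g - 1, n + 1)\<close>. For
  \<open>g = 0\<close> the split terms would have genus -1, and their vanishing is a separate lemma.
  A deletion may also empty a cycle of \<open>\<sigma>\<close>; this happens exactly when the walk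
  along the negative boundary has an orbit inside the deleted pair, so the convention that
  \<open>gl\<close> vanishes on multisets containing 0 covers it. The denominator \<open>k!\<close>
  is \<open>(k - 1)!\<close> from a simplex times \<open>k\<close> from the centraliser. Letting the
  deleted point run through a cycle gives back the factor \<open>k\<close> and turns
  \<open>L^(k-1) / k!\<close> into a divided power; products and convolutions of these need no
  coefficients. The factor \<open>2 * g + n - 1\<close> and the halves come from dividing by 2 an
  identity whose left factor is \<open>N\<close>. The volume is defined through an unspecified
  lattice basis. It is compared with Lebesgue measure in edge coordinates by the uniqueness argument
  for Haar measure, with a fundamental domain fixing the constant.\<close>

abbreviation swap :: "'a \<Rightarrow> 'a \<Rightarrow> 'a \<Rightarrow> 'a" where "swap \<equiv> Transposition.transpose"

section \<open>Orbits and first return maps of finite permutations\<close>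

lemma orbit_eq_range:
  assumes "finite X" "f permutes X"
  shows "orbit f x = range (\<lambda>n. (f ^^ n) x)"
  by (metis assms full_SetCompr_eq orbit_altdef_permutation permutation_permutes)

text \<open>\<open>orbit f x\<close> collects the iterates with positive exponent, so it contains
  \<open>x\<close> only because a positive power of a finite permutation fixes
  \<open>x\<close>.\<close>

lemma orbit_refl:
  assumes "finite X" "f permutes X" shows "x \<in> orbit f x"
  using assms permutation_permutes permutation_self_in_orbit by metis

lemma orbit_sym:
  assumes "finite X" "f permutes X" "y \<in> orbit f x" shows "x \<in> orbit f y"
  using assms orbit_refl orbit_swap by metis

lemma orbit_eq_orbit:
  assumes "finite X" "f permutes X" "y \<in> orbit f x" shows "orbit f y = orbit f x"
  using assms orbit_sym[OF assms] orbit_trans by (metis subsetI subset_antisym)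

lemma orbit_disjoint:
  assumes "finite X" "f permutes X" "orbit f x \<noteq> orbit f y" shows "orbit f x \<inter> orbit f y = {}"
  using assms by (metis disjoint_iff orbit_eq_orbit)

lemma orbit_least:
  assumes "x \<in> A" "\<And>z. z \<in> A \<Longrightarrow> f z \<in> A" shows "orbit f x \<subseteq> A"
proof
  fix z assume "z \<in> orbit f x" then show "z \<in> A"
    by induction (use assms in auto)
qed

lemma orbit_in: "finite X \<Longrightarrow> f permutes X \<Longrightarrow> x \<in> X \<Longrightarrow> orbit f x \<subseteq> X"
  by (simp add: permutes_orbit_subset)

lemma orbit_inv_perm:
  assumes "finite X" "f permutes X" shows "orbit (inv f) x = orbit f x"
  using assms by (metis orbit_inv_eq permutation_permutes)

text \<open>The first return map of \<open>f\<close> to the complement of \<open>a\<close>, fixing \<open>a\<close>.\<close>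

definition skip :: "'a \<Rightarrow> ('a \<Rightarrow> 'a) \<Rightarrow> 'a \<Rightarrow> 'a" where
  "skip a f = swap a (f a) \<circ> f"

lemma skip_apply:
  assumes "inj f"
  shows "skip a f z = (if z = a then a else if f z = a then f a else f z)"
  using assms by (auto simp: skip_def Transposition.transpose_def inj_eq)

lemma skip_permutes:
  assumes "f permutes X"
  shows "skip a f permutes (X - {a})"
proof (cases "a \<in> X")
  case True
  then have "skip a f permutes X" unfolding skip_def
    using assms by (intro permutes_compose permutes_swap_id) (auto simp: permutes_in_image)
  moreover have "skip a f a = a" by (simp add: skip_def)
  ultimately show ?thesis
    by (smt (verit, best) Diff_iff insertI1 permutes_superset singleton_iff Diff_insert0 permutes_subset)
next
  case False
  then have "f a = a" using assms by (simp add: permutes_def)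
  then show ?thesis using assms False by (simp add: skip_def)
qed

text \<open>Cutting \<open>a\<close> out of its cycle does not depend on the direction in which the
  cycle is run through.\<close>

lemma skip_inv:
  assumes "bij f" shows "skip a (inv f) = inv (skip a f)"
proof -
  have "inv (skip a f) = inv f \<circ> swap a (f a)" unfolding skip_def
    using assms by (simp add: o_inv_distrib)
  also have "\<dots> = skip a (inv f)"
    by (simp add: skip_def transpose_comp_eq fun_eq_iff)
       (metis assms bij_betw_def bij_inv_eq_iff inv_f_f transpose_apply_commute bij_imp_bij_inv bij_is_inj bij_is_surj surj_f_inv_f inv_inv_eq transpose_commute)
  finally show ?thesis by simp
qed

lemma skip_comp_fix: "t a = a \<Longrightarrow> skip a (f \<circ> t) = skip a f \<circ> t"
  by (simp add: skip_def fun_eq_iff)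

lemma orbit_skip:
  assumes fin: "finite X" and f: "f permutes X" and z: "z \<noteq> a"
  shows "orbit (skip a f) z = orbit f z - {a}"
proof -
  have inj: "inj f" using f by (simp add: permutes_inj)
  have g: "skip a f permutes (X - {a})" by (rule skip_permutes[OF f])
  have fin': "finite (X - {a})" using fin by simp
  note ap = skip_apply[OF inj]
  show ?thesis
  proof
    show "orbit (skip a f) z \<subseteq> orbit f z - {a}"
    proof (rule orbit_least)
      show "z \<in> orbit f z - {a}" using z orbit_refl[OF fin f] by simp
      fix w assume "w \<in> orbit f z - {a}"
      then show "skip a f w \<in> orbit f z - {a}"
        using inj by (auto simp: ap orbit.step inj_eq)
    qed
    \<comment> \<open>The set has to be closed under \<open>f\<close>, so \<open>a\<close> may be
      added only when its successor \<open>f a\<close> is already reached.\<close>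
    have "orbit f z \<subseteq> orbit (skip a f) z \<union> (if f a \<in> orbit (skip a f) z then {a} else {})"
    proof (rule orbit_least)
      show "z \<in> orbit (skip a f) z \<union> (if f a \<in> orbit (skip a f) z then {a} else {})"
        using orbit_refl[OF fin' g] by simp
      fix w assume w: "w \<in> orbit (skip a f) z \<union> (if f a \<in> orbit (skip a f) z then {a} else {})"
      show "f w \<in> orbit (skip a f) z \<union> (if f a \<in> orbit (skip a f) z then {a} else {})"
      proof (cases "w = a")
        case True
        have "a \<notin> orbit (skip a f) z"
          using \<open>orbit (skip a f) z \<subseteq> orbit f z - {a}\<close> by auto
        then show ?thesis using w True by (auto split: if_splits)
      next
        case False
        then have w': "w \<in> orbit (skip a f) z" using w by (auto split: if_splits)
        then have "skip a f w \<in> orbit (skip a f) z" by (rule orbit.step)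
        then show ?thesis using False by (auto simp: ap split: if_splits)
      qed
    qed
    then show "orbit f z - {a} \<subseteq> orbit (skip a f) z" by (auto split: if_splits)
  qed
qed

lemma skip_skip:
  assumes "finite X" "f permutes X" "x \<noteq> y"
  shows "skip y (skip x f) permutes (X - {x, y})"
    and "z \<notin> {x, y} \<Longrightarrow> orbit (skip y (skip x f)) z = orbit f z - {x, y}"
proof -
  have "skip x f permutes (X - {x})" using assms by (simp add: skip_permutes)
  then show "skip y (skip x f) permutes (X - {x, y})"
    using skip_permutes[of "skip x f" "X - {x}" y] by (simp add: Diff_insert2[symmetric] insert_commute)
  show "orbit (skip y (skip x f)) z = orbit f z - {x, y}" if "z \<notin> {x, y}"
    using that orbit_skip[OF _ \<open>skip x f permutes (X - {x})\<close>, of z y] orbit_skip[OF assms(1,2), of z x] assms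
    by auto
qed

text \<open>Here \<open>\<sigma>\<close> is the boundary permutation of the positive half-edges, \<open>\<tau>\<close> is \<open>s\<^sub>0\<^bsup>-2\<^esup>\<close>, and \<open>\<sigma>\<^bsup>-1\<^esup> \<tau>\<close>
  walks along the negative boundary.\<close>

definition gluings :: "'a set \<Rightarrow> ('a \<Rightarrow> 'a) \<Rightarrow> ('a \<Rightarrow> 'a) set" where
  "gluings X \<sigma> = {\<tau>. \<tau> permutes X \<and> (\<forall>x\<in>X. \<tau> (\<tau> x) = x \<and> \<tau> x \<noteq> x) \<and>
     (\<forall>x\<in>X. \<forall>y\<in>X. y \<in> orbit (inv \<sigma> \<circ> \<tau>) x)}"

text \<open>The cycle type of \<open>f\<close> on \<open>X\<close>, each fixed point counting as a
  cycle of length 1.\<close>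

definition orbit_sizes :: "'a set \<Rightarrow> ('a \<Rightarrow> 'a) \<Rightarrow> nat multiset" where
  "orbit_sizes X f = image_mset card (mset_set (orbit f ` X))"

section \<open>Cutting a pair of points out of a gluing\<close>

lemma finite_gluings: "finite X \<Longrightarrow> finite (gluings X \<sigma>)"
  by (rule finite_subset[OF _ finite_permutations[of X]]) (auto simp: gluings_def)

text \<open>The excluded cases are those in which an orbit of \<open>\<sigma>\<^bsup>-1\<^esup> \<tau>\<close> is contained in \<open>{x, y}\<close>, and so is lost by
  the first return map.\<close>

lemma gluings_cut:
  assumes fin: "finite X" and s: "\<sigma> permutes X" and xy: "x \<in> X" "y \<in> X" "x \<noteq> y" and "card X > 2"
    and nb: "\<not> (\<sigma> x = y \<or> \<sigma> y = x \<or> \<sigma> x = x \<and> \<sigma> y = y)"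
  shows "bij_betw (\<lambda>\<tau>. \<tau> \<circ> swap x y) {\<tau> \<in> gluings X \<sigma>. \<tau> x = y}
           (gluings (X - {x, y}) (skip y (skip x (swap x y \<circ> \<sigma>))))"
proof -
  define X' where "X' = X - {x, y}"
  define s' where "s' = skip y (skip x (swap x y \<circ> \<sigma>))"
  have finX': "finite X'" using fin by (simp add: X'_def)
  have ne: "X' \<noteq> {}"
  proof
    assume "X' = {}" then have "X \<subseteq> {x, y}" by (auto simp: X'_def)
    then have "card X \<le> card {x, y}" by (simp add: card_mono)
    then show False using assms(6) by (simp add: card_insert_if split: if_splits)
  qed
  have sw: "swap x y permutes X" using xy by (simp add: permutes_swap_id)
  have sx: "swap x y \<circ> \<sigma> permutes X" using s sw by (rule permutes_compose)
  have b1: "bij (swap x y \<circ> \<sigma>)" using sx permutes_bij by auto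
  have bs: "bij \<sigma>" using s permutes_bij by auto
  have b2: "bij (skip x (swap x y \<circ> \<sigma>))" using skip_permutes[OF sx] permutes_bij by blast
  \<comment> \<open>The negative walk of the cut gluing is the first return map of the original
    negative walk. The transposition can be moved from the pairing to \<open>\<sigma>\<close>
    because \<open>t\<close> fixes \<open>x\<close> and \<open>y\<close> and hence commutes with
    it.\<close>
  have key: "inv s' \<circ> t = skip y (skip x (inv \<sigma> \<circ> (t \<circ> swap x y)))"
    if t: "t permutes X'" for t
  proof -
    have t2: "t x = x" "t y = y" using t by (auto simp: permutes_def X'_def)
    have comm: "t \<circ> swap x y = swap x y \<circ> t"
    proof
      fix z
      have "t z = x \<longleftrightarrow> z = x" "t z = y \<longleftrightarrow> z = y" using t2 t
        by (metis permutes_inj inj_eq)+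
      then show "(t \<circ> swap x y) z = (swap x y \<circ> t) z" using t2 by (auto simp: Transposition.transpose_def)
    qed
    have "inv s' = skip y (skip x (inv (swap x y \<circ> \<sigma>)))"
      unfolding s'_def by (simp add: skip_inv[OF b2, symmetric] skip_inv[OF b1, symmetric])
    also have "inv (swap x y \<circ> \<sigma>) = inv \<sigma> \<circ> swap x y" using bs by (simp add: o_inv_distrib)
    finally have "inv s' \<circ> t = skip y (skip x (inv \<sigma> \<circ> swap x y)) \<circ> t" by (simp only:)
    also have "\<dots> = skip y (skip x ((inv \<sigma> \<circ> swap x y) \<circ> t))"
      using t2 by (simp only: skip_comp_fix)
    also have "(inv \<sigma> \<circ> swap x y) \<circ> t = inv \<sigma> \<circ> (t \<circ> swap x y)"
      using comm by (simp add: o_assoc)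
    finally show ?thesis .
  qed
  have perm: "t \<circ> swap x y permutes X" if "t permutes X'" for t
    using that sw permutes_subset[OF that, of X] by (intro permutes_compose) (auto simp: X'_def)
  have gperm: "inv \<sigma> \<circ> (t \<circ> swap x y) permutes X" if "t permutes X'" for t
    using permutes_compose[OF perm[OF that] permutes_inv[OF s]] .
  have orb: "orbit (inv s' \<circ> t) z = orbit (inv \<sigma> \<circ> (t \<circ> swap x y)) z - {x, y}"
    if "t permutes X'" "z \<in> X'" for t z
    unfolding key[OF that(1)] using skip_skip(2)[OF fin gperm[OF that(1)] xy(3)] that(2)
    by (simp add: X'_def)
  have fw: "\<tau> \<circ> swap x y \<in> gluings X' s'" if "\<tau> \<in> gluings X \<sigma>" "\<tau> x = y" for \<tau>
  proof -
    have tp: "\<tau> permutes X" and inv: "\<And>z. z \<in> X \<Longrightarrow> \<tau> (\<tau> z) = z" "\<And>z. z \<in> X \<Longrightarrow> \<tau> z \<noteq> z"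
      and tr: "\<And>z w. z \<in> X \<Longrightarrow> w \<in> X \<Longrightarrow> w \<in> orbit (inv \<sigma> \<circ> \<tau>) z"
      using that by (auto simp: gluings_def)
    have ty: "\<tau> y = x" using inv(1)[of x] that xy by simp
    have "\<tau> \<circ> swap x y permutes X" using tp sw by (simp add: permutes_compose)
    moreover have "\<And>z. z \<in> X - X' \<Longrightarrow> (\<tau> \<circ> swap x y) z = z"
      using ty that by (auto simp: X'_def)
    ultimately have p: "\<tau> \<circ> swap x y permutes X'" by (metis permutes_superset)
    have eq: "\<tau> \<circ> swap x y \<circ> swap x y = \<tau>" by (simp add: fun_eq_iff)
    have "w \<in> orbit (inv s' \<circ> (\<tau> \<circ> swap x y)) z" if "z \<in> X'" "w \<in> X'" for z w
      using orb[OF p that(1)] tr[of z w] that unfolding eq by (auto simp: X'_def)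
    moreover have "(\<tau> \<circ> swap x y) ((\<tau> \<circ> swap x y) z) = z \<and> (\<tau> \<circ> swap x y) z \<noteq> z" if "z \<in> X'" for z
    proof -
      have "(\<tau> \<circ> swap x y) z \<in> X'" using permutes_in_image[OF p] that by blast
      then have "\<tau> z \<in> X'" using that by (auto simp: X'_def)
      then show ?thesis using that inv by (auto simp: X'_def)
    qed
    ultimately show ?thesis using p by (auto simp: gluings_def)
  qed
  have bw: "t \<circ> swap x y \<in> {\<tau> \<in> gluings X \<sigma>. \<tau> x = y}" if "t \<in> gluings X' s'" for t
  proof -
    have p: "t permutes X'" and inv: "\<And>z. z \<in> X' \<Longrightarrow> t (t z) = z" "\<And>z. z \<in> X' \<Longrightarrow> t z \<noteq> z"
      and tr: "\<And>z w. z \<in> X' \<Longrightarrow> w \<in> X' \<Longrightarrow> w \<in> orbit (inv s' \<circ> t) z"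
      using that by (auto simp: gluings_def)
    define \<tau> where "\<tau> = t \<circ> swap x y"
    define \<gamma> where "\<gamma> = inv \<sigma> \<circ> \<tau>"
    have gp: "\<gamma> permutes X" using gperm[OF p] by (simp add: \<gamma>_def \<tau>_def)
    have t2: "t x = x" "t y = y" using p by (auto simp: permutes_def X'_def)
    have \<tau>2: "\<tau> x = y" "\<tau> y = x" using t2 by (auto simp: \<tau>_def)
    have \<tau>3: "\<tau> z = t z" if "z \<in> X'" for z using that by (auto simp: \<tau>_def X'_def)
    have tin: "t z \<in> X'" if "z \<in> X'" for z using that p by (simp add: permutes_in_image)
    have orb': "X' \<subseteq> orbit \<gamma> z" if "z \<in> X'" for z
      using orb[OF p that] tr that unfolding \<gamma>_def \<tau>_def by auto
    have gx: "\<gamma> x = inv \<sigma> y" "\<gamma> y = inv \<sigma> x" by (auto simp: \<gamma>_def \<tau>2)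
    \<comment> \<open>An orbit inside \<open>{x, y}\<close> is a fixed point or a 2-cycle of
      \<open>\<gamma>\<close>. As \<open>\<gamma> x = inv \<sigma> y\<close> and
      \<open>\<gamma> y = inv \<sigma> x\<close>, these are the three excluded cases. Hence every
      orbit of \<open>\<gamma>\<close> meets \<open>X'\<close>, where the walk is already known to
      be transitive.\<close>
    have meets: "orbit \<gamma> a \<inter> X' \<noteq> {}" if "a \<in> {x, y}" for a
    proof
      assume em: "orbit \<gamma> a \<inter> X' = {}"
      have "orbit \<gamma> a \<subseteq> X" using orbit_in[OF fin gp] that xy by auto
      then have sub: "orbit \<gamma> a \<subseteq> {x, y}" using em by (auto simp: X'_def)
      have "\<gamma> a \<in> {x, y}" "\<gamma> (\<gamma> a) \<in> {x, y}" using sub orbit.base[of \<gamma> a] orbit.step[OF orbit.base[of \<gamma> a]] by auto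
      moreover have "inj \<gamma>" using gp permutes_inj by auto
      ultimately have "\<gamma> x = x \<or> \<gamma> y = y \<or> (\<gamma> x = y \<and> \<gamma> y = x)"
        using that xy(3) by (auto simp: inj_eq) 
      then show False using nb bs unfolding gx by (metis bij_inv_eq_iff)
    qed
    have tr': "w \<in> orbit \<gamma> z" if "z \<in> X" "w \<in> X" for z w
    proof -
      obtain z0 where z0: "z0 \<in> X'" using ne by auto
      have "u \<in> orbit \<gamma> z0" if "u \<in> X" for u
      proof (cases "u \<in> X'")
        case True then show ?thesis using orb'[OF z0] by auto
      next
        case False
        then have "u \<in> {x, y}" using that by (auto simp: X'_def)
        then obtain v where "v \<in> orbit \<gamma> u" "v \<in> X'" using meets by blast
        then show ?thesis using orb'[OF z0] orbit_eq_orbit[OF fin gp] orbit_refl[OF fin gp, of u] by (metis subsetD)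
      qed
      then show ?thesis using that orbit_eq_orbit[OF fin gp] by blast
    qed
    have "\<tau> (\<tau> z) = z \<and> \<tau> z \<noteq> z" if "z \<in> X" for z
    proof (cases "z \<in> X'")
      case True then show ?thesis using inv tin \<tau>3 by auto
    next
      case False then have "z = x \<or> z = y" using that by (auto simp: X'_def)
      then show ?thesis using \<tau>2 xy by auto
    qed
    then show ?thesis using perm[OF p] tr' \<tau>2 unfolding \<gamma>_def by (auto simp: gluings_def \<tau>_def)
  qed
  show ?thesis unfolding X'_def[symmetric] s'_def[symmetric]
    by (rule bij_betw_byWitness[where f' = "\<lambda>t. t \<circ> swap x y"]) (use fw bw in \<open>auto simp: fun_eq_iff\<close>)
qed

text \<open>In each excluded case the negative walk has an orbit inside \<open>{x, y}\<close>. It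
  cannot be all of \<open>X\<close>, which has more than two points.\<close>

lemma gluings_cut_empty:
  assumes fin: "finite X" and s: "\<sigma> permutes X" and xy: "x \<in> X" "y \<in> X" "x \<noteq> y" and c: "card X > 2"
    and bad: "\<sigma> x = y \<or> \<sigma> y = x \<or> \<sigma> x = x \<and> \<sigma> y = y"
  shows "{\<tau> \<in> gluings X \<sigma>. \<tau> x = y} = {}"
proof (safe, simp)
  fix \<tau> assume t: "\<tau> \<in> gluings X \<sigma>" and y: "y = \<tau> x"
  have bs: "bij \<sigma>" using s permutes_bij by auto
  have ty: "\<tau> y = x" using t xy y by (auto simp: gluings_def)
  define \<gamma> where "\<gamma> = inv \<sigma> \<circ> \<tau>"
  have gx: "\<gamma> x = inv \<sigma> y" "\<gamma> y = inv \<sigma> x" using y ty by (auto simp: \<gamma>_def)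
  have "\<gamma> x = x \<or> \<gamma> y = y \<or> (\<gamma> x = y \<and> \<gamma> y = x)"
    using bad bs unfolding gx by (metis bij_inv_eq_iff)
  then obtain a where "a \<in> {x, y}" "orbit \<gamma> a \<subseteq> {x, y}"
  proof (elim disjE)
    assume "\<gamma> x = x" then show ?thesis using that[of x] orbit_least[of x "{x,y}" \<gamma>] orbit_least[of x "{x}" \<gamma>] by auto
  next
    assume "\<gamma> y = y" then show ?thesis using that[of y] orbit_least[of y "{y}" \<gamma>] by auto
  next
    assume "\<gamma> x = y \<and> \<gamma> y = x" then show ?thesis using that[of x] orbit_least[of x "{x,y}" \<gamma>] by auto
  qed
  moreover have "X \<subseteq> orbit \<gamma> a" using t xy calculation(1) by (auto simp: gluings_def \<gamma>_def)
  ultimately have "X \<subseteq> {x, y}" by auto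
  then have "card X \<le> card {x, y}" by (simp add: card_mono)
  then show False using c by (simp add: card_insert_if split: if_splits)
qed

section \<open>Powers along a cycle, and conjugacy of permutations\<close>

lemma funpow_eq_iff_card_orbit_dvd:
  assumes fin: "finite X" and f: "f permutes X" and "m \<le> n"
  shows "(f ^^ m) x = (f ^^ n) x \<longleftrightarrow> card (orbit f x) dvd (n - m)"
    and "orbit f x = (\<lambda>i. (f ^^ i) x) ` {..<card (orbit f x)}"
    and "inj_on (\<lambda>i. (f ^^ i) x) {..<card (orbit f x)}"
proof -
  have pf: "permutation f" using fin f by (auto simp: permutation_permutes)
  define p where "p = least_power f x"
  have p: "(f ^^ p) x = x" "p > 0" using least_power_of_permutation[OF pf] by (auto simp: p_def)
  have A: "(f ^^ m) x = (f ^^ n) x \<longleftrightarrow> p dvd (n - m)" if "m \<le> n" for m n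
  proof -
    have "inj (f ^^ m)" using permutes_inj[OF f] by (rule inj_fn)
    moreover have "(f ^^ n) x = (f ^^ m) ((f ^^ (n - m)) x)" 
      using that by (metis comp_apply funpow_add le_add_diff_inverse)
    ultimately have "(f ^^ m) x = (f ^^ n) x \<longleftrightarrow> (f ^^ (n - m)) x = x" by (metis injD)
    also have "\<dots> \<longleftrightarrow> p dvd (n - m)"
    proof
      assume "p dvd (n - m)" then obtain k where k: "n - m = p * k" by auto
      have "((f ^^ p) ^^ k) x = x" using p by (induction k) auto
      then show "(f ^^ (n - m)) x = x" by (simp add: k funpow_mult)
    qed (simp add: p_def least_power_minimal)
    finally show ?thesis .
  qed
  have inj: "inj_on (\<lambda>i. (f ^^ i) x) {..<p}"
  proof (rule linorder_inj_onI)
    fix i j assume ij: "i < j" "i \<in> {..<p}" "j \<in> {..<p}"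
    then have "\<not> p dvd (j - i)" by (simp add: nat_dvd_not_less)
    then show "(f ^^ i) x \<noteq> (f ^^ j) x" using A[of i j] ij by simp
  qed auto
  have o: "orbit f x = (\<lambda>i. (f ^^ i) x) ` {..<p}"
  proof -
    have "(f ^^ n) x \<in> (\<lambda>i. (f ^^ i) x) ` {..<p}" for n
    proof (rule image_eqI)
      show "(f ^^ n) x = (f ^^ (n mod p)) x" using A[of "n mod p" n] by (simp add: minus_mod_eq_mult_div)
      show "n mod p \<in> {..<p}" using p by simp
    qed
    then show ?thesis by (auto simp: orbit_eq_range[OF fin f])
  qed
  have c: "card (orbit f x) = p" unfolding o using card_image[OF inj] by simp
  show "(f ^^ m) x = (f ^^ n) x \<longleftrightarrow> card (orbit f x) dvd (n - m)"
    "orbit f x = (\<lambda>i. (f ^^ i) x) ` {..<card (orbit f x)}"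
    "inj_on (\<lambda>i. (f ^^ i) x) {..<card (orbit f x)}"
    using A assms(3) o inj unfolding c by auto
qed

text \<open>Coincidences between iterates depend only on the cycle length, so they carry over
  between cycles of equal length. This makes maps defined along cycles well defined and
  injective.\<close>

lemma funpow_eq_transfer:
  assumes "finite X" "f permutes X" "finite Y" "g permutes Y" "card (orbit f x) = card (orbit g y)"
  shows "(f ^^ m) x = (f ^^ n) x \<longleftrightarrow> (g ^^ m) y = (g ^^ n) y"
proof (cases "m \<le> n")
  case True
  then show ?thesis using funpow_eq_iff_card_orbit_dvd(1)[OF assms(1,2)] funpow_eq_iff_card_orbit_dvd(1)[OF assms(3,4)] assms(5) by metis
next
  case False
  then have "n \<le> m" by simp
  then show ?thesis using funpow_eq_iff_card_orbit_dvd(1)[OF assms(1,2)] funpow_eq_iff_card_orbit_dvd(1)[OF assms(3,4)] assms(5) by metis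
qed

text \<open>Choosing one image for each cycle, in a cycle of the same length, forces
  \<open>h ((\<sigma> ^^ n) a) = (\<rho> ^^ n) (y a)\<close>. The transversal \<open>A\<close>
  carries the choices, and distinct cycles of \<open>X\<close> are sent to distinct cycles that
  exhaust \<open>Y\<close>.\<close>

lemma equivariant_extension:
  assumes X: "finite X" "\<sigma> permutes X" and Y: "finite Y" "\<rho> permutes Y"
    and A: "A \<subseteq> X" "bij_betw (orbit \<sigma>) A (orbit \<sigma> ` X)"
    and y: "y ` A \<subseteq> Y" "bij_betw (\<lambda>a. orbit \<rho> (y a)) A (orbit \<rho> ` Y)"
    and c: "\<And>a. a \<in> A \<Longrightarrow> card (orbit \<rho> (y a)) = card (orbit \<sigma> a)"
  obtains h where "bij_betw h X Y" "\<And>x. x \<in> X \<Longrightarrow> h (\<sigma> x) = \<rho> (h x)" "\<And>a. a \<in> A \<Longrightarrow> h a = y a"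
proof -
  have ex: "\<exists>a n. a \<in> A \<and> x = (\<sigma> ^^ n) a" if "x \<in> X" for x
  proof -
    have "orbit \<sigma> x \<in> orbit \<sigma> ` A" using A(2) that by (simp add: bij_betw_def)
    then obtain a where "a \<in> A" "orbit \<sigma> a = orbit \<sigma> x" by auto
    then have "x \<in> orbit \<sigma> a" using orbit_refl[OF X] by auto
    then show ?thesis using \<open>a \<in> A\<close> by (auto simp: orbit_eq_range[OF X])
  qed
  have orb_eq: "orbit \<sigma> ((\<sigma> ^^ n) a) = orbit \<sigma> a" for n a
    by (rule orbit_eq_orbit[OF X]) (auto simp: orbit_eq_range[OF X])
  have orb_eq': "orbit \<rho> ((\<rho> ^^ n) a) = orbit \<rho> a" for n a
    by (rule orbit_eq_orbit[OF Y]) (auto simp: orbit_eq_range[OF Y])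
  define P where "P x v \<longleftrightarrow> (\<exists>a n. a \<in> A \<and> x = (\<sigma> ^^ n) a \<and> v = (\<rho> ^^ n) (y a))" for x v
  have uniq: "v = w" if "P x v" "P x w" for x v w
  proof -
    from that obtain a n b m where h: "a \<in> A" "x = (\<sigma> ^^ n) a" "v = (\<rho> ^^ n) (y a)" "b \<in> A" "x = (\<sigma> ^^ m) b" "w = (\<rho> ^^ m) (y b)"
      unfolding P_def by blast
    then have "orbit \<sigma> a = orbit \<sigma> b" using orb_eq by metis
    then have "a = b" using A(2) h by (auto simp: bij_betw_def inj_on_def)
    then show ?thesis using h funpow_eq_transfer[OF X Y c[OF h(1), symmetric], of n m] by simp
  qed
  define h where "h x = (THE v. P x v)" for x
  have hP: "h x = v" if "P x v" for x v
    unfolding h_def using that uniq by (intro the_equality) auto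
  have h: "h ((\<sigma> ^^ n) a) = (\<rho> ^^ n) (y a)" if "a \<in> A" for a n
    by (rule hP) (use that in \<open>auto simp: P_def\<close>)
  have hY: "(\<rho> ^^ n) v \<in> Y" if "v \<in> Y" for n v
    using that Y(2) by (induction n) (auto simp: permutes_in_image)
  have hX: "(\<sigma> ^^ n) v \<in> X" if "v \<in> X" for n v
    using that X(2) by (induction n) (auto simp: permutes_in_image)
  have "inj_on h X"
  proof
    fix x x' assume "x \<in> X" "x' \<in> X" "h x = h x'"
    then obtain a n b m where e: "a \<in> A" "x = (\<sigma> ^^ n) a" "b \<in> A" "x' = (\<sigma> ^^ m) b" using ex by metis
    then have e2: "(\<rho> ^^ n) (y a) = (\<rho> ^^ m) (y b)" using h \<open>h x = h x'\<close> by simp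
    then have "orbit \<rho> (y a) = orbit \<rho> (y b)" using orb_eq' by metis
    then have "a = b" using y(2) e by (auto simp: bij_betw_def inj_on_def)
    then show "x = x'" using e e2 funpow_eq_transfer[OF X Y c[OF e(1), symmetric], of n m] by simp
  qed
  moreover have "h ` X = Y"
  proof
    show "h ` X \<subseteq> Y"
    proof safe
      fix x assume "x \<in> X" then obtain a n where "a \<in> A" "x = (\<sigma> ^^ n) a" using ex by metis
      then show "h x \<in> Y" using h hY y(1) by auto
    qed
    show "Y \<subseteq> h ` X"
    proof
      fix v assume v: "v \<in> Y"
      then have "orbit \<rho> v \<in> (\<lambda>a. orbit \<rho> (y a)) ` A" using y(2) by (simp add: bij_betw_def)
      then obtain a where a: "a \<in> A" "orbit \<rho> (y a) = orbit \<rho> v" by auto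
      then have "v \<in> orbit \<rho> (y a)" using orbit_refl[OF Y] by auto
      then obtain n where "v = (\<rho> ^^ n) (y a)" by (auto simp: orbit_eq_range[OF Y])
      then show "v \<in> h ` X" using h[OF a(1), of n] hX A(1) a(1) by (metis image_eqI subsetD)
    qed
  qed
  moreover have "h (\<sigma> x) = \<rho> (h x)" if x: "x \<in> X" for x
  proof -
    obtain a n where e: "a \<in> A" "x = (\<sigma> ^^ n) a" using ex x by metis
    show ?thesis using h[OF e(1), of n] h[OF e(1), of "Suc n"] e by simp
  qed
  moreover have "h a = y a" if "a \<in> A" for a using h[OF that, of 0] by simp
  ultimately show ?thesis using that by (auto simp: bij_betw_def)
qed

lemma orbit_transversal:
  assumes "finite X" "\<sigma> permutes X"
  obtains A where "A \<subseteq> X" "bij_betw (orbit \<sigma>) A (orbit \<sigma> ` X)"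
proof -
  obtain A where "A \<subseteq> X" "inj_on (orbit \<sigma>) A" "orbit \<sigma> ` A = orbit \<sigma> ` X"
    by (metis subset_image_inj subset_refl)
  then show ?thesis using that by (auto simp: bij_betw_def)
qed

lemma bij_betw_of_image_mset_eq:
  assumes "finite A" "finite B" "image_mset f (mset_set A) = image_mset g (mset_set B)"
  obtains h where "bij_betw h A B" "\<And>a. a \<in> A \<Longrightarrow> g (h a) = f a"
proof -
  obtain xs where xs: "set xs = A" "distinct xs" using assms(1) finite_distinct_list by auto
  obtain ys where ys: "set ys = B" "distinct ys" using assms(2) finite_distinct_list by auto
  have "mset xs = mset_set A" "mset ys = mset_set B" using xs ys by (auto simp: mset_set_set[symmetric])
  then have "mset (map f xs) = mset (map g ys)" using assms(3) by simp
  from permutation_Ex_bij[OF this] obtain p where p: "bij_betw p {..<length xs} {..<length ys}"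
    "\<And>i. i < length xs \<Longrightarrow> map f xs ! i = map g ys ! p i" by auto
  have bx: "bij_betw ((!) xs) {..<length xs} A" by (rule bij_betw_nth) (use xs in auto)
  have "bij_betw ((!) ys \<circ> p \<circ> inv_into {..<length xs} ((!) xs)) A B"
    by (intro bij_betw_trans[OF bij_betw_inv_into[OF bx]] bij_betw_trans[OF p(1)] bij_betw_nth) (use ys in auto)
  moreover have "g (((!) ys \<circ> p \<circ> inv_into {..<length xs} ((!) xs)) a) = f a" if a: "a \<in> A" for a
  proof -
    define i where "i = inv_into {..<length xs} ((!) xs) a"
    have i: "i < length xs" "xs ! i = a" unfolding i_def
      using bij_betw_apply[OF bij_betw_inv_into[OF bx] a] bij_betw_inv_into_right[OF bx a] by auto
    moreover have "p i < length ys" using bij_betw_apply[OF p(1)] i by auto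
    ultimately show ?thesis using p(2)[of i] by (simp add: i_def)
  qed
  ultimately show ?thesis using that by blast
qed

text \<open>Match the cycles by length, choose a starting point in each of them and its partner, and
  extend equivariantly.\<close>

lemma conjugate_of_orbit_sizes_eq:
  assumes X: "finite X" "\<sigma> permutes X" and Y: "finite Y" "\<rho> permutes Y"
    and eq: "orbit_sizes X \<sigma> = orbit_sizes Y \<rho>"
  obtains h where "bij_betw h X Y" "\<And>x. x \<in> X \<Longrightarrow> h (\<sigma> x) = \<rho> (h x)"
proof -
  obtain f where f: "bij_betw f (orbit \<sigma> ` X) (orbit \<rho> ` Y)" "\<And>a. a \<in> orbit \<sigma> ` X \<Longrightarrow> card (f a) = card a"
    using bij_betw_of_image_mset_eq[of "orbit \<sigma> ` X" "orbit \<rho> ` Y" card card] X Y eq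
    by (auto simp: orbit_sizes_def)
  obtain A where A: "A \<subseteq> X" "bij_betw (orbit \<sigma>) A (orbit \<sigma> ` X)" by (rule orbit_transversal[OF X]) blast
  have "\<exists>y. y \<in> Y \<and> orbit \<rho> y = f (orbit \<sigma> a)" if "a \<in> A" for a
  proof -
    have "f (orbit \<sigma> a) \<in> orbit \<rho> ` Y" using bij_betw_apply[OF f(1)] A(1) that by auto
    then show ?thesis by auto
  qed
  then obtain y where y: "\<And>a. a \<in> A \<Longrightarrow> y a \<in> Y \<and> orbit \<rho> (y a) = f (orbit \<sigma> a)" by metis
  have "bij_betw (\<lambda>a. orbit \<rho> (y a)) A (orbit \<rho> ` Y)"
    using bij_betw_trans[OF A(2) f(1)] by (rule bij_betw_cong[THEN iffD1, rotated]) (use y in auto)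
  moreover have "card (orbit \<rho> (y a)) = card (orbit \<sigma> a)" if "a \<in> A" for a
    using that y f(2) A by auto
  ultimately show ?thesis using equivariant_extension[OF X Y A, of y] y that by (metis image_subsetI)
qed

text \<open>The basic tool for comparing orbits. With \<open>h = id\<close> it compares two maps
  that agree on \<open>X\<close>; otherwise \<open>h\<close> is a conjugation such as an
  isomorphism, \<open>s1\<close>, or doubling.\<close>

lemma orbit_image:
  assumes x: "x \<in> X" and g: "\<And>z. z \<in> X \<Longrightarrow> g z \<in> X \<and> h (g z) = g' (h z)"
  shows "orbit g' (h x) = h ` orbit g x"
proof
  have sub: "orbit g x \<subseteq> X"
  proof
    fix z assume "z \<in> orbit g x" then show "z \<in> X" by induction (use x g in auto)
  qed
  show "orbit g' (h x) \<subseteq> h ` orbit g x"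
  proof
    fix z assume "z \<in> orbit g' (h x)" then show "z \<in> h ` orbit g x"
    proof induction
      case base then show ?case using g[OF x] orbit.base[of g x] by (metis image_eqI)
    next
      case (step z) then obtain w where "z = h w" "w \<in> orbit g x" by auto
      then show ?case using g[of w] sub orbit.step[of w g x] by (metis image_eqI subsetD)
    qed
  qed
  show "h ` orbit g x \<subseteq> orbit g' (h x)"
  proof safe
    fix z assume "z \<in> orbit g x" then show "h z \<in> orbit g' (h x)"
    proof induction
      case base then show ?case using g[OF x] orbit.base[of g' "h x"] by simp
    next
      case (step z) then show ?case using g[of z] sub orbit.step[of "h z" g' "h x"] by auto
    qed
  qed
qed

section \<open>Gluing numbers as a function of the cycle type\<close>

lemma gluings_conjugate:
  assumes X: "finite X" "\<sigma> permutes X" and Y: "finite Y" "\<rho> permutes Y"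
    and h: "bij_betw h X Y" "\<And>x. x \<in> X \<Longrightarrow> h (\<sigma> x) = \<rho> (h x)"
    and t: "\<tau> permutes X" "\<tau>' permutes Y" "\<And>x. x \<in> X \<Longrightarrow> h (\<tau> x) = \<tau>' (h x)"
  shows "\<tau> \<in> gluings X \<sigma> \<longleftrightarrow> \<tau>' \<in> gluings Y \<rho>"
proof -
  have hY: "Y = h ` X" and inj: "inj_on h X" using h(1) by (auto simp: bij_betw_def)
  have tX: "\<tau> x \<in> X" if "x \<in> X" for x using that t(1) by (simp add: permutes_in_image)
  have sX: "inv \<sigma> x \<in> X" if "x \<in> X" for x using that permutes_inv[OF X(2)] by (simp add: permutes_in_image)
  have hs: "h (inv \<sigma> x) = inv \<rho> (h x)" if "x \<in> X" for x
    using h(2)[OF sX[OF that]] X(2) Y(2) by (metis permutes_inverses)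
  have orb: "orbit (inv \<rho> \<circ> \<tau>') (h x) = h ` orbit (inv \<sigma> \<circ> \<tau>) x" if "x \<in> X" for x
    by (rule orbit_image[OF that]) (use tX sX hs t(3) in auto)
  have osub: "orbit (inv \<sigma> \<circ> \<tau>) x \<subseteq> X" if "x \<in> X" for x
    using that permutes_compose[OF t(1) permutes_inv[OF X(2)]] orbit_in[OF X(1)] by blast
  have "h y \<in> orbit (inv \<rho> \<circ> \<tau>') (h x) \<longleftrightarrow> y \<in> orbit (inv \<sigma> \<circ> \<tau>) x" if "x \<in> X" "y \<in> X" for x y
    unfolding orb[OF that(1)] using that osub inj by (auto simp: inj_on_def) 
  moreover have "\<tau>' (\<tau>' (h x)) = h x \<longleftrightarrow> \<tau> (\<tau> x) = x" if "x \<in> X" for x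
    using that tX t(3) inj by (metis inj_onD)
  moreover have "\<tau>' (h x) = h x \<longleftrightarrow> \<tau> x = x" if "x \<in> X" for x
    using that tX t(3) inj by (metis inj_onD)
  ultimately show ?thesis using t(1,2) by (auto simp: gluings_def hY)
qed

lemma card_gluings_conjugate:
  assumes X: "finite X" "\<sigma> permutes X" and Y: "finite Y" "\<rho> permutes Y"
    and h: "bij_betw h X Y" "\<And>x. x \<in> X \<Longrightarrow> h (\<sigma> x) = \<rho> (h x)"
  shows "card (gluings X \<sigma>) = card (gluings Y \<rho>)"
proof -
  let ?F = "\<lambda>\<pi> x. if x \<in> Y then h (\<pi> (inv_into X h x)) else x"
  have b: "bij_betw ?F {\<pi>. \<pi> permutes X} {\<pi>. \<pi> permutes Y}" by (rule bij_betw_permutations[OF h(1)])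
  have F: "?F \<tau> (h x) = h (\<tau> x)" if "x \<in> X" for x \<tau>
    using that h(1) by (auto simp: bij_betw_def)
  have iff: "\<tau> \<in> gluings X \<sigma> \<longleftrightarrow> ?F \<tau> \<in> gluings Y \<rho>" if "\<tau> permutes X" for \<tau>
    using gluings_conjugate[OF X Y h that, of "?F \<tau>"] b that F by (auto simp: bij_betw_def)
  have "bij_betw ?F (gluings X \<sigma>) (gluings Y \<rho>)"
  proof (rule bij_betw_subset[OF b])
    show "gluings X \<sigma> \<subseteq> {\<pi>. \<pi> permutes X}" by (auto simp: gluings_def)
    show "?F ` gluings X \<sigma> = gluings Y \<rho>"
    proof
      have "?F t \<in> gluings Y \<rho>" if "t \<in> gluings X \<sigma>" for t
      proof -
        have "t permutes X" using that by (simp add: gluings_def)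
        then show ?thesis using iff that by blast
      qed
      then show "?F ` gluings X \<sigma> \<subseteq> gluings Y \<rho>" by blast
      show "gluings Y \<rho> \<subseteq> ?F ` gluings X \<sigma>"
      proof
        fix t assume t: "t \<in> gluings Y \<rho>"
        then have "t \<in> ?F ` {\<pi>. \<pi> permutes X}" using b by (auto simp: bij_betw_def gluings_def)
        then show "t \<in> ?F ` gluings X \<sigma>" using iff t by auto
      qed
    qed
  qed
  then show ?thesis by (rule bij_betw_same_card)
qed

text \<open>The supremum is over at most one value; it is 0 if no permutation has orbit sizes \<open>M\<close>.\<close>

definition gl :: "nat multiset \<Rightarrow> nat" where
  "gl M = Sup {card (gluings X \<sigma>) | (X :: nat set) \<sigma>. finite X \<and> \<sigma> permutes X \<and> orbit_sizes X \<sigma> = M}"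

lemma orbit_sizes_transport:
  assumes X: "finite X" "\<sigma> permutes X"
    and Y: "\<rho> permutes Y" and h: "bij_betw h X Y" "\<And>x. x \<in> X \<Longrightarrow> h (\<sigma> x) = \<rho> (h x)"
  shows "orbit_sizes Y \<rho> = orbit_sizes X \<sigma>"
proof -
  have inj: "inj_on h X" using h by (simp add: bij_betw_def)
  have oi: "orbit \<rho> (h x) = h ` orbit \<sigma> x" if "x \<in> X" for x
    by (rule orbit_image[OF that]) (use h X in \<open>auto simp: permutes_in_image\<close>)
  have "orbit \<rho> ` Y = ((`) h) ` (orbit \<sigma> ` X)"
    using h(1) oi by (auto simp: bij_betw_def image_image intro!: image_cong)
  moreover have sub: "B \<subseteq> X" if "B \<in> orbit \<sigma> ` X" for B using that orbit_in[OF X] by auto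
  moreover have "inj_on ((`) h) (orbit \<sigma> ` X)"
    using sub inj by (intro inj_onI) (metis inj_on_image_eq_iff)
  ultimately have "mset_set (orbit \<rho> ` Y) = image_mset ((`) h) (mset_set (orbit \<sigma> ` X))"
    by (simp add: image_mset_mset_set)
  then have "orbit_sizes Y \<rho> = image_mset (\<lambda>B. card (h ` B)) (mset_set (orbit \<sigma> ` X))"
    by (simp add: orbit_sizes_def image_mset.compositionality o_def)
  also have "\<dots> = orbit_sizes X \<sigma>" unfolding orbit_sizes_def
    by (intro image_mset_cong) (use X sub inj in \<open>auto intro!: card_image intro: inj_on_subset\<close>)
  finally show ?thesis .
qed

text \<open>\<open>gl\<close> only ranges over sets of natural numbers. Transport makes its value
  available for gluings over any type.\<close>

lemma transport_to_nat:
  assumes X: "finite X" "\<sigma> permutes X"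
  obtains Y :: "nat set" and \<rho> h where "finite Y" "\<rho> permutes Y" "bij_betw h X Y"
    "\<And>x. x \<in> X \<Longrightarrow> h (\<sigma> x) = \<rho> (h x)"
proof -
  obtain h and Y :: "nat set" where h: "bij_betw h X Y" "finite Y" using X(1)
    by (metis ex_bij_betw_finite_nat bij_betw_finite)
  let ?F = "\<lambda>\<pi> x. if x \<in> Y then h (\<pi> (inv_into X h x)) else x"
  have "?F \<sigma> permutes Y" using bij_betw_permutations[OF h(1)] X(2) by (auto simp: bij_betw_def)
  moreover have "?F \<sigma> (h x) = h (\<sigma> x)" if "x \<in> X" for x
    using that h(1) by (auto simp: bij_betw_def)
  ultimately show ?thesis using that[OF h(2) _ h(1), of "?F \<sigma>"] by simp
qed

text \<open>Permutations of the same cycle type are conjugate and so have equally many gluings. The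
  set in the definition of \<open>gl\<close> is therefore a singleton, nonempty by
  transport.\<close>

lemma card_gluings_eq_gl:
  assumes X: "finite X" "\<sigma> permutes X"
  shows "card (gluings X \<sigma>) = gl (orbit_sizes X \<sigma>)"
proof -
  let ?S = "{card (gluings Y \<rho>) | (Y :: nat set) \<rho>. finite Y \<and> \<rho> permutes Y \<and> orbit_sizes Y \<rho> = orbit_sizes X \<sigma>}"
  obtain Y :: "nat set" and \<rho> h where Y: "finite Y" "\<rho> permutes Y" "bij_betw h X Y"
    "\<And>x. x \<in> X \<Longrightarrow> h (\<sigma> x) = \<rho> (h x)" by (rule transport_to_nat[OF X]) blast
  have "?S = {card (gluings X \<sigma>)}"
  proof (intro equalityI subsetI)
    fix c assume "c \<in> ?S"
    then obtain Z :: "nat set" and \<pi> where Z: "finite Z" "\<pi> permutes Z" "orbit_sizes Z \<pi> = orbit_sizes X \<sigma>"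
      "c = card (gluings Z \<pi>)" by auto
    obtain k where "bij_betw k X Z" "\<And>x. x \<in> X \<Longrightarrow> k (\<sigma> x) = \<pi> (k x)"
      by (rule conjugate_of_orbit_sizes_eq[OF X Z(1,2) Z(3)[symmetric]]) blast
    from card_gluings_conjugate[OF X Z(1,2) this] show "c \<in> {card (gluings X \<sigma>)}" using Z by simp
  next
    fix c assume "c \<in> {card (gluings X \<sigma>)}"
    then have "c = card (gluings Y \<rho>)" using card_gluings_conjugate[OF X Y] by simp
    then show "c \<in> ?S" using Y orbit_sizes_transport[OF X Y(2,3,4)] by blast
  qed
  then show ?thesis by (simp add: gl_def)
qed

lemma orbit_sizes_pos:
  assumes "finite X" "\<sigma> permutes X" shows "0 \<notin># orbit_sizes X \<sigma>"
proof
  assume "0 \<in># orbit_sizes X \<sigma>"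
  then obtain x where "x \<in> X" "card (orbit \<sigma> x) = 0" using assms(1) by (auto simp: orbit_sizes_def)
  moreover have "finite (orbit \<sigma> x)" "orbit \<sigma> x \<noteq> {}"
    using orbit_in[OF assms \<open>x \<in> X\<close>] assms(1) finite_subset orbit_refl[OF assms, of x] by auto
  ultimately show False by auto
qed

lemma gl_zero:
  assumes "0 \<in># M" shows "gl M = 0"
proof -
  have "{card (gluings X \<sigma>) | (X :: nat set) \<sigma>. finite X \<and> \<sigma> permutes X \<and> orbit_sizes X \<sigma> = M} = {}"
    using assms orbit_sizes_pos by blast
  then show ?thesis unfolding gl_def by (simp only: Sup_nat_empty)
qed

section \<open>Cycles after composition with a transposition\<close>

lemma orbit_swap_comp_other:
  assumes X: "finite X" "\<sigma> permutes X" and "x \<notin> orbit \<sigma> z" "y \<notin> orbit \<sigma> z"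
  shows "orbit (swap x y \<circ> \<sigma>) z = orbit \<sigma> z"
proof -
  have "orbit (swap x y \<circ> \<sigma>) (id z) = id ` orbit \<sigma> z"
  proof (rule orbit_image[where X = "orbit \<sigma> z"])
    show "z \<in> orbit \<sigma> z" using orbit_refl[OF X] .
    fix w assume "w \<in> orbit \<sigma> z"
    then have "\<sigma> w \<in> orbit \<sigma> z" by (rule orbit.step)
    moreover from this have "\<sigma> w \<noteq> x" "\<sigma> w \<noteq> y" using assms by auto
    ultimately show "\<sigma> w \<in> orbit \<sigma> z \<and> id (\<sigma> w) = (swap x y \<circ> \<sigma>) (id w)" by simp
  qed
  then show ?thesis by simp
qed

lemma orbit_swap_comp_merge:
  assumes X: "finite X" "\<sigma> permutes X" and xy: "x \<in> X" "y \<in> X" and n: "y \<notin> orbit \<sigma> x"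
  shows "orbit (swap x y \<circ> \<sigma>) x = orbit \<sigma> x \<union> orbit \<sigma> y"
proof -
  define f where "f = swap x y \<circ> \<sigma>"
  have f: "f permutes X" unfolding f_def
    using permutes_compose[OF X(2) permutes_swap_id[OF xy]] .
  have sf: "\<sigma> w = swap x y (f w)" for w by (simp add: f_def)
  have fs: "f w = swap x y (\<sigma> w)" for w by (simp add: f_def)
  have sub: "orbit f x \<subseteq> orbit \<sigma> x \<union> orbit \<sigma> y"
  proof (rule orbit_least)
    show "x \<in> orbit \<sigma> x \<union> orbit \<sigma> y" using orbit_refl[OF X] by simp
    fix w assume "w \<in> orbit \<sigma> x \<union> orbit \<sigma> y"
    then have "\<sigma> w \<in> orbit \<sigma> x \<union> orbit \<sigma> y" by (auto intro: orbit.step)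
    then show "f w \<in> orbit \<sigma> x \<union> orbit \<sigma> y"
      using orbit_refl[OF X] by (auto simp: fs Transposition.transpose_def)
  qed
  \<comment> \<open>If \<open>y\<close> were missed, \<open>f\<close> and \<open>\<sigma>\<close>
    would agree on the orbit as long as it does not return to \<open>x\<close>, so it would stay
    inside \<open>orbit \<sigma> x\<close>. But \<open>\<sigma>\<close> sends its last point
    \<open>inv f x\<close> to \<open>y\<close>.\<close>
  have yB: "y \<in> orbit f x"
  proof (rule ccontr)
    assume y: "y \<notin> orbit f x"
    have "orbit f x \<subseteq> orbit f x \<inter> orbit \<sigma> x"
    proof (rule orbit_least)
      show "x \<in> orbit f x \<inter> orbit \<sigma> x" using orbit_refl[OF X] orbit_refl[OF X(1) f] by simp
      fix w assume w: "w \<in> orbit f x \<inter> orbit \<sigma> x"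
      have 1: "f w \<in> orbit f x" using w by (auto intro: orbit.step)
      have 2: "\<sigma> w \<in> orbit \<sigma> x" using w by (auto intro: orbit.step)
      have "f w \<noteq> y" using 1 y by auto
      then have "\<sigma> w \<noteq> x" by (auto simp: fs)
      moreover have "\<sigma> w \<noteq> y" using 2 n by auto
      ultimately have "f w = \<sigma> w" by (simp add: fs)
      then show "f w \<in> orbit f x \<inter> orbit \<sigma> x" using 1 2 by simp
    qed
    moreover have "inv f x \<in> orbit f x"
      using orbit.base[of "inv f" x] orbit_inv_perm[OF X(1) f] by simp
    ultimately have "\<sigma> (inv f x) \<in> orbit \<sigma> x" by (auto intro: orbit.step)
    moreover have "\<sigma> (inv f x) = y" unfolding sf using f by (simp add: permutes_inverses)
    ultimately show False using n by simp
  qed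
  have cl: "\<sigma> w \<in> orbit f x" if "w \<in> orbit f x" for w
    using orbit.step[OF that] yB orbit_refl[OF X(1) f, of x] by (auto simp: sf Transposition.transpose_def)
  have "orbit \<sigma> x \<subseteq> orbit f x" by (rule orbit_least) (use cl orbit_refl[OF X(1) f] in auto)
  moreover have "orbit \<sigma> y \<subseteq> orbit f x" by (rule orbit_least) (use cl yB in auto)
  ultimately show ?thesis using sub unfolding f_def by blast
qed

text \<open>The transposition short-circuits the cycle at position \<open>r\<close>: the point
  before \<open>y\<close> is sent back to \<open>x\<close>, and the last point of the cycle is sent
  to \<open>y\<close>.\<close>

lemma orbit_swap_comp_split:
  assumes X: "finite X" "\<sigma> permutes X" and xy: "x \<in> X"
    and r: "0 < r" "r < card (orbit \<sigma> x)" and y: "y = (\<sigma> ^^ r) x"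
  shows "orbit (swap x y \<circ> \<sigma>) x = (\<lambda>i. (\<sigma> ^^ i) x) ` {..<r}"
    and "orbit (swap x y \<circ> \<sigma>) y = (\<lambda>i. (\<sigma> ^^ i) x) ` {r..<card (orbit \<sigma> x)}"
proof -
  define k where "k = card (orbit \<sigma> x)"
  define f where "f = swap x y \<circ> \<sigma>"
  note per = funpow_eq_iff_card_orbit_dvd[OF X, of _ _ x]
  have inj: "inj_on (\<lambda>i. (\<sigma> ^^ i) x) {..<k}" using per(3)[OF le_refl] by (simp add: k_def)
  have O: "orbit \<sigma> x = (\<lambda>i. (\<sigma> ^^ i) x) ` {..<k}" using per(2)[OF le_refl] by (simp add: k_def)
  have neq: "(\<sigma> ^^ i) x \<noteq> (\<sigma> ^^ j) x" if "i < k" "j < k" "i \<noteq> j" for i j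
    using inj that by (auto simp: inj_on_def)
  have wrap: "(\<sigma> ^^ k) x = x" using per(1)[of 0 k] by (simp add: k_def)
  have yX: "y \<in> X" using y O orbit_in[OF X xy] r by (auto simp: k_def)
  have f: "f permutes X" unfolding f_def
    using permutes_compose[OF X(2) permutes_swap_id[OF xy yX]] .
  have step: "f ((\<sigma> ^^ i) x) = swap x y ((\<sigma> ^^ Suc i) x)" for i by (simp add: f_def)
  have 1: "orbit f x \<subseteq> (\<lambda>i. (\<sigma> ^^ i) x) ` {..<r}"
  proof (rule orbit_least)
    show "x \<in> (\<lambda>i. (\<sigma> ^^ i) x) ` {..<r}" using r by (intro image_eqI[of _ _ 0]) auto
    fix w assume "w \<in> (\<lambda>i. (\<sigma> ^^ i) x) ` {..<r}"
    then obtain i where i: "i < r" "w = (\<sigma> ^^ i) x" by auto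
    show "f w \<in> (\<lambda>i. (\<sigma> ^^ i) x) ` {..<r}"
    proof (cases "Suc i = r")
      case True
      then have "f w = x" unfolding i(2) step y by simp
      then show ?thesis using r by (intro image_eqI[of _ _ 0]) auto
    next
      case False
      then have "f w = (\<sigma> ^^ Suc i) x" unfolding i(2) step y
        using neq[of "Suc i" r] neq[of "Suc i" 0] i r unfolding k_def[symmetric]
        by (intro transpose_apply_other) auto
      then show ?thesis using False i by (intro image_eqI[of _ _ "Suc i"]) auto
    qed
  qed
  have 2: "orbit f y \<subseteq> (\<lambda>i. (\<sigma> ^^ i) x) ` {r..<k}"
  proof (rule orbit_least)
    show "y \<in> (\<lambda>i. (\<sigma> ^^ i) x) ` {r..<k}" using r y by (auto simp: k_def)
    fix w assume "w \<in> (\<lambda>i. (\<sigma> ^^ i) x) ` {r..<k}"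
    then obtain i where i: "r \<le> i" "i < k" "w = (\<sigma> ^^ i) x" by auto
    show "f w \<in> (\<lambda>i. (\<sigma> ^^ i) x) ` {r..<k}"
    proof (cases "Suc i = k")
      case True
      then have "f w = y" unfolding i(3) step using wrap by simp
      then show ?thesis using r y by (auto simp: k_def)
    next
      case False
      then have "f w = (\<sigma> ^^ Suc i) x" unfolding i(3) step y
        using neq[of "Suc i" r] neq[of "Suc i" 0] i r unfolding k_def[symmetric]
        by (intro transpose_apply_other) auto
      then show ?thesis using False i by (intro image_eqI[of _ _ "Suc i"]) auto
    qed
  qed
  have "y \<notin> orbit f x"
  proof
    assume "y \<in> orbit f x"
    then obtain i where "i < r" "y = (\<sigma> ^^ i) x" using 1 by auto
    then show False using y neq[of i r] r by (auto simp: k_def)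
  qed
  \<comment> \<open>Since the transposition is an involution, composing \<open>f\<close> with it
    gives \<open>\<sigma>\<close> back. The merging lemma for \<open>f\<close> then says that the
    two orbits fill the cycle, which turns both inclusions into equalities.\<close>
  from orbit_swap_comp_merge[OF X(1) f xy yX this]
  have u: "orbit \<sigma> x = orbit f x \<union> orbit f y" by (simp add: f_def o_assoc)
  have "(\<lambda>i. (\<sigma> ^^ i) x) ` {..<r} \<inter> (\<lambda>i. (\<sigma> ^^ i) x) ` {r..<k} = {}"
    using neq r by (auto simp: k_def)
  moreover have "orbit f x \<union> orbit f y = (\<lambda>i. (\<sigma> ^^ i) x) ` {..<r} \<union> (\<lambda>i. (\<sigma> ^^ i) x) ` {r..<k}"
    unfolding u[symmetric] O image_Un[symmetric] using r by (auto simp: k_def intro!: arg_cong[where f = "image _"])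
  ultimately have "orbit f x = (\<lambda>i. (\<sigma> ^^ i) x) ` {..<r} \<and> orbit f y = (\<lambda>i. (\<sigma> ^^ i) x) ` {r..<k}"
    using 1 2 by blast
  then show "orbit (swap x y \<circ> \<sigma>) x = (\<lambda>i. (\<sigma> ^^ i) x) ` {..<r}"
    "orbit (swap x y \<circ> \<sigma>) y = (\<lambda>i. (\<sigma> ^^ i) x) ` {r..<card (orbit \<sigma> x)}"
    by (auto simp: f_def k_def)
qed

text \<open>When the cut is admissible, this is the bijection of \<open>gluings_cut\<close>
  expressed through cycle types. In the excluded cases some cycle of
  \<open>swap x y \<circ> \<sigma>\<close> lies inside \<open>{x, y}\<close> and contributes a 0, so
  that both sides vanish.\<close>

lemma card_gluings_with_partner:
  assumes X: "finite X" "\<sigma> permutes X" and xy: "x \<in> X" "y \<in> X" "x \<noteq> y" and c: "card X > 2"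
  shows "card {\<tau> \<in> gluings X \<sigma>. \<tau> x = y} =
    gl (image_mset (\<lambda>B. card (B - {x, y})) (mset_set (orbit (swap x y \<circ> \<sigma>) ` X)))"
proof -
  define f where "f = swap x y \<circ> \<sigma>"
  have f: "f permutes X" unfolding f_def
    using permutes_compose[OF X(2) permutes_swap_id[OF xy(1,2)]] .
  have injf: "inj f" using f permutes_inj by blast
  have fx: "f a = swap x y (\<sigma> a)" for a by (simp add: f_def)
  show ?thesis
  proof (cases "\<sigma> x = y \<or> \<sigma> y = x \<or> \<sigma> x = x \<and> \<sigma> y = y")
    case True
    have "\<exists>a\<in>{x,y}. orbit f a \<subseteq> {x, y}"
      using True
    proof (elim disjE)
      assume "\<sigma> x = y" then have "orbit f x \<subseteq> {x}" by (intro orbit_least) (auto simp: fx)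
      then show ?thesis by auto
    next
      assume "\<sigma> y = x" then have "orbit f y \<subseteq> {y}" by (intro orbit_least) (auto simp: fx)
      then show ?thesis by auto
    next
      assume "\<sigma> x = x \<and> \<sigma> y = y" then have "orbit f x \<subseteq> {x, y}" by (intro orbit_least) (auto simp: fx)
      then show ?thesis by auto
    qed
    then obtain a where a: "a \<in> X" "orbit f a - {x, y} = {}" using xy by blast
    then have "0 \<in># image_mset (\<lambda>B. card (B - {x, y})) (mset_set (orbit f ` X))"
    proof -
      have "0 = card (orbit f a - {x, y})" using a(2) by (simp only: card.empty)
      moreover have "orbit f a \<in># mset_set (orbit f ` X)" using a(1) X(1) by simp
      ultimately show ?thesis unfolding in_image_mset by (rule image_eqI)
    qed
    then have "gl (image_mset (\<lambda>B. card (B - {x, y})) (mset_set (orbit f ` X))) = 0" by (rule gl_zero)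
    then show ?thesis by (simp only: f_def gluings_cut_empty[OF X xy c True] card.empty)
  next
    case False
    define X' where "X' = X - {x, y}"
    define s' where "s' = skip y (skip x f)"
    have s': "s' permutes X'" and orb: "\<And>z. z \<in> X' \<Longrightarrow> orbit s' z = orbit f z - {x, y}"
      using skip_skip[OF X(1) f xy(3)] by (auto simp: s'_def X'_def)
    have ne: "orbit f z - {x, y} \<noteq> {}" for z
    proof
      assume "orbit f z - {x, y} = {}"
      then have s: "orbit f z \<subseteq> {x, y}" by auto
      have "z \<in> {x, y}" "f z \<in> {x, y}" "f (f z) \<in> {x, y}" 
        using s orbit_refl[OF X(1) f, of z] orbit.base[of f z] orbit.step[OF orbit.base[of f z]] by auto
      then have "f x = x \<or> f y = y \<or> (f x = y \<and> f y = x)" using injf xy(3) by (auto simp: inj_eq)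
      then show False using False unfolding fx by (auto simp: Transposition.transpose_def split: if_splits)
    qed
    have im: "orbit s' ` X' = (\<lambda>B. B - {x, y}) ` (orbit f ` X)"
    proof (intro equalityI subsetI)
      fix B assume "B \<in> orbit s' ` X'" then show "B \<in> (\<lambda>B. B - {x, y}) ` (orbit f ` X)"
        using orb by (auto simp: X'_def)
    next
      fix B assume "B \<in> (\<lambda>B. B - {x, y}) ` (orbit f ` X)"
      then obtain z where z: "z \<in> X" "B = orbit f z - {x, y}" by auto
      obtain w where w: "w \<in> orbit f z" "w \<notin> {x, y}" using ne[of z] by auto
      then have "w \<in> X'" using orbit_in[OF X(1) f z(1)] by (auto simp: X'_def)
      then show "B \<in> orbit s' ` X'" using orb[of w] orbit_eq_orbit[OF X(1) f w(1)] z by auto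
    qed
    have inj: "inj_on (\<lambda>B. B - {x, y}) (orbit f ` X)"
    proof (rule inj_onI)
      fix B B' assume B: "B \<in> orbit f ` X" "B' \<in> orbit f ` X" and e: "B - {x, y} = B' - {x, y}"
      then obtain z z' where z: "B = orbit f z" "B' = orbit f z'" by auto
      obtain w where w: "w \<in> B - {x, y}" using ne[of z] z by auto
      then have "w \<in> orbit f z" "w \<in> orbit f z'" using e z by auto
      then show "B = B'" using orbit_eq_orbit[OF X(1) f] z by blast
    qed
    have "card {\<tau> \<in> gluings X \<sigma>. \<tau> x = y} = card (gluings X' s')"
      using bij_betw_same_card[OF gluings_cut[OF X xy c False]] by (simp add: X'_def s'_def f_def)
    also have "\<dots> = gl (orbit_sizes X' s')" using X(1) s' by (intro card_gluings_eq_gl) (auto simp: X'_def)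
    also have "orbit_sizes X' s' = image_mset (\<lambda>B. card (B - {x, y})) (mset_set (orbit f ` X))"
      unfolding orbit_sizes_def im image_mset_mset_set[OF inj, symmetric]
      by (simp add: image_mset.compositionality o_def)
    finally show ?thesis by (simp add: f_def)
  qed
qed

lemma finite_orbit_in: "finite X \<Longrightarrow> \<sigma> permutes X \<Longrightarrow> finite (orbit \<sigma> x)"
  by (metis finite_orbit orbit_refl)

lemma orbit_sizes_swap_merge:
  assumes X: "finite X" "\<sigma> permutes X" and xy: "x \<in> X" "y \<in> X" and n: "y \<notin> orbit \<sigma> x"
  shows "image_mset (\<lambda>B. card (B - {x, y})) (mset_set (orbit (swap x y \<circ> \<sigma>) ` X)) =
    add_mset (card (orbit \<sigma> x) + card (orbit \<sigma> y) - 2)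
      (image_mset card (mset_set (orbit \<sigma> ` X - {orbit \<sigma> x, orbit \<sigma> y})))"
proof -
  define f where "f = swap x y \<circ> \<sigma>"
  define R where "R = orbit \<sigma> ` X - {orbit \<sigma> x, orbit \<sigma> y}"
  have ref: "x \<in> orbit \<sigma> x" "y \<in> orbit \<sigma> y" using orbit_refl[OF X] by auto
  have f: "f permutes X" unfolding f_def using permutes_compose[OF X(2) permutes_swap_id[OF xy]] .
  have m: "orbit f x = orbit \<sigma> x \<union> orbit \<sigma> y" using orbit_swap_comp_merge[OF X xy n] by (simp add: f_def)
  have dj: "orbit \<sigma> x \<inter> orbit \<sigma> y = {}" using orbit_disjoint[OF X] n ref by metis
  have R: "x \<notin> B" "y \<notin> B" if "B \<in> R" for B
    using that orbit_eq_orbit[OF X] by (fastforce simp: R_def)+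
  have other: "orbit f z = orbit \<sigma> z" if "orbit \<sigma> z \<in> R" for z
    using R[OF that] orbit_swap_comp_other[OF X] by (simp add: f_def)
  have "orbit f ` X = insert (orbit \<sigma> x \<union> orbit \<sigma> y) R"
  proof (intro equalityI subsetI)
    fix B assume "B \<in> orbit f ` X" then obtain z where z: "z \<in> X" "B = orbit f z" by auto
    show "B \<in> insert (orbit \<sigma> x \<union> orbit \<sigma> y) R"
    proof (cases "orbit \<sigma> z \<in> R")
      case True then show ?thesis using other z by auto
    next
      case False
      then have "z \<in> orbit f x" using z orbit_refl[OF X, of z] by (auto simp: R_def m)
      then have "B = orbit f x" using orbit_eq_orbit[OF X(1) f] z by simp
      then show ?thesis using m by simp
    qed
  next
    fix B assume "B \<in> insert (orbit \<sigma> x \<union> orbit \<sigma> y) R"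
    then consider "B = orbit f x" | "B \<in> R" using m by auto
    then show "B \<in> orbit f ` X"
    proof cases
      case 1 then show ?thesis using xy by simp
    next
      case 2
      then obtain z where "z \<in> X" "B = orbit \<sigma> z" by (auto simp: R_def)
      then show ?thesis using other[of z] 2 by auto
    qed
  qed
  moreover have "orbit \<sigma> x \<union> orbit \<sigma> y \<notin> R" using R ref by auto
  moreover have "finite R" using X by (simp add: R_def)
  moreover have "card (orbit \<sigma> x \<union> orbit \<sigma> y - {x, y}) = card (orbit \<sigma> x) + card (orbit \<sigma> y) - 2"
  proof -
    have "x \<noteq> y" using n ref by auto
    then show ?thesis using ref dj finite_orbit_in[OF X]
      by (subst card_Diff_subset) (auto simp: card_Un_disjoint)
  qed
  moreover have "image_mset (\<lambda>B. card (B - {x, y})) (mset_set R) = image_mset card (mset_set R)"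
    using \<open>finite R\<close> R by (intro image_mset_cong) (auto intro!: arg_cong[where f = card])
  ultimately show ?thesis by (simp add: f_def R_def)
qed

text \<open>The two pieces have \<open>r\<close> and \<open>card (orbit \<sigma> x) - r\<close>
  points. The first one loses \<open>x\<close> and the second one loses \<open>y\<close>.\<close>

lemma orbit_sizes_swap_split:
  assumes X: "finite X" "\<sigma> permutes X" and xy: "x \<in> X"
    and r: "0 < r" "r < card (orbit \<sigma> x)" and y: "y = (\<sigma> ^^ r) x"
  shows "image_mset (\<lambda>B. card (B - {x, y})) (mset_set (orbit (swap x y \<circ> \<sigma>) ` X)) =
    {#r - 1, card (orbit \<sigma> x) - r - 1#} + image_mset card (mset_set (orbit \<sigma> ` X - {orbit \<sigma> x}))"
proof -
  define f where "f = swap x y \<circ> \<sigma>"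
  define k where "k = card (orbit \<sigma> x)"
  define R where "R = orbit \<sigma> ` X - {orbit \<sigma> x}"
  have yO: "y \<in> orbit \<sigma> x" using y by (auto simp: orbit_eq_range[OF X])
  have yX: "y \<in> X" using yO orbit_in[OF X xy] by auto
  have f: "f permutes X" unfolding f_def using permutes_compose[OF X(2) permutes_swap_id[OF xy yX]] .
  have ref: "x \<in> orbit f x" "y \<in> orbit f y" "x \<in> orbit \<sigma> x" using orbit_refl[OF X(1) f] orbit_refl[OF X] by auto
  have sp: "orbit f x = (\<lambda>i. (\<sigma> ^^ i) x) ` {..<r}" "orbit f y = (\<lambda>i. (\<sigma> ^^ i) x) ` {r..<k}"
    using orbit_swap_comp_split[OF X xy r y] by (auto simp: f_def k_def)
  have inj: "inj_on (\<lambda>i. (\<sigma> ^^ i) x) {..<k}" using funpow_eq_iff_card_orbit_dvd(3)[OF X le_refl] by (simp add: k_def)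
  have u: "orbit \<sigma> x = orbit f x \<union> orbit f y"
    unfolding sp image_Un[symmetric] using funpow_eq_iff_card_orbit_dvd(2)[OF X le_refl, of x] r
    by (simp add: k_def ivl_disj_un)
  have cx: "card (orbit f x) = r" "card (orbit f y) = k - r" unfolding sp
    by (subst card_image[OF inj_on_subset[OF inj]]; use r in \<open>auto simp: k_def\<close>)+
  have dj: "orbit f x \<inter> orbit f y = {}" unfolding sp
    by (subst inj_on_image_Int[OF inj, symmetric]) (use r in \<open>auto simp: k_def\<close>)
  have Rw: "w \<notin> B" if "B \<in> R" "w \<in> orbit \<sigma> x" for B w
  proof
    assume "w \<in> B"
    moreover from that(1) obtain z where "B = orbit \<sigma> z" "B \<noteq> orbit \<sigma> x" by (auto simp: R_def)
    ultimately show False using orbit_eq_orbit[OF X] that(2) by metis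
  qed
  have R: "x \<notin> B" "y \<notin> B" if "B \<in> R" for B
    using Rw[OF that] yO ref by auto
  have other: "orbit f z = orbit \<sigma> z" if "orbit \<sigma> z \<in> R" for z
    using R[OF that] orbit_swap_comp_other[OF X] by (simp add: f_def)
  have "orbit f ` X = insert (orbit f x) (insert (orbit f y) R)"
  proof (intro equalityI subsetI)
    fix B assume "B \<in> orbit f ` X" then obtain z where z: "z \<in> X" "B = orbit f z" by auto
    show "B \<in> insert (orbit f x) (insert (orbit f y) R)"
    proof (cases "orbit \<sigma> z \<in> R")
      case True then show ?thesis using other z by auto
    next
      case False
      then have "z \<in> orbit f x \<union> orbit f y" using z orbit_refl[OF X, of z] by (auto simp: R_def u)
      then show ?thesis using orbit_eq_orbit[OF X(1) f] z by auto
    qed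
  next
    fix B assume "B \<in> insert (orbit f x) (insert (orbit f y) R)"
    then consider "B = orbit f x" | "B = orbit f y" | "B \<in> R" by auto
    then show "B \<in> orbit f ` X"
    proof cases
      case 3
      then obtain z where "z \<in> X" "B = orbit \<sigma> z" by (auto simp: R_def)
      then show ?thesis using other[of z] 3 by auto
    qed (use xy yX in simp_all)
  qed
  moreover have "orbit f x \<notin> insert (orbit f y) R" "orbit f y \<notin> R" using R ref dj by auto
  moreover have "finite R" using X by (simp add: R_def)
  moreover have "orbit f x - {x, y} = orbit f x - {x}" "orbit f y - {x, y} = orbit f y - {y}" using dj ref by auto
  moreover from this have "card (orbit f x - {x, y}) = r - 1" "card (orbit f y - {x, y}) = k - r - 1"
    using ref cx finite_orbit_in[OF X(1) f] by (auto simp: card_Diff_singleton)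
  moreover have "image_mset (\<lambda>B. card (B - {x, y})) (mset_set R) = image_mset card (mset_set R)"
    using \<open>finite R\<close> R by (intro image_mset_cong) (auto intro!: arg_cong[where f = card])
  ultimately show ?thesis by (simp add: f_def R_def k_def)
qed

section \<open>The recursion for gluing numbers\<close>

lemma orbit_sizes_eq_add_mset:
  assumes X: "finite X" "\<sigma> permutes X" and "x \<in> X"
  shows "orbit_sizes X \<sigma> = add_mset (card (orbit \<sigma> x)) (image_mset card (mset_set (orbit \<sigma> ` X - {orbit \<sigma> x})))"
proof -
  have "mset_set (orbit \<sigma> ` X) = add_mset (orbit \<sigma> x) (mset_set (orbit \<sigma> ` X - {orbit \<sigma> x}))"
    using assms by (simp add: mset_set.remove)
  then show ?thesis by (simp add: orbit_sizes_def)
qed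

lemma sum_orbit_sizes:
  assumes X: "finite X" "\<sigma> permutes X"
  shows "sum_mset (orbit_sizes X \<sigma>) = card X"
proof -
  have "card X = card (\<Union>(orbit \<sigma> ` X))"
    using orbit_refl[OF X] orbit_in[OF X] by (intro arg_cong[where f = card]) auto
  also have "\<dots> = (\<Sum>B\<in>orbit \<sigma> ` X. card B)"
    using orbit_disjoint[OF X] finite_orbit_in[OF X]
    by (intro card_Union_disjoint) (auto simp: pairwise_def disjnt_def)
  also have "\<dots> = sum_mset (orbit_sizes X \<sigma>)" by (simp add: orbit_sizes_def sum_unfold_sum_mset)
  finally show ?thesis by simp
qed

lemma ex_orbit_sizes:
  assumes "0 \<notin># M"
  shows "\<exists>(X :: nat set) \<sigma>. finite X \<and> \<sigma> permutes X \<and> orbit_sizes X \<sigma> = M"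
  using assms
proof (induction M)
  case empty
  show ?case by (intro exI[of _ "{}"] exI[of _ id]) (simp add: orbit_sizes_def id_def)
next
  case (add k M)
  then obtain X :: "nat set" and \<sigma> where X: "finite X" "\<sigma> permutes X" "orbit_sizes X \<sigma> = M" by auto
  have k: "k > 0" using add.prems by (metis gr0I union_single_eq_member)
  \<comment> \<open>The new cycle is placed on an interval above \<open>X\<close>. Inserting 0 keeps
    the maximum defined when \<open>X\<close> is empty.\<close>
  define a where "a = Suc (Max (insert 0 X))"
  have a: "x < a" if "x \<in> X" for x using that X(1) by (simp add: a_def less_Suc_eq_le)
  define Y where "Y = {a..<a + k}"
  define c where "c i = (if i \<in> Y then (if Suc i = a + k then a else Suc i) else i)" for i
  have cY: "c ` Y \<subseteq> Y" using k by (auto simp: c_def Y_def)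
  have "inj_on c Y" by (auto simp: inj_on_def c_def Y_def split: if_splits)
  then have "bij_betw c Y Y" using endo_inj_surj[of Y c] cY by (auto simp: bij_betw_def Y_def)
  then have c: "c permutes Y" by (rule bij_imp_permutes) (simp add: c_def)
  have pow: "(c ^^ i) a = a + i" if "i < k" for i
    using that by (induction i) (auto simp: c_def Y_def)
  have disj: "X \<inter> Y = {}" using a by (force simp: Y_def)
  define s where "s = \<sigma> \<circ> c"
  have s: "s permutes X \<union> Y" unfolding s_def
    by (intro permutes_compose) (use permutes_subset[OF c] permutes_subset[OF X(2)] in auto)
  have fin: "finite (X \<union> Y)" using X by (simp add: Y_def)
  have sX: "s x = \<sigma> x" if "x \<in> X" for x using disj that by (auto simp: s_def c_def)
  have sY: "s x = c x" if "x \<in> Y" for x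
  proof -
    have "c x \<in> Y" using that cY by auto
    then have "c x \<notin> X" using disj by auto
    then show ?thesis using X(2) by (auto simp: s_def permutes_def)
  qed
  have oX: "orbit s x = orbit \<sigma> x" if "x \<in> X" for x
    using orbit_image[of x X \<sigma> id s] that sX permutes_in_image[OF X(2)] by simp
  have oY: "orbit s y = Y" if "y \<in> Y" for y
  proof -
    have finY: "finite Y" by (simp add: Y_def)
    have "Y \<subseteq> orbit c a"
    proof
      fix z assume "z \<in> Y"
      then have "z = (c ^^ (z - a)) a" using pow[of "z - a"] by (auto simp: Y_def)
      then show "z \<in> orbit c a" using orbit_eq_range[OF finY c] by auto
    qed
    moreover have "orbit c a \<subseteq> Y" using orbit_in[OF finY c, of a] k by (simp add: Y_def)
    ultimately have "orbit c a = Y" by auto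
    then have "orbit c y = Y" using orbit_eq_orbit[OF finY c, of y a] that by simp
    then show ?thesis using orbit_image[of y Y c id s] that sY cY by auto
  qed
  have aY: "a \<in> Y" using k by (simp add: Y_def)
  have rem: "orbit s ` (X \<union> Y) - {Y} = orbit \<sigma> ` X"
  proof -
    have "Y \<notin> orbit \<sigma> ` X" using orbit_in[OF X(1,2)] aY disj by blast
    then show ?thesis using oX oY aY by auto
  qed
  have "orbit_sizes (X \<union> Y) s = add_mset k M"
    using orbit_sizes_eq_add_mset[OF fin s, of a] aY oY[OF aY] rem X(3)
    by (simp add: orbit_sizes_def Y_def)
  then show ?case using fin s by blast
qed

lemma gluings_no_fixpoint: "\<tau> \<in> gluings X \<sigma> \<Longrightarrow> x \<in> X \<Longrightarrow> \<tau> x \<in> X - {x}"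
  by (auto simp: gluings_def permutes_in_image)

text \<open>Fix \<open>x\<close> in a cycle of length \<open>k\<close>. The first sum collects the \<open>\<tau>\<close> with \<open>\<tau> x = \<sigma>\<^bsup>r\<^esup> x\<close>, the second one
  those with \<open>\<tau> x\<close> in another cycle, of length \<open>b\<close>. The terms with \<open>\<sigma>\<^bsup>-1\<^esup> \<tau>\<close> not a full cycle are
  included harmlessly: their multiset contains 0, hence \<open>gl\<close> vanishes.\<close>

theorem gl_recursion:
  assumes k: "k > 0" and big: "k + sum_mset M > 2"
  shows "gl (add_mset k M) = (\<Sum>r=1..<k. gl ({#r - 1, k - r - 1#} + M)) +
    (\<Sum>b\<in>#M. b * gl (add_mset (k + b - 2) (M - {#b#})))"
proof (cases "0 \<in># M")
  case True
  \<comment> \<open>Taking out a nonzero \<open>b\<close> leaves the 0 in the multiset, and for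
    \<open>b = 0\<close> the factor \<open>b\<close> vanishes.\<close>
  have "b * gl (add_mset (k + b - 2) (M - {#b#})) = 0" if "b \<in># M" for b
  proof (cases "b = 0")
    case False
    then have "0 \<in># M - {#b#}" using True by (simp add: in_diff_count)
    then show ?thesis using gl_zero by simp
  qed simp
  then have "(\<Sum>b\<in>#M. b * gl (add_mset (k + b - 2) (M - {#b#}))) = 0" by simp
  moreover have "(\<Sum>r=1..<k. gl ({#r - 1, k - r - 1#} + M)) = 0"
    using True by (intro sum.neutral) (simp add: gl_zero)
  ultimately show ?thesis using True gl_zero by simp
next
  case False
  then have "0 \<notin># add_mset k M" using k by simp
  then obtain X :: "nat set" and \<sigma> where X: "finite X" "\<sigma> permutes X" and M: "orbit_sizes X \<sigma> = add_mset k M"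
    using ex_orbit_sizes by blast
  have cX: "card X > 2" using sum_orbit_sizes[OF X] big M by simp
  have "k \<in># orbit_sizes X \<sigma>" using M by simp
  then obtain x where x: "x \<in> X" "card (orbit \<sigma> x) = k" using X(1) by (auto simp: orbit_sizes_def)
  define R where "R = orbit \<sigma> ` X - {orbit \<sigma> x}"
  have finR: "finite R" using X by (simp add: R_def)
  have MR: "M = image_mset card (mset_set R)"
    using orbit_sizes_eq_add_mset[OF X x(1)] M x by (simp add: R_def)
  have dj: "orbit \<sigma> x \<inter> B = {}" if "B \<in> R" for B
    using that orbit_disjoint[OF X] by (auto simp: R_def)
  define N where "N y = card {\<tau> \<in> gluings X \<sigma>. \<tau> x = y}" for y
  have "gluings X \<sigma> = (\<Union>y\<in>X - {x}. {\<tau> \<in> gluings X \<sigma>. \<tau> x = y})"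
    using gluings_no_fixpoint[OF _ x(1)] by blast
  then have "card (gluings X \<sigma>) = card (\<Union>y\<in>X - {x}. {\<tau> \<in> gluings X \<sigma>. \<tau> x = y})" by simp
  also have "\<dots> = (\<Sum>y\<in>X - {x}. N y)" unfolding N_def
    by (rule card_UN_disjoint) (use X in \<open>auto intro: finite_subset[OF _ finite_gluings[OF X(1)]]\<close>)
  also have "X - {x} = (orbit \<sigma> x - {x}) \<union> \<Union>R"
  proof -
    have "x \<notin> \<Union>R" using dj orbit_refl[OF X, of x] by blast
    moreover have "\<Union>R \<subseteq> X" "orbit \<sigma> x \<subseteq> X" unfolding R_def using orbit_in[OF X] x(1) by blast+
    moreover have "z \<in> orbit \<sigma> x \<union> \<Union>R" if "z \<in> X" for z
    proof -
      have "orbit \<sigma> z = orbit \<sigma> x \<or> orbit \<sigma> z \<in> R" using that by (simp add: R_def)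
      moreover have "z \<in> orbit \<sigma> z" by (rule orbit_refl[OF X])
      ultimately show ?thesis by auto
    qed
    ultimately show ?thesis by (intro equalityI subsetI) auto
  qed
  also have "(\<Sum>y\<in>\<dots>. N y) = (\<Sum>y\<in>orbit \<sigma> x - {x}. N y) + (\<Sum>y\<in>\<Union>R. N y)"
  proof (rule sum.union_disjoint)
    show "finite (\<Union>R)" using finR finite_orbit_in[OF X] unfolding R_def by blast
    show "(orbit \<sigma> x - {x}) \<inter> \<Union>R = {}" using dj by blast
  qed (use finite_orbit_in[OF X] in auto)
  also have "(\<Sum>y\<in>orbit \<sigma> x - {x}. N y) = (\<Sum>r=1..<k. gl ({#r - 1, k - r - 1#} + M))"
  proof (rule sum.reindex_bij_betw[symmetric, THEN trans])
    have inj: "inj_on (\<lambda>i. (\<sigma> ^^ i) x) {..<k}"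
      using funpow_eq_iff_card_orbit_dvd(3)[OF X le_refl, of x] x by simp
    have O: "orbit \<sigma> x = (\<lambda>i. (\<sigma> ^^ i) x) ` {..<k}"
      using funpow_eq_iff_card_orbit_dvd(2)[OF X le_refl, of x] x by simp
    have "{..<k} - {0} = {1..<k}" "{Suc 0..<k} \<subseteq> {..<k}" by auto
    then have "(\<lambda>i. (\<sigma> ^^ i) x) ` {1..<k} = orbit \<sigma> x - {(\<sigma> ^^ 0) x}"
      using inj_on_image_set_diff[OF inj, of "{..<k}" "{0}"] k by (simp add: O)
    then show "bij_betw (\<lambda>i. (\<sigma> ^^ i) x) {1..<k} (orbit \<sigma> x - {x})"
      using inj_on_subset[OF inj, of "{1..<k}"] \<open>{Suc 0..<k} \<subseteq> {..<k}\<close> by (simp add: bij_betw_def)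
    show "(\<Sum>r=1..<k. N ((\<sigma> ^^ r) x)) = (\<Sum>r=1..<k. gl ({#r - 1, k - r - 1#} + M))"
    proof (rule sum.cong)
      fix r assume r: "r \<in> {1..<k}"
      then have r': "0 < r" "r < card (orbit \<sigma> x)" using x by auto
      have "(\<sigma> ^^ r) x \<in> orbit \<sigma> x" by (auto simp: orbit_eq_range[OF X])
      then have "(\<sigma> ^^ r) x \<in> X" using orbit_in[OF X x(1)] by auto
      moreover have "x \<noteq> (\<sigma> ^^ r) x" using inj_onD[OF inj, of 0 r] r by auto
      ultimately show "N ((\<sigma> ^^ r) x) = gl ({#r - 1, k - r - 1#} + M)"
        unfolding N_def using card_gluings_with_partner[OF X x(1) _ _ cX] 
          orbit_sizes_swap_split[OF X x(1) r' refl] x by (simp add: MR R_def)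
    qed simp
  qed
  also have "(\<Sum>y\<in>\<Union>R. N y) = (\<Sum>B\<in>R. \<Sum>y\<in>B. N y)"
    using orbit_disjoint[OF X] finite_orbit_in[OF X]
    by (subst sum.Union_disjoint) (auto simp: R_def)
  also have "\<dots> = (\<Sum>B\<in>R. card B * gl (add_mset (k + card B - 2) (M - {#card B#})))"
  proof (rule sum.cong)
    fix B assume B: "B \<in> R"
    have "N y = gl (add_mset (k + card B - 2) (M - {#card B#}))" if y: "y \<in> B" for y
    proof -
      have By: "B = orbit \<sigma> y" using B y orbit_eq_orbit[OF X] by (auto simp: R_def)
      have yX: "y \<in> X" using B y orbit_in[OF X] by (auto simp: R_def)
      have yn: "y \<notin> orbit \<sigma> x" using B By orbit_eq_orbit[OF X] by (auto simp: R_def)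
      then have xy: "x \<noteq> y" using orbit_refl[OF X] by auto
      have "mset_set R = add_mset B (mset_set (R - {B}))" using B finR by (simp add: mset_set.remove)
      then have "M - {#card B#} = image_mset card (mset_set (R - {B}))" by (simp add: MR)
      moreover have "R - {B} = orbit \<sigma> ` X - {orbit \<sigma> x, orbit \<sigma> y}" by (auto simp: R_def By)
      ultimately show ?thesis unfolding N_def
        using card_gluings_with_partner[OF X x(1) yX xy cX] orbit_sizes_swap_merge[OF X x(1) yX yn] x By by simp
    qed
    then show "(\<Sum>y\<in>B. N y) = card B * gl (add_mset (k + card B - 2) (M - {#card B#}))" by simp
  qed simp
  also have "\<dots> = (\<Sum>b\<in>#M. b * gl (add_mset (k + b - 2) (M - {#b#})))"
    unfolding MR by (simp add: sum_unfold_sum_mset image_mset.compositionality o_def)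
  finally show ?thesis using card_gluings_eq_gl[OF X] M by simp
qed

section \<open>Initial value, vanishing and positivity of gluing numbers\<close>

lemma gl_two_one: "gl {#1, 1#} = 1"
proof -
  define X :: "nat set" where "X = {0, 1}"
  have X: "finite X" "id permutes X" by (auto simp: X_def permutes_id)
  have o: "orbit id x = {x}" for x :: nat by (simp add: orbit_eq_singleton_iff)
  have "orbit_sizes X id = {#1, 1#}" unfolding orbit_sizes_def by (simp add: X_def o)
  moreover have "gluings X id = {swap 0 1}"
  proof (intro equalityI subsetI)
    fix t assume t: "t \<in> gluings X id"
    then have p: "t permutes X" by (simp add: gluings_def)
    have "t 0 = 1" "t 1 = 0" using gluings_no_fixpoint[OF t, of 0] gluings_no_fixpoint[OF t, of 1] by (auto simp: X_def)
    then have "t i = swap 0 1 i" for i using p by (cases "i \<in> X") (auto simp: permutes_def X_def Transposition.transpose_def)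
    then show "t \<in> {swap 0 1}" by auto
  next
    fix t :: "nat \<Rightarrow> nat" assume "t \<in> {swap 0 1}"
    then have t: "t = swap 0 1" by simp
    have "1 \<in> orbit t 0" "0 \<in> orbit t 1" using orbit.base[of t] t by (metis transpose_apply_first, metis transpose_apply_second)
    moreover have "t permutes X" unfolding t by (rule permutes_swap_id) (auto simp: X_def)
    ultimately show "t \<in> gluings X id" using orbit_refl[OF X(1) \<open>t permutes X\<close>]
      by (auto simp: gluings_def X_def t[symmetric]) (auto simp: t)
  qed
  ultimately show ?thesis using card_gluings_eq_gl[OF X] by simp
qed

text \<open>By the Euler characteristic, these gluings would have negative genus.\<close>

lemma gl_eq_0_of_many_boundaries:
  "2 * size M > sum_mset M + 2 \<Longrightarrow> gl M = 0"
proof (induction "sum_mset M" arbitrary: M rule: less_induct)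
  case less
  show ?case
  proof (cases "0 \<in># M")
    case True then show ?thesis by (rule gl_zero)
  next
    case False
    have "M \<noteq> {#}" using less.prems by auto
    then obtain k M' where M: "M = add_mset k M'" by (metis multiset_cases)
    have k: "k > 0" using False M by (metis gr0I union_single_eq_member)
    have pos: "size N \<le> sum_mset N" if "0 \<notin># N" for N :: "nat multiset"
      using that by (induction N) auto
    have "size M \<le> sum_mset M" using pos False by simp
    then have big: "k + sum_mset M' > 2" using less.prems M by simp
    \<comment> \<open>A cut lowers the sum by 2. Splitting raises \<open>2 * size M\<close> by 2 and
      merging lowers it by 2, so the inequality survives both.\<close>
    have "gl ({#r - 1, k - r - 1#} + M') = 0" if "r \<in> {1..<k}" for r
      by (rule less.hyps) (use that less.prems M in auto)
    moreover have "b * gl (add_mset (k + b - 2) (M' - {#b#})) = 0" if b: "b \<in># M'" for b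
    proof -
      obtain M'' where M'': "M' = add_mset b M''" using b by (metis insert_DiffM)
      have "b > 0" using False b M by (metis gr0I insert_noteq_member multi_member_split union_iff add_mset_add_single)
      have "gl (add_mset (k + b - 2) M'') = 0"
        by (rule less.hyps) (use less.prems M M'' k \<open>b > 0\<close> in auto)
      then show ?thesis by (simp add: M'')
    qed
    ultimately show ?thesis using gl_recursion[OF k big] by (simp add: M)
  qed
qed

text \<open>This supplies the nonzero coefficient of the volume polynomial. All terms of the
  recursion are nonnegative, so a single positive one suffices: one merging term adds a boundary
  component in genus 0, and one splitting term raises the genus.\<close>

lemma ex_gl_pos:
  assumes "n \<ge> 1" "2 * g + n \<ge> 2"
  shows "\<exists>M. size M = n \<and> sum_mset M + 2 = 2 * (2 * g + n) \<and> gl M > 0"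
  using assms
proof (induction g arbitrary: n)
  case 0
  have "\<exists>M. size M = m + 2 \<and> sum_mset M + 2 = 2 * (m + 2) \<and> gl M > 0" for m
  proof (induction m)
    case 0
    show ?case using gl_two_one by (intro exI[of _ "{#1, 1#}"]) simp
  next
    case (Suc m)
    then obtain M where M: "size M = m + 2" "sum_mset M + 2 = 2 * (m + 2)" "gl M > 0" by auto
    then have "M \<noteq> {#}" by auto
    then obtain k M' where k: "M = add_mset k M'" by (metis multiset_cases)
    \<comment> \<open>Merging a one-point cycle with one of length \<open>k + 1\<close> and deleting
      two points leaves a cycle of length \<open>k\<close>, that is, \<open>M\<close> again.\<close>
    have "gl (add_mset 1 (add_mset (k + 1) M')) \<ge> (k + 1) * gl M"
      using M by (subst gl_recursion) (auto simp: k)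
    then have "gl (add_mset 1 (add_mset (k + 1) M')) > 0" using M(3) by (metis add_gr_0 gr0I leD mult_is_0 zero_less_one)
    then show ?case using M k by (intro exI[of _ "add_mset 1 (add_mset (k + 1) M')"]) auto
  qed
  moreover have "n - 2 + 2 = n" using 0 by simp
  ultimately show ?case by (metis add_0 mult_0_right)
next
  case (Suc g)
  obtain M where M: "size M = n + 1" "sum_mset M + 2 = 2 * (2 * g + (n + 1))" "gl M > 0"
    using Suc.IH[of "n + 1"] Suc.prems by auto
  then have "M \<noteq> {#}" by auto
  then obtain a M1 where a: "M = add_mset a M1" by (metis multiset_cases)
  then have "M1 \<noteq> {#}" using M Suc.prems by auto
  then obtain b M2 where b: "M1 = add_mset b M2" by (metis multiset_cases)
  \<comment> \<open>Splitting at \<open>r = a + 1\<close> then leaves the lengths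
    \<open>r - 1 = a\<close> and \<open>k - r - 1 = b\<close>, so \<open>gl M\<close> is one of the
    splitting terms.\<close>
  define k where "k = a + b + 2"
  have "gl M \<le> (\<Sum>r=1..<k. gl ({#r - 1, k - r - 1#} + M2))"
    by (rule order_trans[OF _ member_le_sum[of "a + 1"]]) (auto simp: k_def a b)
  also have "\<dots> \<le> gl (add_mset k M2)"
    by (subst gl_recursion) (use M a b in \<open>auto simp: k_def\<close>)
  finally show ?case using M a b by (intro exI[of _ "add_mset k M2"]) (auto simp: k_def)
qed

section \<open>Volumes in coordinates\<close>

abbreviation lebesgue_on_funs :: "'i set \<Rightarrow> ('i \<Rightarrow> real) measure" where
  "lebesgue_on_funs I \<equiv> Pi\<^sub>M I (\<lambda>_. lborel)"

text \<open>Points of the product space are extensional functions, so sums and negatives have to be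
  restricted to \<open>I\<close>.\<close>

definition vadd :: "'i set \<Rightarrow> ('i \<Rightarrow> real) \<Rightarrow> ('i \<Rightarrow> real) \<Rightarrow> 'i \<Rightarrow> real" where
  "vadd I x y = (\<lambda>i\<in>I. x i + y i)"

definition vneg :: "'i set \<Rightarrow> ('i \<Rightarrow> real) \<Rightarrow> 'i \<Rightarrow> real" where
  "vneg I x = (\<lambda>i\<in>I. - x i)"

lemma vadd_in [simp]: "vadd I x y \<in> I \<rightarrow>\<^sub>E UNIV" by (simp add: vadd_def)
lemma vneg_in [simp]: "vneg I x \<in> I \<rightarrow>\<^sub>E UNIV" by (simp add: vneg_def)

lemma measurable_vadd_const: "(\<lambda>x. vadd I c x) \<in> measurable (lebesgue_on_funs I) (lebesgue_on_funs I)"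
  unfolding vadd_def by measurable

lemma emeasure_lborel_vimage_plus:
  assumes "A \<in> sets (borel :: real measure)"
  shows "emeasure lborel ((+) c -` A) = emeasure lborel A"
proof -
  have "emeasure lborel A = emeasure (distr lborel borel ((+) c)) A"
    using lborel_distr_plus[of c] by simp
  also have "\<dots> = emeasure lborel ((+) c -` A)"
    using assms by (simp add: emeasure_distr)
  finally show ?thesis by simp
qed

lemma distr_vadd:
  assumes "finite I"
  shows "distr (lebesgue_on_funs I) (lebesgue_on_funs I) (\<lambda>x. vadd I c x) = lebesgue_on_funs I"
proof -
  interpret product_sigma_finite "\<lambda>_. lborel :: real measure" by standard
  show ?thesis
  proof (rule PiM_eqI[OF assms])
    fix A :: "'a \<Rightarrow> real set" assume A: "\<And>i. i \<in> I \<Longrightarrow> A i \<in> sets lborel"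
    have "emeasure (distr (lebesgue_on_funs I) (lebesgue_on_funs I) (\<lambda>x. vadd I c x)) (Pi\<^sub>E I A)
      = emeasure (lebesgue_on_funs I) ((\<lambda>x. vadd I c x) -` Pi\<^sub>E I A \<inter> space (lebesgue_on_funs I))"
      using A assms measurable_vadd_const by (intro emeasure_distr) (auto intro!: sets_PiM_I_finite)
    also have "(\<lambda>x. vadd I c x) -` Pi\<^sub>E I A \<inter> space (lebesgue_on_funs I) = (\<Pi>\<^sub>E i\<in>I. (+) (c i) -` A i)"
      by (auto simp: space_PiM vadd_def PiE_def Pi_def extensional_def split: if_splits)
    also have "emeasure (lebesgue_on_funs I) \<dots> = (\<Prod>i\<in>I. emeasure lborel ((+) (c i) -` A i))"
      using A assms by (intro emeasure_PiM) (auto intro!: measurable_sets_borel[of "(+) _" borel])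
    also have "\<dots> = (\<Prod>i\<in>I. emeasure lborel (A i))"
      using A by (intro prod.cong) (auto simp: emeasure_lborel_vimage_plus)
    finally show "emeasure (distr (lebesgue_on_funs I) (lebesgue_on_funs I) (\<lambda>x. vadd I c x)) (Pi\<^sub>E I A)
      = (\<Prod>i\<in>I. emeasure lborel (A i))" .
  qed simp
qed

lemma nn_integral_vadd:
  assumes "finite I" "f \<in> borel_measurable (lebesgue_on_funs I)"
  shows "(\<integral>\<^sup>+x. f (vadd I c x) \<partial>lebesgue_on_funs I) = (\<integral>\<^sup>+x. f x \<partial>lebesgue_on_funs I)"
proof -
  have "(\<integral>\<^sup>+x. f x \<partial>lebesgue_on_funs I) = (\<integral>\<^sup>+x. f x \<partial>distr (lebesgue_on_funs I) (lebesgue_on_funs I) (\<lambda>x. vadd I c x))"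
    by (simp add: distr_vadd[OF assms(1)])
  also have "\<dots> = (\<integral>\<^sup>+x. f (vadd I c x) \<partial>lebesgue_on_funs I)"
    by (subst nn_integral_distr[OF measurable_vadd_const]) (use assms(2) in auto)
  finally show ?thesis by simp
qed

lemma emeasure_vadd:
  assumes "finite I" "A \<in> sets (lebesgue_on_funs I)"
  shows "emeasure (lebesgue_on_funs I) {x \<in> I \<rightarrow>\<^sub>E UNIV. vadd I c x \<in> A} = emeasure (lebesgue_on_funs I) A"
proof -
  have "emeasure (lebesgue_on_funs I) A = emeasure (distr (lebesgue_on_funs I) (lebesgue_on_funs I) (\<lambda>x. vadd I c x)) A"
    by (simp add: distr_vadd[OF assms(1)])
  also have "\<dots> = emeasure (lebesgue_on_funs I) ((\<lambda>x. vadd I c x) -` A \<inter> space (lebesgue_on_funs I))"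
    using measurable_vadd_const assms(2) by (rule emeasure_distr)
  also have "(\<lambda>x. vadd I c x) -` A \<inter> space (lebesgue_on_funs I) = {x \<in> I \<rightarrow>\<^sub>E UNIV. vadd I c x \<in> A}"
    by (auto simp: space_PiM)
  finally show ?thesis by simp
qed

lemma emeasure_eq_nn_integral_indicator:
  assumes f: "f \<in> measurable N M" and B: "B \<in> sets M"
  shows "emeasure N {t \<in> space N. f t \<in> B} = (\<integral>\<^sup>+t. indicator B (f t) \<partial>N)"
proof -
  have "(\<integral>\<^sup>+t. indicator B (f t) \<partial>N) = (\<integral>\<^sup>+x. indicator B x \<partial>distr N M f)"
    using B by (subst nn_integral_distr[OF f]) auto
  also have "\<dots> = emeasure N (f -` B \<inter> space N)" using B f by (simp add: emeasure_distr)
  also have "f -` B \<inter> space N = {t \<in> space N. f t \<in> B}" by auto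
  finally show ?thesis by simp
qed

section \<open>Lattice-preserving additive bijections preserve Lebesgue measure\<close>

lemma vadd_commute: "vadd I x y = vadd I y x"
  by (auto simp: vadd_def fun_eq_iff)
lemma vadd_neg: "x \<in> I \<rightarrow>\<^sub>E UNIV \<Longrightarrow> vadd I (vneg I y) (vadd I y x) = x"
  by (auto simp: vadd_def vneg_def fun_eq_iff PiE_def extensional_def)
text \<open>A change of coordinates matching the two integer lattices. Measure preservation is
  derived from additivity and the lattices, without a determinant, so the two index sets need not be
  identified.\<close>

locale unimodular =
  fixes J :: "'j set" and I :: "'i set" and T :: "('j \<Rightarrow> real) \<Rightarrow> 'i \<Rightarrow> real"
  assumes fin: "finite J" "finite I"
    and meas: "T \<in> measurable (lebesgue_on_funs J) (lebesgue_on_funs I)"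
    and bij: "bij_betw T (J \<rightarrow>\<^sub>E UNIV) (I \<rightarrow>\<^sub>E UNIV)"
    and add: "\<And>s t. s \<in> J \<rightarrow>\<^sub>E UNIV \<Longrightarrow> t \<in> J \<rightarrow>\<^sub>E UNIV \<Longrightarrow> T (vadd J s t) = vadd I (T s) (T t)"
    and int: "T ` (J \<rightarrow>\<^sub>E \<int>) = I \<rightarrow>\<^sub>E \<int>"
begin

lemma T_in: "t \<in> J \<rightarrow>\<^sub>E UNIV \<Longrightarrow> T t \<in> I \<rightarrow>\<^sub>E UNIV"
  using bij by (auto simp: bij_betw_def)

lemma measurable_combined:
  assumes "A \<in> sets (lebesgue_on_funs I)"
  shows "(\<lambda>(x, t). indicator A (vadd I x (T t)) :: ennreal) \<in> borel_measurable (lebesgue_on_funs I \<Otimes>\<^sub>M lebesgue_on_funs J)"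
    and "(\<lambda>(x, t). indicator A (vadd I (vneg I (T t)) x) :: ennreal) \<in> borel_measurable (lebesgue_on_funs I \<Otimes>\<^sub>M lebesgue_on_funs J)"
proof -
  note [measurable] = meas assms
  have c: "(\<lambda>p. T (snd p) i) \<in> borel_measurable (lebesgue_on_funs I \<Otimes>\<^sub>M lebesgue_on_funs J)" if "i \<in> I" for i
  proof -
    have "(\<lambda>f. f i) \<in> measurable (lebesgue_on_funs I) lborel" using that by measurable
    then have "(\<lambda>f. f i) \<in> borel_measurable (lebesgue_on_funs I)" by simp
    from measurable_compose[OF measurable_compose[OF measurable_snd meas] this] show ?thesis .
  qed
  have d: "(\<lambda>p. fst p i) \<in> borel_measurable (lebesgue_on_funs I \<Otimes>\<^sub>M lebesgue_on_funs J)" if "i \<in> I" for i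
  proof -
    have "(\<lambda>f. f i) \<in> measurable (lebesgue_on_funs I) lborel" using that by measurable
    then have "(\<lambda>f. f i) \<in> borel_measurable (lebesgue_on_funs I)" by simp
    from measurable_compose[OF measurable_fst this] show ?thesis .
  qed
  have "(\<lambda>p. vadd I (fst p) (T (snd p))) \<in> measurable (lebesgue_on_funs I \<Otimes>\<^sub>M lebesgue_on_funs J) (lebesgue_on_funs I)"
    unfolding vadd_def by (intro measurable_restrict) (use c d in \<open>simp add: borel_measurable_add\<close>)
  from measurable_compose[OF this borel_measurable_indicator[OF assms]]
  show "(\<lambda>(x, t). indicator A (vadd I x (T t)) :: ennreal) \<in> borel_measurable (lebesgue_on_funs I \<Otimes>\<^sub>M lebesgue_on_funs J)"
    by (simp add: case_prod_beta')
  have "(\<lambda>p. vadd I (vneg I (T (snd p))) (fst p)) = (\<lambda>p. \<lambda>i\<in>I. fst p i - T (snd p) i)"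
    by (auto simp: vadd_def vneg_def fun_eq_iff)
  also have "\<dots> \<in> measurable (lebesgue_on_funs I \<Otimes>\<^sub>M lebesgue_on_funs J) (lebesgue_on_funs I)"
    by (intro measurable_restrict) (use c d in \<open>simp add: borel_measurable_diff\<close>)
  finally show "(\<lambda>(x, t). indicator A (vadd I (vneg I (T t)) x) :: ennreal) \<in> borel_measurable (lebesgue_on_funs I \<Otimes>\<^sub>M lebesgue_on_funs J)"
    using measurable_compose[OF _ borel_measurable_indicator[OF assms]] by (simp add: case_prod_beta')
qed

text \<open>The image of Lebesgue measure under \<open>T\<close> is translation invariant: by
  surjectivity every shift is some \<open>T u\<close>, and additivity turns it into a shift by
  \<open>u\<close> in the source.\<close>

lemma nn_integral_T_invariant:
  assumes f: "f \<in> borel_measurable (lebesgue_on_funs I)" and x: "x \<in> I \<rightarrow>\<^sub>E UNIV"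
  shows "(\<integral>\<^sup>+t. f (vadd I x (T t)) \<partial>lebesgue_on_funs J) = (\<integral>\<^sup>+t. f (T t) \<partial>lebesgue_on_funs J)"
proof -
  have "x \<in> T ` (J \<rightarrow>\<^sub>E UNIV)" using bij x by (simp add: bij_betw_def)
  then obtain u where u: "u \<in> J \<rightarrow>\<^sub>E UNIV" "T u = x" by auto
  have "(\<integral>\<^sup>+t. f (vadd I x (T t)) \<partial>lebesgue_on_funs J) = (\<integral>\<^sup>+t. f (T (vadd J u t)) \<partial>lebesgue_on_funs J)"
    by (intro nn_integral_cong) (simp add: add u space_PiM)
  also have "\<dots> = (\<integral>\<^sup>+t. f (T t) \<partial>lebesgue_on_funs J)"
    using nn_integral_vadd[OF fin(1) measurable_compose[OF meas f]] .
  finally show ?thesis .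
qed

text \<open>Both sides are the integral of the indicator of \<open>{(x, t). x \<in> A \<and> x + T t \<in> B}\<close>.\<close>

lemma emeasure_exchange:
  assumes A: "A \<in> sets (lebesgue_on_funs I)" and B: "B \<in> sets (lebesgue_on_funs I)"
  shows "emeasure (lebesgue_on_funs I) A * emeasure (lebesgue_on_funs J) {t \<in> J \<rightarrow>\<^sub>E UNIV. T t \<in> B} =
    emeasure (lebesgue_on_funs I) B * emeasure (lebesgue_on_funs J) {t \<in> J \<rightarrow>\<^sub>E UNIV. vneg I (T t) \<in> A}"
proof -
  let ?M = "lebesgue_on_funs I" and ?N = "lebesgue_on_funs J"
  interpret P: product_sigma_finite "\<lambda>_. lborel :: real measure" by standard
  interpret M: sigma_finite_measure ?M by (rule P.sigma_finite[OF fin(2)])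
  interpret N: sigma_finite_measure ?N by (rule P.sigma_finite[OF fin(1)])
  interpret pair_sigma_finite ?M ?N ..
  have iA: "(indicator A :: _ \<Rightarrow> ennreal) \<in> borel_measurable ?M" and iB: "(indicator B :: _ \<Rightarrow> ennreal) \<in> borel_measurable ?M" using A B by auto
  have mvn: "(\<lambda>x. vneg I x) \<in> measurable ?M ?M" unfolding vneg_def by measurable
  have "emeasure ?N {t \<in> J \<rightarrow>\<^sub>E UNIV. T t \<in> B} = (\<integral>\<^sup>+t. indicator B (T t) \<partial>?N)"
    using emeasure_eq_nn_integral_indicator[OF meas B] by (simp add: space_PiM)
  then have "emeasure ?M A * emeasure ?N {t \<in> J \<rightarrow>\<^sub>E UNIV. T t \<in> B} =
      (\<integral>\<^sup>+x. indicator A x * (\<integral>\<^sup>+t. indicator B (T t) \<partial>?N) \<partial>?M)"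
    using A by (simp add: nn_integral_multc)
  also have "\<dots> = (\<integral>\<^sup>+x. indicator A x * (\<integral>\<^sup>+t. indicator B (vadd I x (T t)) \<partial>?N) \<partial>?M)"
    by (intro nn_integral_cong arg_cong2[where f = "(*)"] refl nn_integral_T_invariant[OF iB, symmetric])
       (simp add: space_PiM)
  also have "\<dots> = (\<integral>\<^sup>+x. (\<integral>\<^sup>+t. indicator A x * indicator B (vadd I x (T t)) \<partial>?N) \<partial>?M)"
  proof (intro nn_integral_cong nn_integral_cmult[symmetric])
    fix x assume "x \<in> space ?M"
    then show "(\<lambda>t. indicator B (vadd I x (T t)) :: ennreal) \<in> borel_measurable ?N"
      using measurable_compose[OF measurable_Pair1'[of x ?M ?N] measurable_combined(1)[OF B]] by simp
  qed
  also have "\<dots> = (\<integral>\<^sup>+t. (\<integral>\<^sup>+x. indicator A x * indicator B (vadd I x (T t)) \<partial>?M) \<partial>?N)"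
  proof (rule Fubini'[symmetric])
    have "(\<lambda>p. indicator B (vadd I (fst p) (T (snd p))) :: ennreal) \<in> borel_measurable (?M \<Otimes>\<^sub>M ?N)"
      using measurable_combined(1)[OF B] by (simp add: case_prod_beta')
    from borel_measurable_times_ennreal[OF measurable_compose[OF measurable_fst iA] this]
    show "(\<lambda>(x, t). indicator A x * indicator B (vadd I x (T t)) :: ennreal) \<in> borel_measurable (?M \<Otimes>\<^sub>M ?N)"
      by (simp add: case_prod_beta')
  qed
  also have "\<dots> = (\<integral>\<^sup>+t. (\<integral>\<^sup>+x. indicator A (vadd I (vneg I (T t)) x) * indicator B x \<partial>?M) \<partial>?N)"
  proof (rule nn_integral_cong)
    fix t assume "t \<in> space ?N"
    have "(\<integral>\<^sup>+x. indicator A x * indicator B (vadd I x (T t)) \<partial>?M) =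
      (\<integral>\<^sup>+x. indicator A (vadd I (vneg I (T t)) (vadd I (T t) x)) * indicator B (vadd I (T t) x) \<partial>?M)"
    proof (rule nn_integral_cong)
      fix x assume "x \<in> space ?M"
      then have "vadd I (vneg I (T t)) (vadd I (T t) x) = x" by (simp add: vadd_neg space_PiM)
      then show "indicator A x * indicator B (vadd I x (T t)) =
          (indicator A (vadd I (vneg I (T t)) (vadd I (T t) x)) * indicator B (vadd I (T t) x) :: ennreal)"
        by (simp only: vadd_commute[of I x "T t"])
    qed
    also have "\<dots> = (\<integral>\<^sup>+x. indicator A (vadd I (vneg I (T t)) x) * indicator B x \<partial>?M)"
      using measurable_compose[OF measurable_vadd_const iA] iB
      by (intro nn_integral_vadd[OF fin(2), where f = "\<lambda>x. indicator A (vadd I (vneg I (T t)) x) * indicator B x"]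
          borel_measurable_times_ennreal)
    finally show "(\<integral>\<^sup>+x. indicator A x * indicator B (vadd I x (T t)) \<partial>?M) =
      (\<integral>\<^sup>+x. indicator A (vadd I (vneg I (T t)) x) * indicator B x \<partial>?M)" .
  qed
  also have "\<dots> = (\<integral>\<^sup>+x. (\<integral>\<^sup>+t. indicator A (vadd I (vneg I (T t)) x) * indicator B x \<partial>?N) \<partial>?M)"
  proof (rule Fubini')
    have "(\<lambda>p. indicator A (vadd I (vneg I (T (snd p))) (fst p)) :: ennreal) \<in> borel_measurable (?M \<Otimes>\<^sub>M ?N)"
      using measurable_combined(2)[OF A] by (simp add: case_prod_beta')
    from borel_measurable_times_ennreal[OF this measurable_compose[OF measurable_fst iB]]
    show "(\<lambda>(x, t). indicator A (vadd I (vneg I (T t)) x) * indicator B x :: ennreal) \<in> borel_measurable (?M \<Otimes>\<^sub>M ?N)"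
      by (simp add: case_prod_beta')
  qed
  also have "\<dots> = (\<integral>\<^sup>+x. (\<integral>\<^sup>+t. indicator A (vneg I (T t)) \<partial>?N) * indicator B x \<partial>?M)"
  proof (rule nn_integral_cong)
    fix x assume x: "x \<in> space ?M"
    have m: "(\<lambda>t. indicator A (vadd I (vneg I (T t)) x) :: ennreal) \<in> borel_measurable ?N"
      using measurable_compose[OF measurable_Pair1'[OF x] measurable_combined(2)[OF A]] by simp
    then have "(\<integral>\<^sup>+t. indicator A (vadd I (vneg I (T t)) x) * indicator B x \<partial>?N) =
      (\<integral>\<^sup>+t. indicator A (vadd I (vneg I (T t)) x) \<partial>?N) * indicator B x"
      by (rule nn_integral_multc)
    \<comment> \<open>Replacing \<open>T t\<close> by \<open>x + T t\<close> is allowed by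
      invariance and cancels the outer \<open>x\<close>, so that the inner integral no longer
      depends on \<open>x\<close>.\<close>
    also have "(\<integral>\<^sup>+t. indicator A (vadd I (vneg I (T t)) x) \<partial>?N) =
        (\<integral>\<^sup>+t. indicator A (vadd I (vneg I (vadd I x (T t))) x) \<partial>?N)"
    proof (rule nn_integral_T_invariant[symmetric, where f = "\<lambda>y. indicator A (vadd I (vneg I y) x)"])
      show "x \<in> I \<rightarrow>\<^sub>E UNIV" using x by (simp add: space_PiM)
      have "(\<lambda>y. indicator A (vadd I x (vneg I y)) :: ennreal) \<in> borel_measurable ?M"
        using measurable_compose[OF measurable_compose[OF mvn measurable_vadd_const[of I x]] iA] by simp
      then show "(\<lambda>y. indicator A (vadd I (vneg I y) x) :: ennreal) \<in> borel_measurable ?M"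
        by (simp only: vadd_commute[of I x])
    qed
    also have "\<dots> = (\<integral>\<^sup>+t. indicator A (vneg I (T t)) \<partial>?N)"
      by (intro nn_integral_cong arg_cong[where f = "indicator A"])
         (auto simp: vadd_def vneg_def)
    finally show "(\<integral>\<^sup>+t. indicator A (vadd I (vneg I (T t)) x) * indicator B x \<partial>?N) =
      (\<integral>\<^sup>+t. indicator A (vneg I (T t)) \<partial>?N) * indicator B x" .
  qed
  also have "\<dots> = emeasure ?M B * (\<integral>\<^sup>+t. indicator A (vneg I (T t)) \<partial>?N)"
    by (subst nn_integral_cmult_indicator[OF B]) (rule mult.commute)
  also have "(\<integral>\<^sup>+t. indicator A (vneg I (T t)) \<partial>?N) = emeasure ?N {t \<in> J \<rightarrow>\<^sub>E UNIV. vneg I (T t) \<in> A}"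
    using emeasure_eq_nn_integral_indicator[OF measurable_compose[OF meas mvn] A] by (simp add: space_PiM)
  finally show ?thesis .
qed

end

text \<open>Half-open, so that the integer translates tile the space without overlaps.\<close>

definition cube :: "'i set \<Rightarrow> ('i \<Rightarrow> real) set" where
  "cube I = I \<rightarrow>\<^sub>E {0..<1}"

lemma sets_cube: "finite I \<Longrightarrow> cube I \<in> sets (lebesgue_on_funs I)"
  unfolding cube_def by (intro sets_PiM_I_finite) auto

lemma emeasure_cube:
  assumes "finite I" shows "emeasure (lebesgue_on_funs I) (cube I) = 1"
proof -
  interpret product_sigma_finite "\<lambda>_. lborel :: real measure" by standard
  show ?thesis unfolding cube_def using assms by (subst emeasure_PiM) auto
qed

lemma cube_translate:
  assumes "x \<in> I \<rightarrow>\<^sub>E UNIV"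
  shows "\<exists>!z. z \<in> I \<rightarrow>\<^sub>E \<int> \<and> vadd I z x \<in> cube I"
proof
  show "(\<lambda>i\<in>I. - of_int \<lfloor>x i\<rfloor>) \<in> I \<rightarrow>\<^sub>E \<int> \<and> vadd I (\<lambda>i\<in>I. - of_int \<lfloor>x i\<rfloor>) x \<in> cube I"
    by (auto simp: vadd_def cube_def) linarith
  fix z assume z: "z \<in> I \<rightarrow>\<^sub>E \<int> \<and> vadd I z x \<in> cube I"
  show "z = (\<lambda>i\<in>I. - of_int \<lfloor>x i\<rfloor>)"
  proof
    fix i show "z i = (\<lambda>i\<in>I. - of_int \<lfloor>x i\<rfloor>) i"
    proof (cases "i \<in> I")
      case True
      then have "z i \<in> \<int>" using PiE_mem[of z I "\<lambda>_. \<int>"] z by simp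
      then obtain k where k: "z i = of_int k" by (elim Ints_cases)
      have "vadd I z x i \<in> {0..<1}" using PiE_mem[of "vadd I z x" I "\<lambda>_. {0..<1}"] z True by (simp add: cube_def)
      then have "0 \<le> of_int k + x i" "of_int k + x i < 1" using True k by (auto simp: vadd_def)
      then have "\<lfloor>x i\<rfloor> = - k" by linarith
      then show ?thesis using True k by simp
    next
      case False then show ?thesis using z by (auto simp: PiE_def extensional_def)
    qed
  qed
qed

lemma countable_int_points: "finite I \<Longrightarrow> countable (I \<rightarrow>\<^sub>E (\<int> :: real set))"
  by (intro countable_PiE) (auto simp: Ints_def)

lemma bij_vneg_int: "bij_betw (vneg I) (I \<rightarrow>\<^sub>E (\<int> :: real set)) (I \<rightarrow>\<^sub>E \<int>)"
proof (rule bij_betw_byWitness[where f' = "vneg I"])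
  show "\<forall>a\<in>I \<rightarrow>\<^sub>E \<int>. vneg I (vneg I a) = a"
    by (auto simp: vneg_def fun_eq_iff PiE_def extensional_def)
  show "\<forall>a\<in>I \<rightarrow>\<^sub>E \<int>. vneg I (vneg I a) = a"
    by (auto simp: vneg_def fun_eq_iff PiE_def extensional_def)
qed (auto simp: vneg_def)

text \<open>Every point has exactly one integer shift into \<open>B\<close>. Sorting the points of
  \<open>A\<close> by that shift gives a countable disjoint decomposition.\<close>

lemma emeasure_split_translates:
  assumes fin: "finite I" and A: "A \<in> sets (lebesgue_on_funs I)" and B: "B \<in> sets (lebesgue_on_funs I)"
    and dom: "\<And>x. x \<in> I \<rightarrow>\<^sub>E UNIV \<Longrightarrow> \<exists>!z. z \<in> I \<rightarrow>\<^sub>E \<int> \<and> vadd I z x \<in> B"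
  shows "emeasure (lebesgue_on_funs I) A =
    (\<integral>\<^sup>+z. emeasure (lebesgue_on_funs I) {x \<in> A. vadd I z x \<in> B} \<partial>count_space (I \<rightarrow>\<^sub>E \<int>))"
proof -
  have sub: "A \<subseteq> I \<rightarrow>\<^sub>E UNIV" using sets.sets_into_space[OF A] by (simp add: space_PiM)
  have m: "{x \<in> A. vadd I z x \<in> B} \<in> sets (lebesgue_on_funs I)" for z
  proof -
    have "{x \<in> A. vadd I z x \<in> B} = A \<inter> ((\<lambda>x. vadd I z x) -` B \<inter> space (lebesgue_on_funs I))"
      using sub by (auto simp: space_PiM)
    then show ?thesis using measurable_sets[OF measurable_vadd_const B] A by auto
  qed
  have "A = (\<Union>z\<in>I \<rightarrow>\<^sub>E \<int>. {x \<in> A. vadd I z x \<in> B})"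
  proof (intro equalityI subsetI)
    fix x assume x: "x \<in> A"
    then have "x \<in> I \<rightarrow>\<^sub>E UNIV" using sub by blast
    from ex1_implies_ex[OF dom[OF this]] show "x \<in> (\<Union>z\<in>I \<rightarrow>\<^sub>E \<int>. {x \<in> A. vadd I z x \<in> B})" using x by auto
  qed auto
  then have "emeasure (lebesgue_on_funs I) A = emeasure (lebesgue_on_funs I) (\<Union>z\<in>I \<rightarrow>\<^sub>E \<int>. {x \<in> A. vadd I z x \<in> B})"
    by simp
  also have "\<dots> = (\<integral>\<^sup>+z. emeasure (lebesgue_on_funs I) {x \<in> A. vadd I z x \<in> B} \<partial>count_space (I \<rightarrow>\<^sub>E \<int>))"
  proof (rule emeasure_UN_countable)
    show "disjoint_family_on (\<lambda>z. {x \<in> A. vadd I z x \<in> B}) (I \<rightarrow>\<^sub>E \<int>)"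
      unfolding disjoint_family_on_def using dom sub by blast
  qed (use m countable_int_points[OF fin] in auto)
  finally show ?thesis .
qed

text \<open>Cutting \<open>F\<close> into its intersections with the integer translates of the cube and translating the
  pieces back tiles the cube.\<close>

lemma emeasure_fundamental_domain:
  assumes fin: "finite I" and F: "F \<in> sets (lebesgue_on_funs I)"
    and dom: "\<And>x. x \<in> I \<rightarrow>\<^sub>E UNIV \<Longrightarrow> \<exists>!z. z \<in> I \<rightarrow>\<^sub>E \<int> \<and> vadd I z x \<in> F"
  shows "emeasure (lebesgue_on_funs I) F = 1"
proof -
  let ?M = "lebesgue_on_funs I"
  have subF: "F \<subseteq> I \<rightarrow>\<^sub>E UNIV" using sets.sets_into_space[OF F] by (simp add: space_PiM)
  have subC: "cube I \<subseteq> I \<rightarrow>\<^sub>E UNIV" by (auto simp: cube_def)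
  have "emeasure ?M F = (\<integral>\<^sup>+z. emeasure ?M {x \<in> F. vadd I z x \<in> cube I} \<partial>count_space (I \<rightarrow>\<^sub>E \<int>))"
    by (rule emeasure_split_translates[OF fin F sets_cube[OF fin] cube_translate])
  also have "\<dots> = (\<integral>\<^sup>+z. emeasure ?M {x \<in> cube I. vadd I (vneg I z) x \<in> F} \<partial>count_space (I \<rightarrow>\<^sub>E \<int>))"
  proof (rule nn_integral_cong)
    fix z :: "'a \<Rightarrow> real"
    have m: "{x \<in> cube I. vadd I (vneg I z) x \<in> F} \<in> sets ?M"
    proof -
      have "{x \<in> cube I. vadd I (vneg I z) x \<in> F} = cube I \<inter> ((\<lambda>x. vadd I (vneg I z) x) -` F \<inter> space ?M)"
        using subC by (auto simp: space_PiM)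
      then show ?thesis using measurable_sets[OF measurable_vadd_const F] sets_cube[OF fin] by auto
    qed
    have "{x \<in> F. vadd I z x \<in> cube I} =
      {x \<in> I \<rightarrow>\<^sub>E UNIV. vadd I z x \<in> {x \<in> cube I. vadd I (vneg I z) x \<in> F}}"
      using subF by (auto simp: vadd_neg)
    then show "emeasure ?M {x \<in> F. vadd I z x \<in> cube I} = emeasure ?M {x \<in> cube I. vadd I (vneg I z) x \<in> F}"
      using emeasure_vadd[OF fin m, of z] by simp
  qed
  also have "\<dots> = (\<integral>\<^sup>+z. emeasure ?M {x \<in> cube I. vadd I z x \<in> F} \<partial>count_space (I \<rightarrow>\<^sub>E \<int>))"
    by (rule nn_integral_bij_count_space[OF bij_vneg_int])
  also have "\<dots> = emeasure ?M (cube I)"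
    by (rule emeasure_split_translates[OF fin sets_cube[OF fin] F dom, symmetric])
  finally show ?thesis using emeasure_cube[OF fin] by simp
qed

lemma vneg_vneg: "x \<in> I \<rightarrow>\<^sub>E UNIV \<Longrightarrow> vneg I (vneg I x) = x"
  by (auto simp: vneg_def fun_eq_iff PiE_def extensional_def)

text \<open>Taking the unit cube for \<open>A\<close> in \<open>emeasure_exchange\<close> shows that
  the two measures are proportional. The constant is the measure of \<open>F\<close>, which is a
  fundamental domain of the source lattice because \<open>T\<close> matches the lattices; hence it
  is 1.\<close>

theorem (in unimodular) emeasure_preimage:
  assumes B: "B \<in> sets (lebesgue_on_funs I)"
  shows "emeasure (lebesgue_on_funs J) {t \<in> J \<rightarrow>\<^sub>E UNIV. T t \<in> B} = emeasure (lebesgue_on_funs I) B"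
proof -
  define F where "F = {t \<in> J \<rightarrow>\<^sub>E UNIV. vneg I (T t) \<in> cube I}"
  have mvn: "(\<lambda>x. vneg I x) \<in> measurable (lebesgue_on_funs I) (lebesgue_on_funs I)" unfolding vneg_def by measurable
  have "F = (\<lambda>t. vneg I (T t)) -` cube I \<inter> space (lebesgue_on_funs J)" by (auto simp: F_def space_PiM)
  then have F: "F \<in> sets (lebesgue_on_funs J)"
    using measurable_sets[OF measurable_compose[OF meas mvn] sets_cube[OF fin(2)]] by simp
  have "emeasure (lebesgue_on_funs J) F = 1"
  proof (rule emeasure_fundamental_domain[OF fin(1) F])
    fix t assume t: "t \<in> J \<rightarrow>\<^sub>E (UNIV :: real set)"
    have iff: "vadd J z t \<in> F \<longleftrightarrow> vadd I (vneg I (T z)) (vneg I (T t)) \<in> cube I" if "z \<in> J \<rightarrow>\<^sub>E \<int>" for z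
    proof -
      have "z \<in> J \<rightarrow>\<^sub>E UNIV" using that by auto
      then have "vneg I (T (vadd J z t)) = vadd I (vneg I (T z)) (vneg I (T t))"
        using add[of z t] t by (auto simp: vadd_def vneg_def fun_eq_iff)
      then show ?thesis by (simp add: F_def)
    qed
    from cube_translate[of "vneg I (T t)" I] obtain w where w: "w \<in> I \<rightarrow>\<^sub>E \<int>" "vadd I w (vneg I (T t)) \<in> cube I"
      and u: "\<And>w'. w' \<in> I \<rightarrow>\<^sub>E \<int> \<Longrightarrow> vadd I w' (vneg I (T t)) \<in> cube I \<Longrightarrow> w' = w" by (metis vneg_in)
    have "vneg I w \<in> I \<rightarrow>\<^sub>E \<int>" using w by (auto simp: vneg_def)
    then have "vneg I w \<in> T ` (J \<rightarrow>\<^sub>E \<int>)" using int by simp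
    then obtain z where z: "z \<in> J \<rightarrow>\<^sub>E \<int>" "T z = vneg I w" by auto
    show "\<exists>!z. z \<in> J \<rightarrow>\<^sub>E \<int> \<and> vadd J z t \<in> F"
    proof
      have "vneg I (vneg I w) = w" using w by (intro vneg_vneg) auto
      then show "z \<in> J \<rightarrow>\<^sub>E \<int> \<and> vadd J z t \<in> F" using iff z w by simp
      fix z' assume z': "z' \<in> J \<rightarrow>\<^sub>E \<int> \<and> vadd J z' t \<in> F"
      have Tz': "T z' \<in> I \<rightarrow>\<^sub>E \<int>" unfolding int[symmetric] using z' by (rule imageI[OF conjunct1])
      have zU: "z' \<in> J \<rightarrow>\<^sub>E UNIV" using conjunct1[OF z'] by auto
      from Tz' have "vneg I (T z') \<in> I \<rightarrow>\<^sub>E \<int>" by (auto simp: vneg_def)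
      then have "vneg I (T z') = w" using u iff z' by blast
      then have "T z' = vneg I w" using vneg_vneg[OF T_in[OF zU]] by simp
      then have e: "T z' = T z" using z(2) by simp
      have "z \<in> J \<rightarrow>\<^sub>E UNIV" using z(1) by auto
      then show "z' = z" using bij_betw_imp_inj_on[OF bij] e zU by (simp add: inj_on_def)
    qed
  qed
  then show ?thesis
    using emeasure_exchange[OF sets_cube[OF fin(2)] B] emeasure_cube[OF fin(2)] by (simp add: F_def)
qed

section \<open>Volumes of products of open simplices\<close>

definition simplices :: "'i set \<Rightarrow> ('i \<Rightarrow> 'c) \<Rightarrow> 'c set \<Rightarrow> ('c \<Rightarrow> real) \<Rightarrow> ('i \<Rightarrow> real) set" where
  "simplices I c C L = {x \<in> I \<rightarrow>\<^sub>E UNIV. (\<forall>i\<in>I. x i > 0) \<and> (\<forall>a\<in>C. (\<Sum>i | i \<in> I \<and> c i = a. x i) < L a)}"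

lemma sets_simplices:
  assumes "finite I" "finite C" shows "simplices I c C L \<in> sets (lebesgue_on_funs I)"
proof -
  have m: "(\<lambda>x. \<Sum>i | i \<in> I \<and> c i = a. x i) \<in> borel_measurable (lebesgue_on_funs I)" for a
  proof (rule borel_measurable_sum)
    fix i assume "i \<in> {i. i \<in> I \<and> c i = a}"
    then have "(\<lambda>x. x i) \<in> measurable (lebesgue_on_funs I) lborel" by (intro measurable_component_singleton) auto
    then show "(\<lambda>x. x i) \<in> borel_measurable (lebesgue_on_funs I)" by simp
  qed
  have m2: "(\<lambda>x. x i) \<in> borel_measurable (lebesgue_on_funs I)" if "i \<in> I" for i
  proof -
    have "(\<lambda>x. x i) \<in> measurable (lebesgue_on_funs I) lborel" using that by (intro measurable_component_singleton) auto
    then show ?thesis by simp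
  qed
  have "simplices I c C L = {x \<in> space (lebesgue_on_funs I). (\<forall>i\<in>I. x i > 0) \<and> (\<forall>a\<in>C. (\<Sum>i | i \<in> I \<and> c i = a. x i) < L a)}"
    by (simp add: simplices_def space_PiM)
  also have "\<dots> \<in> sets (lebesgue_on_funs I)"
    by (intro sets.sets_Collect_conj sets.sets_Collect_finite_All borel_measurable_less m m2)
       (use assms in auto)
  finally show ?thesis .
qed

text \<open>Integrate out one coordinate at a time. A coordinate with value \<open>y\<close> lowers
  the bound of its own colour to \<open>L (c b) - y\<close>, and integrating the resulting power
  raises the exponent and the factorial of that colour by one.\<close>

lemma emeasure_simplices:
  assumes "finite I" "finite C" "c ` I \<subseteq> C" "\<And>a. a \<in> C \<Longrightarrow> L a > 0"
  shows "emeasure (lebesgue_on_funs I) (simplices I c C L) =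
    ennreal (\<Prod>a\<in>C. L a ^ card {i \<in> I. c i = a} / fact (card {i \<in> I. c i = a}))"
  using assms(1,3,4)
proof (induction I arbitrary: L rule: finite_induct)
  case empty
  have "simplices {} c C L = {\<lambda>x. undefined}" using empty by (auto simp: simplices_def)
  then show ?case by (simp add: PiM_empty)
next
  case (insert b I)
  interpret product_sigma_finite "\<lambda>_. lborel :: real measure" by standard
  have fin: "finite (insert b I)" using insert by simp
  define k where "k = card {i \<in> I. c i = c b}"
  define Q where "Q = (\<Prod>a\<in>C - {c b}. L a ^ card {i \<in> I. c i = a} / fact (card {i \<in> I. c i = a}))"
  have bC: "c b \<in> C" using insert.prems by auto
  have Lb: "L (c b) > 0" using insert.prems bC by auto
  have Q0: "Q \<ge> 0" unfolding Q_def using insert.prems by (intro prod_nonneg) (auto intro!: divide_nonneg_nonneg zero_le_power less_imp_le)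
  have mem: "x(b := y) \<in> simplices (insert b I) c C L \<longleftrightarrow>
      y \<in> {0<..<L (c b)} \<and> x \<in> simplices I c C (L(c b := L (c b) - y))"
    if x: "x \<in> space (lebesgue_on_funs I)" for x y
  proof -
    have x': "x \<in> I \<rightarrow>\<^sub>E UNIV" using x by (simp add: space_PiM)
    have s: "(\<Sum>i | i \<in> insert b I \<and> c i = a. (x(b := y)) i) =
      (\<Sum>i | i \<in> I \<and> c i = a. x i) + (if a = c b then y else 0)" for a
    proof -
      have e: "(\<Sum>i | i \<in> I \<and> c i = a. (x(b := y)) i) = (\<Sum>i | i \<in> I \<and> c i = a. x i)"
        using insert.hyps by (intro sum.cong) auto
      have "{i. i \<in> insert b I \<and> c i = a} = (if a = c b then insert b {i \<in> I. c i = a} else {i \<in> I. c i = a})" by auto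
      then show ?thesis using insert.hyps e by auto
    qed
    have nn: "(\<Sum>i | i \<in> I \<and> c i = c b. x i) \<ge> 0" if "\<forall>i\<in>I. x i > 0"
      using that by (intro sum_nonneg) (auto intro: less_imp_le)
    have 1: "(\<forall>i\<in>insert b I. (x(b := y)) i > 0) \<longleftrightarrow> y > 0 \<and> (\<forall>i\<in>I. x i > 0)"
      using insert.hyps by auto
    have 2: "x(b := y) \<in> insert b I \<rightarrow>\<^sub>E UNIV" using x' by (auto simp: PiE_def extensional_def)
    have 3: "(\<forall>a\<in>C. (\<Sum>i | i \<in> I \<and> c i = a. x i) + (if a = c b then y else 0) < L a) \<longleftrightarrow>
      (\<forall>a\<in>C. (\<Sum>i | i \<in> I \<and> c i = a. x i) < (L(c b := L (c b) - y)) a)"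
      by (intro ball_cong) auto
    show ?thesis unfolding simplices_def mem_Collect_eq s 1 3 using x' 2 bC nn by fastforce
  qed
  have IH: "emeasure (lebesgue_on_funs I) (simplices I c C (L(c b := L (c b) - y))) =
      ennreal (Q * ((L (c b) - y) ^ k / fact k))" if y: "y \<in> {0<..<L (c b)}" for y
  proof -
    have "emeasure (lebesgue_on_funs I) (simplices I c C (L(c b := L (c b) - y))) =
      ennreal (\<Prod>a\<in>C. (L(c b := L (c b) - y)) a ^ card {i \<in> I. c i = a} / fact (card {i \<in> I. c i = a}))"
      by (rule insert.IH) (use insert.prems y in auto)
    also have "(\<Prod>a\<in>C. (L(c b := L (c b) - y)) a ^ card {i \<in> I. c i = a} / fact (card {i \<in> I. c i = a})) =
       Q * ((L (c b) - y) ^ k / fact k)"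
      unfolding Q_def k_def by (subst prod.remove[OF assms(2) bC]) (auto simp: mult.commute intro!: prod.cong)
    finally show ?thesis .
  qed
  have "emeasure (lebesgue_on_funs (insert b I)) (simplices (insert b I) c C L) =
    (\<integral>\<^sup>+x. indicator (simplices (insert b I) c C L) x \<partial>lebesgue_on_funs (insert b I))"
    using sets_simplices[OF fin assms(2)] by simp
  also have "\<dots> = (\<integral>\<^sup>+y. \<integral>\<^sup>+x. indicator (simplices (insert b I) c C L) (x(b := y)) \<partial>lebesgue_on_funs I \<partial>lborel)"
    using insert.hyps sets_simplices[OF fin assms(2)] by (intro product_nn_integral_insert_rev) auto
  also have "\<dots> = (\<integral>\<^sup>+y. \<integral>\<^sup>+x. indicator {0<..<L (c b)} y * indicator (simplices I c C (L(c b := L (c b) - y))) x \<partial>lebesgue_on_funs I \<partial>lborel)"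
    by (intro nn_integral_cong) (simp add: mem indicator_def)
  also have "\<dots> = (\<integral>\<^sup>+y. indicator {0<..<L (c b)} y * emeasure (lebesgue_on_funs I) (simplices I c C (L(c b := L (c b) - y))) \<partial>lborel)"
    using sets_simplices[OF insert.hyps(1) assms(2)] by (intro nn_integral_cong) (simp add: nn_integral_cmult)
  also have "\<dots> = (\<integral>\<^sup>+y. ennreal (Q * ((L (c b) - y) ^ k / fact k)) * indicator {0..L (c b)} y \<partial>lborel)"
  \<comment> \<open>The induction hypothesis needs positive bounds, so it covers only the open
    interval. The two endpoints are null.\<close>
  proof (rule nn_integral_cong_AE)
    have "AE y in lborel. y \<noteq> 0 \<and> y \<noteq> L (c b)" by (intro AE_conjI AE_lborel_singleton)
    then show "AE y in lborel. indicator {0<..<L (c b)} y * emeasure (lebesgue_on_funs I) (simplices I c C (L(c b := L (c b) - y))) =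
       ennreal (Q * ((L (c b) - y) ^ k / fact k)) * indicator {0..L (c b)} y"
      by eventually_elim (auto simp: indicator_def IH)
  qed
  also have "\<dots> = ennreal (Q * (L (c b) ^ Suc k / fact (Suc k)))"
  proof (rule nn_integral_has_integral_lebesgue')
    let ?F = "\<lambda>y. - Q / fact (Suc k) * (L (c b) - y) ^ Suc k"
    have der: "(?F has_real_derivative Q * ((L (c b) - y) ^ k / fact k)) (at y)" for y
    proof -
      have "((\<lambda>y. (L (c b) - y) ^ Suc k) has_real_derivative - (real (Suc k) * (L (c b) - y) ^ k)) (at y)"
        by (auto intro!: derivative_eq_intros simp del: power_Suc of_nat_Suc)
      then have "(?F has_real_derivative - Q / fact (Suc k) * - (real (Suc k) * (L (c b) - y) ^ k)) (at y)"
        by (rule DERIV_cmult)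
      moreover have "- Q / fact (Suc k) * - (real (Suc k) * (L (c b) - y) ^ k) = Q * ((L (c b) - y) ^ k / fact k)"
        by (simp add: field_simps del: of_nat_Suc)
      ultimately show ?thesis by simp
    qed
    have "((\<lambda>y. Q * ((L (c b) - y) ^ k / fact k)) has_integral (?F (L (c b)) - ?F 0)) {0..L (c b)}"
      using Lb der
      by (intro fundamental_theorem_of_calculus)
         (auto simp: has_real_derivative_iff_has_vector_derivative[symmetric] intro: has_field_derivative_at_within)
    then show "((\<lambda>y. Q * ((L (c b) - y) ^ k / fact k)) has_integral (Q * (L (c b) ^ Suc k / fact (Suc k)))) {0..L (c b)}"
      by simp
  qed (use Q0 in \<open>auto intro!: mult_nonneg_nonneg divide_nonneg_nonneg\<close>)
  also have "\<dots> = (\<Prod>a\<in>C. L a ^ card {i \<in> insert b I. c i = a} / fact (card {i \<in> insert b I. c i = a}))"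
  proof -
    have "{i \<in> insert b I. c i = c b} = insert b {i \<in> I. c i = c b}" by auto
    then have "card {i \<in> insert b I. c i = c b} = Suc k" using insert.hyps by (simp add: k_def)
    moreover have "{i \<in> insert b I. c i = a} = {i \<in> I. c i = a}" if "a \<noteq> c b" for a using that by auto
    ultimately show ?thesis unfolding Q_def
      by (subst prod.remove[OF assms(2) bC, of "\<lambda>a. L a ^ card {i \<in> insert b I. c i = a} / fact (card {i \<in> insert b I. c i = a})"]) (auto simp: mult.commute intro!: prod.cong)
  qed
  finally show ?case .
qed

section \<open>The kernel volume in edge coordinates\<close>

lemma length_kernel_sum:
  assumes "\<And>i. i < k \<Longrightarrow> b i \<in> length_kernel R"
  shows "(\<lambda>e. \<Sum>i<(k::nat). t i * b i e) \<in> length_kernel R"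
proof -
  have "boundary_length R (\<lambda>e. \<Sum>i<k. t i * b i e) \<beta> = (\<Sum>i<k. t i * boundary_length R (b i) \<beta>)" for \<beta>
    unfolding boundary_length_def by (subst sum.swap) (simp add: sum_distrib_left)
  then show ?thesis using assms by (auto simp: length_kernel_def edge_space_def)
qed

text \<open>Restriction to the edges in \<open>I\<close> identifies the kernel with all real
  functions on \<open>I\<close>, and its integer points with the integer functions. Such coordinates
  make the volume computable whatever basis and origin \<open>kernel_volume\<close> selects.\<close>

locale kernel_coordinates =
  fixes R :: "('h, 'z) ribbon_graph_scheme" and I :: "'h set set"
  assumes finI: "finite I"
    and bij_restrict: "bij_betw (\<lambda>m. restrict m I) (length_kernel R) (I \<rightarrow>\<^sub>E UNIV)"
    and integral: "\<And>m e. m \<in> length_kernel R \<Longrightarrow> (\<And>e. e \<in> I \<Longrightarrow> m e \<in> \<int>) \<Longrightarrow> m e \<in> \<int>"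
begin

lemma kernel_eqI:
  assumes "m \<in> length_kernel R" "m' \<in> length_kernel R" "\<And>e. e \<in> I \<Longrightarrow> m e = m' e"
  shows "m = m'"
  using bij_betw_imp_inj_on[OF bij_restrict] assms by (metis (mono_tags, lifting) inj_on_def restrict_ext)

lemma kernel_ex:
  obtains m where "m \<in> length_kernel R" "\<And>e. e \<in> I \<Longrightarrow> m e = v e"
proof -
  have "restrict v I \<in> (\<lambda>m. restrict m I) ` length_kernel R"
    using bij_restrict by (simp add: bij_betw_def)
  then obtain m where "m \<in> length_kernel R" "restrict v I = restrict m I" by auto
  then show ?thesis using that by (metis restrict_apply')
qed

text \<open>The basis dual to the coordinates in \<open>I\<close> works. Existence is needed so that
  the \<open>SOME\<close> in \<open>kernel_volume\<close> really picks a lattice basis.\<close>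

lemma ex_kernel_lattice_basis: "\<exists>k b. kernel_lattice_basis R k b"
proof -
  define k where "k = card I"
  obtain f where f: "bij_betw f {..<k} I" using ex_bij_betw_nat_finite[OF finI] by (auto simp: k_def atLeast0LessThan)
  have "\<exists>m. m \<in> length_kernel R \<and> (\<forall>e\<in>I. m e = (if e = f i then 1 else 0))" for i
    by (rule kernel_ex[of "\<lambda>e. if e = f i then 1 else 0"]) blast
  then obtain b where b: "\<And>i. b i \<in> length_kernel R" "\<And>i e. e \<in> I \<Longrightarrow> b i e = (if e = f i then 1 else 0)"
    by metis
  have coord: "(\<Sum>i<k. t i * b i (f j)) = t j" if "j < k" for t j
  proof -
    have fj: "f j \<in> I" using bij_betw_apply[OF f] that by auto
    have "(\<Sum>i<k. t i * b i (f j)) = (\<Sum>i<k. if i = j then t i else 0)"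
    proof (rule sum.cong)
      fix i assume "i \<in> {..<k}"
      then have "f j = f i \<longleftrightarrow> i = j" using that f by (auto simp: bij_betw_def inj_on_def)
      then show "t i * b i (f j) = (if i = j then t i else 0)" using b(2)[OF fj] by auto
    qed simp
    then show ?thesis using that by simp
  qed
  have onI: "\<exists>j<k. e = f j" if "e \<in> I" for e using that f by (auto simp: bij_betw_def)
  have expand: "m = (\<lambda>e. \<Sum>i<k. m (f i) * b i e)" if m: "m \<in> length_kernel R" for m
  proof (rule kernel_eqI[OF m length_kernel_sum])
    fix e assume "e \<in> I"
    then obtain j where j: "j < k" "e = f j" using onI by blast
    then show "m e = (\<Sum>i<k. m (f i) * b i e)" using coord[OF j(1), of "\<lambda>i. m (f i)"] by simp
  qed (use b in auto)
  have "kernel_lattice_basis R k b"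
    unfolding kernel_lattice_basis_def
  proof (intro conjI ballI allI impI)
    fix i assume "i < k" show "b i \<in> length_kernel R" by (rule b)
    fix e show "b i e \<in> \<int>" by (rule integral[OF b(1)]) (simp add: b)
  next
    fix m assume m: "m \<in> length_kernel R"
    show "\<exists>!t. t \<in> {..<k} \<rightarrow>\<^sub>E UNIV \<and> m = (\<lambda>e. \<Sum>i<k. t i * b i e)"
    proof
      show "(\<lambda>i\<in>{..<k}. m (f i)) \<in> {..<k} \<rightarrow>\<^sub>E UNIV \<and> m = (\<lambda>e. \<Sum>i<k. (\<lambda>i\<in>{..<k}. m (f i)) i * b i e)"
        using expand[OF m] by simp
      fix t assume t: "t \<in> {..<k} \<rightarrow>\<^sub>E UNIV \<and> m = (\<lambda>e. \<Sum>i<k. t i * b i e)"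
      then have "t j = m (f j)" if "j < k" for j using coord[OF that, of t] by simp
      then show "t = (\<lambda>i\<in>{..<k}. m (f i))" using t by (auto simp: fun_eq_iff PiE_def extensional_def)
    qed
  next
    fix m assume m: "m \<in> length_kernel R" and i: "\<forall>e. m e \<in> \<int>"
    then show "\<exists>t. (\<forall>i<k. t i \<in> \<int>) \<and> m = (\<lambda>e. \<Sum>i<k. t i * b i e)"
      using expand[OF m] by (intro exI[of _ "\<lambda>i. m (f i)"]) auto
  qed
  then show ?thesis by blast
qed

text \<open>Applies to the arbitrary basis selected in \<open>kernel_volume\<close>: the passage
  from its coefficients to the values on \<open>I\<close> is a composite of two lattice-preserving
  linear bijections.\<close>

lemma unimodular_of_basis:
  assumes b: "kernel_lattice_basis R k b"
  shows "unimodular {..<k} I (\<lambda>t. \<lambda>e\<in>I. \<Sum>i<k. t i * b i e)"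
proof -
  have bK: "\<And>i. i < k \<Longrightarrow> b i \<in> length_kernel R" and bI: "\<And>i e. i < k \<Longrightarrow> b i e \<in> \<int>"
    and uniq: "\<And>m. m \<in> length_kernel R \<Longrightarrow> \<exists>!t. t \<in> {..<k} \<rightarrow>\<^sub>E UNIV \<and> m = (\<lambda>e. \<Sum>i<k. t i * b i e)"
    and int: "\<And>m. m \<in> length_kernel R \<Longrightarrow> (\<forall>e. m e \<in> \<int>) \<Longrightarrow> \<exists>t. (\<forall>i<k. t i \<in> \<int>) \<and> m = (\<lambda>e. \<Sum>i<k. t i * b i e)"
    using b unfolding kernel_lattice_basis_def by auto
  define S where "S t = (\<lambda>e. \<Sum>i<k. t i * b i e)" for t :: "nat \<Rightarrow> real"
  have SK: "S t \<in> length_kernel R" for t unfolding S_def using bK by (rule length_kernel_sum)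
  have "bij_betw S ({..<k} \<rightarrow>\<^sub>E UNIV) (length_kernel R)"
    unfolding bij_betw_def
  proof
    show "inj_on S ({..<k} \<rightarrow>\<^sub>E UNIV)" unfolding inj_on_def using uniq[OF SK] unfolding S_def by blast
    show "S ` ({..<k} \<rightarrow>\<^sub>E UNIV) = length_kernel R" using SK uniq unfolding S_def by blast
  qed
  from bij_betw_trans[OF this bij_restrict]
  have bij: "bij_betw (\<lambda>t. \<lambda>e\<in>I. \<Sum>i<k. t i * b i e) ({..<k} \<rightarrow>\<^sub>E UNIV) (I \<rightarrow>\<^sub>E UNIV)"
    by (simp add: S_def o_def)
  show ?thesis
  proof
    show "finite {..<k}" "finite I" by (simp_all add: finI)
    show "(\<lambda>t. \<lambda>e\<in>I. \<Sum>i<k. t i * b i e) \<in> measurable (lebesgue_on_funs {..<k}) (lebesgue_on_funs I)"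
    proof (rule measurable_restrict)
      fix e assume "e \<in> I"
      have "(\<lambda>t. \<Sum>i<k. t i * b i e) \<in> borel_measurable (lebesgue_on_funs {..<k})"
      proof (intro borel_measurable_sum borel_measurable_times borel_measurable_const)
        fix i assume "i \<in> {..<k}"
        then have "(\<lambda>t. t i) \<in> measurable (lebesgue_on_funs {..<k}) lborel" by (rule measurable_component_singleton)
        then show "(\<lambda>t. t i) \<in> borel_measurable (lebesgue_on_funs {..<k})" by simp
      qed
      then show "(\<lambda>t. \<Sum>i<k. t i * b i e) \<in> measurable (lebesgue_on_funs {..<k}) lborel" by simp
    qed
    show "bij_betw (\<lambda>t. \<lambda>e\<in>I. \<Sum>i<k. t i * b i e) ({..<k} \<rightarrow>\<^sub>E UNIV) (I \<rightarrow>\<^sub>E UNIV)" by (rule bij)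
    fix s t :: "nat \<Rightarrow> real"
    show "(\<lambda>e\<in>I. \<Sum>i<k. vadd {..<k} s t i * b i e) = vadd I (\<lambda>e\<in>I. \<Sum>i<k. s i * b i e) (\<lambda>e\<in>I. \<Sum>i<k. t i * b i e)"
      by (auto simp: vadd_def fun_eq_iff algebra_simps sum.distrib)
  next
    show "(\<lambda>t. \<lambda>e\<in>I. \<Sum>i<k. t i * b i e) ` ({..<k} \<rightarrow>\<^sub>E \<int>) = I \<rightarrow>\<^sub>E \<int>"
    proof (intro equalityI subsetI)
      fix v assume "v \<in> (\<lambda>t. \<lambda>e\<in>I. \<Sum>i<k. t i * b i e) ` ({..<k} \<rightarrow>\<^sub>E \<int>)"
      then obtain t where t: "t \<in> {..<k} \<rightarrow>\<^sub>E \<int>" "v = (\<lambda>e\<in>I. \<Sum>i<k. t i * b i e)" by auto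
      have "(\<Sum>i<k. t i * b i e) \<in> \<int>" for e
        using PiE_mem[OF t(1)] bI by (intro Ints_sum Ints_mult) auto
      then show "v \<in> I \<rightarrow>\<^sub>E \<int>" using t(2) by auto
    next
      fix v :: "'h set \<Rightarrow> real" assume v: "v \<in> I \<rightarrow>\<^sub>E \<int>"
      obtain m where m: "m \<in> length_kernel R" "\<And>e. e \<in> I \<Longrightarrow> m e = v e" using kernel_ex[of v] by blast
      have "\<forall>e. m e \<in> \<int>" using integral[OF m(1)] m(2) PiE_mem[OF v] by metis
      from int[OF m(1) this] obtain t where t: "\<forall>i<k. t i \<in> \<int>" "m = (\<lambda>e. \<Sum>i<k. t i * b i e)" by auto
      have "v = (\<lambda>e\<in>I. \<Sum>i<k. restrict t {..<k} i * b i e)"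
      proof
        fix e show "v e = (\<lambda>e\<in>I. \<Sum>i<k. restrict t {..<k} i * b i e) e"
        proof (cases "e \<in> I")
          case True
          then have "v e = (\<Sum>i<k. t i * b i e)" using m(2)[OF True] t(2) by simp
          then show ?thesis using True by simp
        next
          case False then show ?thesis using v by (auto simp: PiE_def extensional_def)
        qed
      qed
      moreover have "restrict t {..<k} \<in> {..<k} \<rightarrow>\<^sub>E \<int>" using t(1) by auto
      ultimately show "v \<in> (\<lambda>t. \<lambda>e\<in>I. \<Sum>i<k. t i * b i e) ` ({..<k} \<rightarrow>\<^sub>E \<int>)" by blast
    qed
  qed
qed

text \<open>The assumption \<open>AQ\<close> says that \<open>Q\<close> is the picture of
  \<open>A\<close> in the coordinates \<open>I\<close>, seen from any point of \<open>A\<close>. The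
  choice of the basis changes the coordinates by a unimodular map, and the choice of the origin only
  translates them.\<close>

theorem kernel_volume_eq:
  assumes ne: "A \<noteq> {}" and Q: "Q \<in> sets (lebesgue_on_funs I)"
    and AQ: "\<And>p m. p \<in> A \<Longrightarrow> m \<in> length_kernel R \<Longrightarrow> (\<lambda>e. p e + m e) \<in> A \<longleftrightarrow> (\<lambda>e\<in>I. p e + m e) \<in> Q"
  shows "kernel_volume R A = measure (lebesgue_on_funs I) Q"
proof -
  obtain k b where kb: "(SOME (k, b). kernel_lattice_basis R k b) = (k, b)" by fastforce
  have "\<exists>x. case x of (k, b) \<Rightarrow> kernel_lattice_basis R k b" using ex_kernel_lattice_basis by auto
  from someI_ex[OF this] have b: "kernel_lattice_basis R k b" unfolding kb by simp
  interpret unimodular "{..<k}" I "\<lambda>t. \<lambda>e\<in>I. \<Sum>i<k. t i * b i e" by (rule unimodular_of_basis[OF b])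
  have bK: "\<And>i. i < k \<Longrightarrow> b i \<in> length_kernel R" using b unfolding kernel_lattice_basis_def by auto
  define p where "p = (SOME p. p \<in> A)"
  have p: "p \<in> A" using ne by (simp add: p_def some_in_eq)
  define B where "B = {y \<in> I \<rightarrow>\<^sub>E UNIV. vadd I p y \<in> Q}"
  have "B = (\<lambda>y. vadd I p y) -` Q \<inter> space (lebesgue_on_funs I)" by (auto simp: B_def space_PiM)
  then have B: "B \<in> sets (lebesgue_on_funs I)" using measurable_sets[OF measurable_vadd_const Q] by simp
  have "(\<lambda>e. p e + (\<Sum>i<k. t i * b i e)) \<in> A \<longleftrightarrow> (\<lambda>e\<in>I. \<Sum>i<k. t i * b i e) \<in> B" for t
  proof -
    have "vadd I p (\<lambda>e\<in>I. \<Sum>i<k. t i * b i e) = (\<lambda>e\<in>I. p e + (\<Sum>i<k. t i * b i e))"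
      by (auto simp: vadd_def fun_eq_iff)
    then show ?thesis unfolding B_def using AQ[OF p length_kernel_sum[of k b R t]] bK by simp
  qed
  then have "{t \<in> {..<k} \<rightarrow>\<^sub>E UNIV. (\<lambda>e. p e + (\<Sum>i<k. t i * b i e)) \<in> A} =
     {t \<in> {..<k} \<rightarrow>\<^sub>E UNIV. (\<lambda>e\<in>I. \<Sum>i<k. t i * b i e) \<in> B}" by simp
  then have "kernel_volume R A = measure (lebesgue_on_funs {..<k}) {t \<in> {..<k} \<rightarrow>\<^sub>E UNIV. (\<lambda>e\<in>I. \<Sum>i<k. t i * b i e) \<in> B}"
    unfolding kernel_volume_def kb Let_def by (simp add: p_def)
  also have "\<dots> = measure (lebesgue_on_funs I) B"
    unfolding measure_def using emeasure_preimage[OF B] by simp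
  also have "\<dots> = measure (lebesgue_on_funs I) Q"
    unfolding measure_def B_def using emeasure_vadd[OF finI Q] by simp
  finally show ?thesis .
qed

end

section \<open>Ribbon graphs and gluings\<close>

definition labelled :: "'a set \<Rightarrow> ('a \<Rightarrow> 'a) \<Rightarrow> ('a \<Rightarrow> nat) \<Rightarrow> nat list \<Rightarrow> bool" where
  "labelled X \<sigma> c ks \<longleftrightarrow> finite X \<and> \<sigma> permutes X \<and>
     (\<forall>x\<in>X. \<forall>y\<in>X. c x = c y \<longleftrightarrow> y \<in> orbit \<sigma> x) \<and> c ` X = {..<length ks} \<and>
     (\<forall>i<length ks. card {x \<in> X. c x = i} = ks ! i)"

definition labelled_bijections ::
  "'a set \<Rightarrow> ('a \<Rightarrow> 'a) \<Rightarrow> ('a \<Rightarrow> nat) \<Rightarrow> 'b set \<Rightarrow> ('b \<Rightarrow> 'b) \<Rightarrow> ('b \<Rightarrow> nat) \<Rightarrow> ('a \<Rightarrow> 'b) set" where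
  "labelled_bijections X \<sigma> c Y \<rho> d = {h \<in> X \<rightarrow>\<^sub>E Y. bij_betw h X Y \<and>
     (\<forall>x\<in>X. h (\<sigma> x) = \<rho> (h x) \<and> d (h x) = c x)}"

lemma labelled_orbit:
  assumes "labelled X \<sigma> c ks" "x \<in> X"
  shows "orbit \<sigma> x = {y \<in> X. c y = c x}"
proof -
  have "orbit \<sigma> x \<subseteq> X" using assms orbit_in[of X \<sigma> x] by (simp add: labelled_def)
  moreover have "y \<in> orbit \<sigma> x \<longleftrightarrow> c x = c y" if "y \<in> X" for y
    using assms that by (simp add: labelled_def)
  ultimately show ?thesis by (auto simp: eq_commute[of "c x"])
qed

lemma labelled_orbit_eq_iff:
  assumes "labelled X \<sigma> c ks" "x \<in> X" "y \<in> X"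
  shows "orbit \<sigma> x = orbit \<sigma> y \<longleftrightarrow> c x = c y"
  using labelled_orbit[OF assms(1,2)] labelled_orbit[OF assms(1,3)] assms by auto

text \<open>Such a bijection is determined by the image of one point \<open>a i\<close> in each
  cycle, and that image may be any of the \<open>ks ! i\<close> points of the cycle with the same
  number.\<close>

lemma card_labelled_bijections:
  assumes X: "labelled X \<sigma> c ks" and Y: "labelled Y \<rho> d ks"
  shows "card (labelled_bijections X \<sigma> c Y \<rho> d) = prod_list ks"
proof -
  have fX: "finite X" "\<sigma> permutes X" and fY: "finite Y" "\<rho> permutes Y" using X Y by (auto simp: labelled_def)
  have cX: "c ` X = {..<length ks}" and dY: "d ` Y = {..<length ks}" using X Y by (auto simp: labelled_def)
  have kX: "card {x \<in> X. c x = i} = ks ! i" "card {y \<in> Y. d y = i} = ks ! i" if "i < length ks" for i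
    using X Y that by (auto simp: labelled_def)
  have "\<forall>i\<in>{..<length ks}. \<exists>x. x \<in> X \<and> c x = i" unfolding cX[symmetric] by auto
  then obtain a where a: "\<And>i. i < length ks \<Longrightarrow> a i \<in> X \<and> c (a i) = i" by (metis lessThan_iff)
  let ?B = "labelled_bijections X \<sigma> c Y \<rho> d"
  let ?P = "\<Pi>\<^sub>E i\<in>{..<length ks}. {y \<in> Y. d y = i}"
  let ?\<Phi> = "\<lambda>h. \<lambda>i\<in>{..<length ks}. h (a i)"
  have "bij_betw ?\<Phi> ?B ?P"
    unfolding bij_betw_def
  proof
    show "inj_on ?\<Phi> ?B"
    proof (rule inj_onI)
      fix h h' assume h: "h \<in> ?B" "h' \<in> ?B" and eq: "?\<Phi> h = ?\<Phi> h'"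
      have "h x = h' x" if x: "x \<in> X" for x
      proof -
        have i: "c x < length ks" using cX x by auto
        then have "h (a (c x)) = h' (a (c x))" using fun_cong[OF eq, of "c x"] by simp
        moreover have "x \<in> orbit \<sigma> (a (c x))" using labelled_orbit[OF X, of "a (c x)"] a[OF i] x by simp
        moreover have "h y = h' y \<and> y \<in> X" if "y \<in> orbit \<sigma> z" "h z = h' z" "z \<in> X" for y z
          using that
        proof induction
          case base then show ?case using h permutes_in_image[OF fX(2)] by (auto simp: labelled_bijections_def)
        next
          case (step y) then show ?case using h permutes_in_image[OF fX(2)] by (auto simp: labelled_bijections_def)
        qed
        ultimately show ?thesis using a[OF i] by blast
      qed
      moreover have "h x = h' x" if "x \<notin> X" for x
        using h that by (auto simp: labelled_bijections_def PiE_def extensional_def)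
      ultimately show "h = h'" by blast
    qed
    show "?\<Phi> ` ?B = ?P"
    proof (intro equalityI subsetI)
      fix v assume "v \<in> ?\<Phi> ` ?B"
      then obtain h where h: "h \<in> ?B" "v = ?\<Phi> h" by blast
      have "h (a i) \<in> Y \<and> d (h (a i)) = i" if "i < length ks" for i
        using h(1) a[OF that] by (auto simp: labelled_bijections_def)
      then show "v \<in> ?P" unfolding h(2) by auto
    next
      fix v assume v: "v \<in> ?P"
      have vi: "v i \<in> Y" "d (v i) = i" if "i < length ks" for i using PiE_mem[OF v, of i] that by auto
      define A where "A = a ` {..<length ks}"
      have AX: "A \<subseteq> X" using a by (auto simp: A_def)
      have cA: "x = a (c x)" "c x < length ks" if "x \<in> A" for x using that a by (auto simp: A_def)
      have A: "bij_betw (orbit \<sigma>) A (orbit \<sigma> ` X)"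
        unfolding bij_betw_def
      proof
        show "inj_on (orbit \<sigma>) A"
          by (rule inj_onI) (metis AX cA(1) labelled_orbit_eq_iff[OF X] subsetD)
        show "orbit \<sigma> ` A = orbit \<sigma> ` X"
        proof (intro equalityI subsetI)
          fix B assume "B \<in> orbit \<sigma> ` X"
          then obtain x where x: "x \<in> X" "B = orbit \<sigma> x" by auto
          then have i: "c x < length ks" using cX by auto
          then have "B = orbit \<sigma> (a (c x))" using labelled_orbit_eq_iff[OF X, of x "a (c x)"] a[OF i] x by simp
          then show "B \<in> orbit \<sigma> ` A" using i by (auto simp: A_def)
        qed (use AX in auto)
      qed
      have vY: "(\<lambda>x. v (c x)) ` A \<subseteq> Y" using vi cA by auto
      have B: "bij_betw (\<lambda>x. orbit \<rho> (v (c x))) A (orbit \<rho> ` Y)"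
        unfolding bij_betw_def
      proof
        show "inj_on (\<lambda>x. orbit \<rho> (v (c x))) A"
        proof (rule inj_onI)
          fix x y assume xy: "x \<in> A" "y \<in> A" "orbit \<rho> (v (c x)) = orbit \<rho> (v (c y))"
          then have "d (v (c x)) = d (v (c y))"
            using labelled_orbit_eq_iff[OF Y, of "v (c x)" "v (c y)"] vi cA by auto
          then have "c x = c y" using vi cA xy by auto
          then show "x = y" using cA xy by metis
        qed
        show "(\<lambda>x. orbit \<rho> (v (c x))) ` A = orbit \<rho> ` Y"
        proof (intro equalityI subsetI)
          fix D assume "D \<in> orbit \<rho> ` Y"
          then obtain y where y: "y \<in> Y" "D = orbit \<rho> y" by auto
          then have i: "d y < length ks" using dY by auto
          then have "D = orbit \<rho> (v (c (a (d y))))"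
            using labelled_orbit_eq_iff[OF Y, of y "v (d y)"] vi[OF i] y a[OF i] by simp
          then show "D \<in> (\<lambda>x. orbit \<rho> (v (c x))) ` A" using i by (auto simp: A_def)
        qed (use vY in auto)
      qed
      have sz: "card (orbit \<rho> (v (c x))) = card (orbit \<sigma> x)" if "x \<in> A" for x
        using labelled_orbit[OF X, of x] labelled_orbit[OF Y, of "v (c x)"] kX[OF cA(2)[OF that]] vi cA(2)[OF that] AX that
        by auto
      from equivariant_extension[OF fX fY AX A vY B sz] obtain h where
        h: "bij_betw h X Y" "\<And>x. x \<in> X \<Longrightarrow> h (\<sigma> x) = \<rho> (h x)" "\<And>x. x \<in> A \<Longrightarrow> h x = v (c x)" by metis
      have ax: "d (h x) = c x" if x: "x \<in> X" for x
      proof -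
        have i: "c x < length ks" using cX x by auto
        then have xo: "x \<in> orbit \<sigma> (a (c x))" using labelled_orbit[OF X, of "a (c x)"] a[OF i] x by simp
        have "orbit \<rho> (h (a (c x))) = h ` orbit \<sigma> (a (c x))"
          by (rule orbit_image[where X = X]) (use a[OF i] h permutes_in_image[OF fX(2)] in auto)
        then have "h x \<in> orbit \<rho> (h (a (c x)))" using xo by auto
        moreover have "h (a (c x)) = v (c x)" using h(3)[of "a (c x)"] i a[OF i] by (auto simp: A_def)
        ultimately have "h x \<in> orbit \<rho> (v (c x))" by simp
        then show ?thesis using labelled_orbit[OF Y, of "v (c x)"] vi[OF i] by auto
      qed
      have "restrict h X \<in> ?B"
        using h(1,2) ax permutes_in_image[OF fX(2)] bij_betw_apply[OF h(1)]
        by (auto simp: labelled_bijections_def cong: bij_betw_cong)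
      moreover have "?\<Phi> (restrict h X) = v"
      proof
        fix i show "?\<Phi> (restrict h X) i = v i"
        proof (cases "i < length ks")
          case True
          then show ?thesis using a[OF True] h(3)[of "a i"] by (simp add: A_def)
        next
          case False then show ?thesis using v by (auto simp: PiE_def extensional_def)
        qed
      qed
      ultimately show "v \<in> ?\<Phi> ` ?B" by (metis image_eqI)
    qed
  qed
  then have "card ?B = card ?P" by (rule bij_betw_same_card)
  also have "\<dots> = (\<Prod>i<length ks. ks ! i)" by (simp add: card_PiE kX(2))
  also have "\<dots> = prod_list ks" by (simp add: prod.list_conv_set_nth atLeast0LessThan)
  finally show ?thesis .
qed

lemma image_mset_nth: "image_mset ((!) ks) (mset_set {..<length ks}) = mset ks"
proof -
  have "image_mset ((!) ks) (mset [0..<length ks]) = mset (map ((!) ks) [0..<length ks])" by simp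
  then show ?thesis by (simp only: mset_upt map_nth atLeast0LessThan)
qed

lemma ex_labelled:
  assumes "0 \<notin> set ks"
  shows "\<exists>(X :: nat set) \<sigma> c. labelled X \<sigma> c ks"
proof -
  obtain X :: "nat set" and \<sigma> where X: "finite X" "\<sigma> permutes X" "orbit_sizes X \<sigma> = mset ks"
    using ex_orbit_sizes[of "mset ks"] assms by auto
  have "image_mset card (mset_set (orbit \<sigma> ` X)) = image_mset ((!) ks) (mset_set {..<length ks})"
    using X(3) by (simp add: orbit_sizes_def image_mset_nth)
  then obtain f where f: "bij_betw f (orbit \<sigma> ` X) {..<length ks}" "\<And>B. B \<in> orbit \<sigma> ` X \<Longrightarrow> ks ! f B = card B"
    using bij_betw_of_image_mset_eq[of "orbit \<sigma> ` X" "{..<length ks}" card "(!) ks"] X(1) by blast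
  have iff: "f (orbit \<sigma> x) = f (orbit \<sigma> y) \<longleftrightarrow> y \<in> orbit \<sigma> x" if "x \<in> X" "y \<in> X" for x y
  proof -
    have "f (orbit \<sigma> x) = f (orbit \<sigma> y) \<longleftrightarrow> orbit \<sigma> x = orbit \<sigma> y"
      using bij_betw_imp_inj_on[OF f(1)] that by (auto simp: inj_on_def)
    also have "\<dots> \<longleftrightarrow> y \<in> orbit \<sigma> x" using orbit_eq_orbit[OF X(1,2)] orbit_refl[OF X(1,2)] by metis
    finally show ?thesis .
  qed
  have im: "(\<lambda>x. f (orbit \<sigma> x)) ` X = {..<length ks}" using f(1) by (auto simp: bij_betw_def image_image)
  have "card {x \<in> X. f (orbit \<sigma> x) = i} = ks ! i" if "i < length ks" for i
  proof -
    have "i \<in> (\<lambda>x. f (orbit \<sigma> x)) ` X" using im that by simp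
    then obtain x where x: "x \<in> X" "i = f (orbit \<sigma> x)" by auto
    have "f (orbit \<sigma> y) = i \<longleftrightarrow> y \<in> orbit \<sigma> x" if "y \<in> X" for y using iff[OF x(1) that] x(2) by auto
    then have "{y \<in> X. f (orbit \<sigma> y) = i} = orbit \<sigma> x" using orbit_in[OF X(1,2) x(1)] by blast
    then show ?thesis using f(2) x by auto
  qed
  then have "labelled X \<sigma> (\<lambda>x. f (orbit \<sigma> x)) ks" using X iff im by (simp add: labelled_def)
  then show ?thesis by blast
qed

lemma labelled_orbit_sizes:
  assumes X: "labelled X \<sigma> c ks" shows "orbit_sizes X \<sigma> = mset ks"
proof -
  have fX: "finite X" "\<sigma> permutes X" using X by (auto simp: labelled_def)
  have cX: "c ` X = {..<length ks}" using X by (auto simp: labelled_def)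
  have inj: "inj_on (\<lambda>i. {x \<in> X. c x = i}) {..<length ks}" unfolding cX[symmetric] by (rule inj_onI) blast
  have "(\<lambda>i. {x \<in> X. c x = i}) ` {..<length ks} = orbit \<sigma> ` X"
    unfolding cX[symmetric] image_image by (intro image_cong) (simp_all add: labelled_orbit[OF X])
  then have "mset_set (orbit \<sigma> ` X) = image_mset (\<lambda>i. {x \<in> X. c x = i}) (mset_set {..<length ks})"
    using image_mset_mset_set[OF inj] by simp
  then have "orbit_sizes X \<sigma> = image_mset (\<lambda>i. card {x \<in> X. c x = i}) (mset_set {..<length ks})"
    by (simp add: orbit_sizes_def image_mset.compositionality o_def)
  also have "\<dots> = image_mset ((!) ks) (mset_set {..<length ks})"
    using X by (intro image_mset_cong) (simp add: labelled_def)
  also have "\<dots> = mset ks"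
    by (rule image_mset_nth)
  finally show ?thesis .
qed

lemma restrict_permutes:
  assumes "finite H" "f permutes H" "P \<subseteq> H" "\<And>x. x \<in> P \<Longrightarrow> f x \<in> P"
  shows "(\<lambda>x. if x \<in> P then f x else x) permutes P"
proof (rule bij_imp_permutes)
  have "inj_on (\<lambda>x. if x \<in> P then f x else x) P"
    using permutes_inj[OF assms(2)] by (auto simp: inj_on_def inj_def)
  moreover have "(\<lambda>x. if x \<in> P then f x else x) ` P \<subseteq> P" using assms(4) by auto
  ultimately show "bij_betw (\<lambda>x. if x \<in> P then f x else x) P P"
    using endo_inj_surj[OF finite_subset[OF assms(3,1)]] unfolding bij_betw_def by blast
qed simp

lemma orbit_restrict:
  assumes "x \<in> P" "\<And>x. x \<in> P \<Longrightarrow> f x \<in> P"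
  shows "orbit (\<lambda>x. if x \<in> P then f x else x) x = orbit f x"
  using orbit_image[of x P f id "\<lambda>x. if x \<in> P then f x else x"] assms by simp

section \<open>The positive half-edges of a graph with one negative boundary\<close>

definition pos :: "('h, 'z) directed_ribbon_graph_scheme \<Rightarrow> 'h set" where
  "pos R = {x \<in> half_edges R. direction R x = 1}"

definition neg :: "('h, 'z) directed_ribbon_graph_scheme \<Rightarrow> 'h set" where
  "neg R = {x \<in> half_edges R. direction R x = -1}"

definition bperm :: "('h, 'z) directed_ribbon_graph_scheme \<Rightarrow> 'h \<Rightarrow> 'h" where
  "bperm R x = (if x \<in> pos R then s2 R x else x)"

text \<open>This is \<open>(s2 \<circ> s1) ^^ 2\<close>, the inverse square of \<open>s0\<close>.
  Directions alternate around a vertex, so at degree 4 it exchanges the two positive half-edges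
  there.\<close>

definition pairing :: "('h, 'z) directed_ribbon_graph_scheme \<Rightarrow> 'h \<Rightarrow> 'h" where
  "pairing R x = (if x \<in> pos R then s2 R (s1 R (s2 R (s1 R x))) else x)"

definition blabel :: "('h, 'z) directed_ribbon_graph_scheme \<Rightarrow> 'h \<Rightarrow> nat" where
  "blabel R x = label R (orbit (s2 R) x)"

definition sizes :: "nat \<Rightarrow> ('h, 'z) directed_ribbon_graph_scheme \<Rightarrow> nat list" where
  "sizes n R = map (\<lambda>i. card {x \<in> pos R. blabel R x = i}) [0..<n]"

locale one_negative =
  fixes R :: "('h, 'z) directed_ribbon_graph_scheme" and g n :: nat
  assumes of_type: "of_type g n 1 R" and four: "four_valent R"
begin

abbreviation "H \<equiv> half_edges R"
abbreviation "P \<equiv> pos R"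
abbreviation "M \<equiv> neg R"

lemma rg: "finite H" "s0 R permutes H" "s1 R permutes H" "s2 R permutes H"
  "\<And>x. x \<in> H \<Longrightarrow> s1 R (s1 R x) = x" "\<And>x. x \<in> H \<Longrightarrow> s1 R x \<noteq> x" "s2 R \<circ> s1 R \<circ> s0 R = id"
  using of_type by (auto simp: of_type_def ribbon_graph_def)

lemma dir: "x \<in> H \<Longrightarrow> direction R x = 1 \<or> direction R x = -1"
  "x \<in> H \<Longrightarrow> direction R (s2 R x) = direction R x" "x \<in> H \<Longrightarrow> direction R (s1 R x) = - direction R x"
  using of_type by (auto simp: of_type_def is_direction_def)

lemma in_H: "x \<in> H \<Longrightarrow> s0 R x \<in> H" "x \<in> H \<Longrightarrow> s1 R x \<in> H" "x \<in> H \<Longrightarrow> s2 R x \<in> H"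
  using rg by (simp_all add: permutes_in_image)

lemma H_split: "H = P \<union> M" "P \<inter> M = {}" "P \<subseteq> H" "M \<subseteq> H"
  using dir(1) by (auto simp: pos_def neg_def)

lemma s1_swap: "x \<in> P \<Longrightarrow> s1 R x \<in> M" "x \<in> M \<Longrightarrow> s1 R x \<in> P"
  using dir(3) in_H by (auto simp: pos_def neg_def)

lemma s2_keep: "x \<in> P \<Longrightarrow> s2 R x \<in> P" "x \<in> M \<Longrightarrow> s2 R x \<in> M"
  using dir(2) in_H by (auto simp: pos_def neg_def)

lemma finP: "finite P" and finM: "finite M" using rg(1) H_split finite_subset by auto

lemma bperm_permutes: "bperm R permutes P"
  using restrict_permutes[OF rg(1,4) H_split(3) s2_keep(1)] by (simp add: bperm_def[abs_def])

lemma orbit_bperm: "x \<in> P \<Longrightarrow> orbit (bperm R) x = orbit (s2 R) x"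
  using orbit_restrict[of x P "s2 R"] s2_keep(1) by (simp add: bperm_def[abs_def])

lemma orbit_s2_P: "x \<in> P \<Longrightarrow> orbit (s2 R) x \<subseteq> P"
  using orbit_in[OF finP bperm_permutes] orbit_bperm by blast

lemma orbit_s2_M: "x \<in> M \<Longrightarrow> orbit (s2 R) x \<subseteq> M"
  by (rule orbit_least) (use s2_keep in auto)

lemma pos_boundaries_eq: "pos_boundaries R = orbit (s2 R) ` P"
proof (intro equalityI subsetI)
  fix B assume B: "B \<in> pos_boundaries R"
  then obtain x where x: "x \<in> H" "B = orbit (s2 R) x" by (auto simp: pos_boundaries_def boundaries_def)
  have "x \<in> B" using x orbit_refl[OF rg(1,4)] by simp
  then have "direction R x = 1" using B by (auto simp: pos_boundaries_def)
  then show "B \<in> orbit (s2 R) ` P" using x by (auto simp: pos_def)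
next
  fix B assume "B \<in> orbit (s2 R) ` P"
  then obtain x where x: "x \<in> P" "B = orbit (s2 R) x" by auto
  then have "B \<subseteq> P" using orbit_s2_P by simp
  then show "B \<in> pos_boundaries R" using x by (auto simp: pos_boundaries_def boundaries_def pos_def)
qed

lemma neg_boundaries_eq: "neg_boundaries R = orbit (s2 R) ` M"
proof (intro equalityI subsetI)
  fix B assume B: "B \<in> neg_boundaries R"
  then obtain x where x: "x \<in> H" "B = orbit (s2 R) x" by (auto simp: neg_boundaries_def boundaries_def)
  have "x \<in> B" using x orbit_refl[OF rg(1,4)] by simp
  then have "direction R x = -1" using B by (auto simp: neg_boundaries_def)
  then show "B \<in> orbit (s2 R) ` M" using x by (auto simp: neg_def)
next
  fix B assume "B \<in> orbit (s2 R) ` M"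
  then obtain x where x: "x \<in> M" "B = orbit (s2 R) x" by auto
  then have "B \<subseteq> M" using orbit_s2_M by simp
  then show "B \<in> neg_boundaries R" using x by (auto simp: neg_boundaries_def boundaries_def neg_def)
qed

lemma label_bij: "bij_betw (label R) (orbit (s2 R) ` P) {..<n}" "bij_betw (label R) (orbit (s2 R) ` M) {..<1}"
  using of_type by (auto simp: of_type_def pos_boundaries_eq neg_boundaries_eq)

lemma label_M: "x \<in> M \<Longrightarrow> label R (orbit (s2 R) x) = 0"
  using bij_betw_apply[OF label_bij(2)] by auto

lemma orbit_M: assumes "x \<in> M" shows "orbit (s2 R) x = M"
proof
  show "orbit (s2 R) x \<subseteq> M" by (rule orbit_s2_M[OF assms])
  show "M \<subseteq> orbit (s2 R) x"
  proof
    fix y assume y: "y \<in> M"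
    have "label R (orbit (s2 R) x) = label R (orbit (s2 R) y)" by (simp only: label_M[OF assms] label_M[OF y])
    then have "orbit (s2 R) x = orbit (s2 R) y"
      using inj_onD[OF bij_betw_imp_inj_on[OF label_bij(2)]] assms y by blast
    then show "y \<in> orbit (s2 R) x" using orbit_refl[OF rg(1,4)] by simp
  qed
qed

lemma s2_s1_inv: "s2 R \<circ> s1 R = inv (s0 R)"
proof -
  have "s2 R \<circ> s1 R = (s2 R \<circ> s1 R) \<circ> (s0 R \<circ> inv (s0 R))"
    by (simp only: permutes_inv_o(1)[OF rg(2)] comp_id)
  also have "\<dots> = (s2 R \<circ> s1 R \<circ> s0 R) \<circ> inv (s0 R)" by (simp only: o_assoc)
  finally have "s2 R \<circ> s1 R = (s2 R \<circ> s1 R \<circ> s0 R) \<circ> inv (s0 R)" .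
  then show ?thesis by (simp only: rg(7) id_comp)
qed

lemma s0_s2_s1: "s0 R (s2 R (s1 R x)) = x"
  using fun_cong[OF s2_s1_inv, of x] rg(2) by (simp add: permutes_inverses)

lemma pairing_eq: "x \<in> P \<Longrightarrow> pairing R x = (inv (s0 R) ^^ 2) x"
  unfolding s2_s1_inv[symmetric] by (simp add: pairing_def numeral_2_eq_2)

text \<open>On an orbit of length 4 the fourth power is the identity and the second power has no
  fixed point.\<close>

lemma pairing_involution: assumes "x \<in> P" shows "pairing R (pairing R x) = x" "pairing R x \<noteq> x" "pairing R x \<in> P"
proof -
  have p: "inv (s0 R) permutes H" using rg(2) by (rule permutes_inv)
  have xH: "x \<in> H" using assms H_split by auto
  show PP: "pairing R x \<in> P" using assms s1_swap s2_keep by (simp add: pairing_def)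
  have "card (orbit (s0 R) x) = 4" using four xH by (auto simp: four_valent_def vertices_def)
  then have c: "card (orbit (inv (s0 R)) x) = 4" by (simp add: orbit_inv_perm[OF rg(1,2)])
  have "(inv (s0 R) ^^ 0) x = (inv (s0 R) ^^ 4) x"
    using funpow_eq_iff_card_orbit_dvd(1)[OF rg(1) p, of 0 4 x] c by simp
  moreover have "(inv (s0 R) ^^ 0) x \<noteq> (inv (s0 R) ^^ 2) x"
    using funpow_eq_iff_card_orbit_dvd(1)[OF rg(1) p, of 0 2 x] c by simp
  moreover have "(inv (s0 R) ^^ 4) x = (inv (s0 R) ^^ 2) ((inv (s0 R) ^^ 2) x)"
    using funpow_add[of 2 2 "inv (s0 R)"] by simp
  ultimately show "pairing R (pairing R x) = x" "pairing R x \<noteq> x"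
    using pairing_eq[OF assms] pairing_eq[OF PP] by simp_all
qed

lemma pairing_permutes: "pairing R permutes P"
proof -
  have "s2 R \<circ> s1 R \<circ> (s2 R \<circ> s1 R) permutes H" by (intro permutes_compose rg)
  moreover have "(s2 R \<circ> s1 R \<circ> (s2 R \<circ> s1 R)) x \<in> P" if "x \<in> P" for x
    using that s1_swap s2_keep by simp
  ultimately have "(\<lambda>x. if x \<in> P then (s2 R \<circ> s1 R \<circ> (s2 R \<circ> s1 R)) x else x) permutes P"
    using restrict_permutes[OF rg(1) _ H_split(3)] by blast
  then show ?thesis by (simp only: comp_def pairing_def[abs_def])
qed

lemma bperm_inv_pairing: assumes "x \<in> P" shows "inv (bperm R) (pairing R x) = s1 R (s2 R (s1 R x))"
proof -
  have "s1 R (s2 R (s1 R x)) \<in> P" using assms s1_swap s2_keep by simp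
  then have "bperm R (s1 R (s2 R (s1 R x))) = pairing R x" using assms by (simp add: bperm_def pairing_def)
  then show ?thesis using bperm_permutes by (metis permutes_inverses(2))
qed

lemma pairing_gluing: "pairing R \<in> gluings P (bperm R)"
proof -
  have "y \<in> orbit (inv (bperm R) \<circ> pairing R) x" if x: "x \<in> P" and y: "y \<in> P" for x y
  proof -
    \<comment> \<open>\<open>s1\<close> carries the walk of \<open>s2\<close> along the negative
      boundary to \<open>inv (bperm R) \<circ> pairing R\<close> on the positive half-edges, and the
      former has the single orbit \<open>M\<close>.\<close>
    have "orbit (inv (bperm R) \<circ> pairing R) (s1 R (s1 R x)) = s1 R ` orbit (s2 R) (s1 R x)"
    proof (rule orbit_image[where X = M])
      show "s1 R x \<in> M" using s1_swap x by simp
      fix z assume z: "z \<in> M"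
      then have "s1 R z \<in> P" "s1 R (s1 R z) = z" using s1_swap rg(5) H_split by auto
      then show "s2 R z \<in> M \<and> s1 R (s2 R z) = (inv (bperm R) \<circ> pairing R) (s1 R z)"
        using bperm_inv_pairing s2_keep z by simp
    qed
    moreover have "s1 R x \<in> M" "s1 R y \<in> M" using s1_swap x y by auto
    moreover have "s1 R (s1 R x) = x" "s1 R (s1 R y) = y" using rg(5) x y H_split by auto
    ultimately show ?thesis using orbit_M by (metis image_eqI)
  qed
  then show ?thesis using pairing_permutes pairing_involution by (auto simp: gluings_def)
qed

lemma labelled_pos: "labelled P (bperm R) (blabel R) (sizes n R)"
proof -
  have "blabel R x = blabel R y \<longleftrightarrow> y \<in> orbit (bperm R) x" if "x \<in> P" "y \<in> P" for x y
  proof -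
    have "blabel R x = blabel R y \<longleftrightarrow> orbit (s2 R) x = orbit (s2 R) y"
      using bij_betw_imp_inj_on[OF label_bij(1)] that by (auto simp: inj_on_def blabel_def)
    also have "\<dots> \<longleftrightarrow> y \<in> orbit (s2 R) x"
      using orbit_eq_orbit[OF rg(1,4)] orbit_refl[OF rg(1,4)] by metis
    finally show ?thesis using orbit_bperm that by simp
  qed
  moreover have "blabel R ` P = {..<n}"
    using label_bij(1) by (simp add: bij_betw_def image_image blabel_def)
  ultimately show ?thesis using finP bperm_permutes by (auto simp: labelled_def sizes_def)
qed

lemma orbit_s1: "x \<in> H \<Longrightarrow> orbit (s1 R) x = {x, s1 R x}"
proof
  assume x: "x \<in> H"
  show "orbit (s1 R) x \<subseteq> {x, s1 R x}" by (rule orbit_least) (use rg(5)[OF x] in auto)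
  show "{x, s1 R x} \<subseteq> orbit (s1 R) x" using orbit_refl[OF rg(1,3), of x] orbit.base[of "s1 R" x] by simp
qed

lemma edges_bij: "bij_betw (orbit (s1 R)) P (edges R)"
  unfolding bij_betw_def
proof
  show "inj_on (orbit (s1 R)) P"
  proof (rule inj_onI)
    fix x y assume xy: "x \<in> P" "y \<in> P" "orbit (s1 R) x = orbit (s1 R) y"
    then have "x \<in> {y, s1 R y}" using orbit_s1[of x] orbit_s1[of y] H_split by auto
    then show "x = y" using s1_swap xy H_split(2) by auto
  qed
  show "orbit (s1 R) ` P = edges R"
  proof
    show "orbit (s1 R) ` P \<subseteq> edges R" using H_split by (auto simp: edges_def)
    show "edges R \<subseteq> orbit (s1 R) ` P"
    proof
      fix e assume "e \<in> edges R"
      then obtain x where x: "x \<in> H" "e = orbit (s1 R) x" by (auto simp: edges_def)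
      have "e = orbit (s1 R) (s1 R x)" using orbit_s1[OF x(1)] orbit_s1[OF in_H(2)[OF x(1)]] rg(5)[OF x(1)] x by auto
      then show "e \<in> orbit (s1 R) ` P" using x s1_swap H_split by (cases "x \<in> P") auto
    qed
  qed
qed

lemma card_H: "card H = 2 * card P"
proof -
  have "bij_betw (s1 R) P M"
    by (rule bij_betw_byWitness[where f' = "s1 R"]) (use s1_swap rg(5) H_split in auto)
  then have "card M = card P" by (simp add: bij_betw_same_card)
  then show ?thesis using card_Un_disjoint[OF finP finM H_split(2)] H_split(1) by simp
qed

text \<open>Euler characteristic: there are \<open>card P\<close> edges, half as many vertices, and
  \<open>n + 1\<close> boundary components.\<close>

lemma card_pos: "int (card P) = 2 * (2 * int g - 1 + int n)"
proof -
  have "card H = sum_mset (orbit_sizes H (s0 R))" using sum_orbit_sizes[OF rg(1,2)] by simp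
  also have "\<dots> = (\<Sum>v\<in>vertices R. card v)" by (simp add: orbit_sizes_def vertices_def sum_unfold_sum_mset)
  also have "\<dots> = 4 * card (vertices R)" using four by (simp add: four_valent_def)
  finally have V: "2 * card P = 4 * card (vertices R)" using card_H by simp
  have E: "card (edges R) = card P" using bij_betw_same_card[OF edges_bij] by simp
  have "boundaries R = orbit (s2 R) ` P \<union> orbit (s2 R) ` M"
    using H_split(1) by (auto simp: boundaries_def)
  moreover have "orbit (s2 R) ` P \<inter> orbit (s2 R) ` M = {}"
  proof -
    have "orbit (s2 R) x \<noteq> orbit (s2 R) y" if "x \<in> P" "y \<in> M" for x y
    proof
      assume "orbit (s2 R) x = orbit (s2 R) y"
      moreover have "x \<in> orbit (s2 R) x" by (rule orbit_refl[OF rg(1,4)])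
      ultimately show False using orbit_s2_M[OF that(2)] that(1) H_split(2) by auto
    qed
    then show ?thesis by fast
  qed
  ultimately have "card (boundaries R) = n + 1"
    using bij_betw_same_card[OF label_bij(1)] bij_betw_same_card[OF label_bij(2)] finP finM
    by (simp add: card_Un_disjoint)
  then show ?thesis using of_type V E by (simp add: of_type_def has_genus_def)
qed

lemma sum_sizes: "sum_list (sizes n R) = card P"
  using labelled_orbit_sizes[OF labelled_pos] sum_orbit_sizes[OF finP bperm_permutes]
  by (metis sum_mset_sum_list)

lemma length_sizes: "length (sizes n R) = n" by (simp add: sizes_def)

lemma sizes_pos: "0 \<notin> set (sizes n R)"
  using labelled_orbit_sizes[OF labelled_pos] orbit_sizes_pos[OF finP bperm_permutes] by (metis set_mset_mset)

end

section \<open>Isomorphisms read off from the positive half-edges\<close>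

lemma is_iso_orbit:
  assumes "is_iso \<phi> R S" "ribbon_graph R" "x \<in> half_edges R"
  shows "orbit (s2 S) (\<phi> x) = \<phi> ` orbit (s2 R) x"
  by (rule orbit_image[OF assms(3)])
     (use assms in \<open>auto simp: is_iso_def ribbon_graph_def permutes_in_image\<close>)

lemma is_iso_refl: "is_iso id R R"
  by (simp add: is_iso_def)

lemma is_iso_trans:
  assumes \<phi>: "is_iso \<phi> R S" and \<psi>: "is_iso \<psi> S U" and R: "ribbon_graph R"
  shows "is_iso (\<psi> \<circ> \<phi>) R U"
proof -
  have b: "bij_betw (\<psi> \<circ> \<phi>) (half_edges R) (half_edges U)"
    using \<phi> \<psi> by (auto simp: is_iso_def intro: bij_betw_trans)
  have in_S: "\<phi> x \<in> half_edges S" if "x \<in> half_edges R" for x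
    using \<phi> that bij_betw_apply by (fastforce simp: is_iso_def)
  have "label U ((\<psi> \<circ> \<phi>) ` B) = label R B" if "B \<in> boundaries R" for B
  proof -
    obtain x where x: "x \<in> half_edges R" "B = orbit (s2 R) x" using \<open>B \<in> boundaries R\<close> by (auto simp: boundaries_def)
    then have "\<phi> ` B = orbit (s2 S) (\<phi> x)" using is_iso_orbit[OF \<phi> R x(1)] by simp
    then have "\<phi> ` B \<in> boundaries S" using in_S[OF x(1)] by (simp add: boundaries_def)
    then show ?thesis unfolding image_comp[symmetric] using \<phi> \<psi> that by (simp add: is_iso_def)
  qed
  then show ?thesis using \<phi> \<psi> b in_S by (simp add: is_iso_def)
qed

lemma is_iso_sym:
  assumes \<phi>: "is_iso \<phi> R S" and R: "ribbon_graph R"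
  shows "is_iso (inv_into (half_edges R) \<phi>) S R"
proof -
  let ?\<psi> = "inv_into (half_edges R) \<phi>"
  have b: "bij_betw \<phi> (half_edges R) (half_edges S)" using \<phi> by (simp add: is_iso_def)
  have b': "bij_betw ?\<psi> (half_edges S) (half_edges R)" using b by (rule bij_betw_inv_into)
  have l: "?\<psi> (\<phi> x) = x" if "x \<in> half_edges R" for x using b that by (simp add: bij_betw_inv_into_left)
  have cl: "s0 R x \<in> half_edges R" "s1 R x \<in> half_edges R" "s2 R x \<in> half_edges R" if "x \<in> half_edges R" for x
    using R that by (auto simp: ribbon_graph_def permutes_in_image)
  have ex: "\<exists>x\<in>half_edges R. y = \<phi> x" if "y \<in> half_edges S" for y
    using b that by (auto simp: bij_betw_def)
  have "?\<psi> (s0 S y) = s0 R (?\<psi> y) \<and> ?\<psi> (s1 S y) = s1 R (?\<psi> y) \<and> ?\<psi> (s2 S y) = s2 R (?\<psi> y)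
      \<and> direction R (?\<psi> y) = direction S y" if y: "y \<in> half_edges S" for y
  proof -
    obtain x where x: "x \<in> half_edges R" "y = \<phi> x" using ex[OF y] by auto
    have "s0 S y = \<phi> (s0 R x)" "s1 S y = \<phi> (s1 R x)" "s2 S y = \<phi> (s2 R x)" "direction S y = direction R x"
      using \<phi> x by (auto simp: is_iso_def)
    then show ?thesis using l cl x by simp
  qed
  moreover have "label R (?\<psi> ` B) = label S B" if B: "B \<in> boundaries S" for B
  proof -
    obtain y where y: "y \<in> half_edges S" "B = orbit (s2 S) y" using B by (auto simp: boundaries_def)
    obtain x where x: "x \<in> half_edges R" "y = \<phi> x" using ex[OF y(1)] by auto
    have e: "B = \<phi> ` orbit (s2 R) x" using is_iso_orbit[OF \<phi> R x(1)] x y by simp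
    have sub: "orbit (s2 R) x \<subseteq> half_edges R" using R x(1) by (simp add: orbit_in ribbon_graph_def)
    have "?\<psi> ` B = (\<lambda>z. ?\<psi> (\<phi> z)) ` orbit (s2 R) x" unfolding e by (rule image_image)
    also have "\<dots> = id ` orbit (s2 R) x" using l sub by (intro image_cong) auto
    finally have "?\<psi> ` B = orbit (s2 R) x" by simp
    moreover have "label S (\<phi> ` orbit (s2 R) x) = label R (orbit (s2 R) x)"
      using \<phi> x by (simp add: is_iso_def boundaries_def)
    ultimately show ?thesis using e by simp
  qed
  ultimately show ?thesis using b' by (simp add: is_iso_def)
qed

lemma labelled_bijections_trans:
  assumes "h \<in> labelled_bijections X \<sigma> c Y \<rho> d" "k \<in> labelled_bijections Y \<rho> d Z \<pi> e" "\<sigma> permutes X"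
  shows "(\<lambda>x\<in>X. k (h x)) \<in> labelled_bijections X \<sigma> c Z \<pi> e"
proof -
  have hk: "bij_betw h X Y" "bij_betw k Y Z" using assms by (auto simp: labelled_bijections_def)
  have "bij_betw (k \<circ> h) X Z" by (rule bij_betw_trans[OF hk])
  then have "bij_betw (\<lambda>x\<in>X. k (h x)) X Z" by (simp add: bij_betw_def inj_on_def image_def)
  moreover have "h x \<in> Y" if "x \<in> X" for x using hk(1) that by (rule bij_betw_apply)
  moreover have "k y \<in> Z" if "y \<in> Y" for y using hk(2) that by (rule bij_betw_apply)
  ultimately show ?thesis using assms permutes_in_image[OF \<open>\<sigma> permutes X\<close>]
    by (simp add: labelled_bijections_def)
qed

lemma labelled_bijections_sym:
  assumes h: "h \<in> labelled_bijections X \<sigma> c Y \<rho> d" and s: "\<sigma> permutes X" "\<rho> permutes Y"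
  shows "(\<lambda>y\<in>Y. inv_into X h y) \<in> labelled_bijections Y \<rho> d X \<sigma> c"
proof -
  have b: "bij_betw h X Y" using h by (simp add: labelled_bijections_def)
  have b': "bij_betw (inv_into X h) Y X" using b by (rule bij_betw_inv_into)
  then have b2: "bij_betw (\<lambda>y\<in>Y. inv_into X h y) Y X" by (simp add: bij_betw_def inj_on_def image_def)
  have "inv_into X h (\<rho> y) = \<sigma> (inv_into X h y) \<and> c (inv_into X h y) = d y" if y: "y \<in> Y" for y
  proof -
    have "y \<in> h ` X" using b y by (simp add: bij_betw_def)
    then obtain x where x: "x \<in> X" "y = h x" by auto
    then have "\<rho> y = h (\<sigma> x)" "d y = c x" using h by (auto simp: labelled_bijections_def)
    moreover have "\<sigma> x \<in> X" using x permutes_in_image[OF s(1)] by simp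
    ultimately show ?thesis using x bij_betw_inv_into_left[OF b] by simp
  qed
  then show ?thesis using b2 bij_betw_apply[OF b'] permutes_in_image[OF s(2)]
    by (simp add: labelled_bijections_def)
qed

lemma labelled_bijections_sizes:
  assumes h: "h \<in> labelled_bijections X \<sigma> c Y \<rho> d" and X: "labelled X \<sigma> c ks" and Y: "labelled Y \<rho> d ls"
  shows "ks = ls"
proof -
  have b: "bij_betw h X Y" and hd: "\<And>x. x \<in> X \<Longrightarrow> d (h x) = c x" using h by (auto simp: labelled_bijections_def)
  have hX: "Y = h ` X" using b by (simp add: bij_betw_def)
  have "{..<length ks} = c ` X" using X by (simp add: labelled_def)
  also have "\<dots> = d ` Y" unfolding hX image_image using hd by (intro image_cong) auto
  also have "\<dots> = {..<length ls}" using Y by (simp add: labelled_def)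
  finally have len: "length ks = length ls" by simp
  show ?thesis
  proof (rule nth_equalityI[OF len])
    fix i assume i: "i < length ks"
    have "bij_betw h {x \<in> X. c x = i} {y \<in> Y. d y = i}"
    proof (rule bij_betw_subset[OF b])
      show "h ` {x \<in> X. c x = i} = {y \<in> Y. d y = i}" unfolding hX using hd by auto
    qed auto
    then have "card {x \<in> X. c x = i} = card {y \<in> Y. d y = i}" by (rule bij_betw_same_card)
    then show "ks ! i = ls ! i" using X Y i len by (simp add: labelled_def)
  qed
qed

definition lbij where
  "lbij R S = labelled_bijections (pos R) (bperm R) (blabel R) (pos S) (bperm S) (blabel S)"

text \<open>A directed ribbon graph with one negative boundary is determined by its positive half-edges
  with the permutations \<open>bperm\<close> and \<open>pairing\<close>.\<close>

lemma lbij_of_iso: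
  assumes "one_negative R g n" "one_negative S g n" "is_iso \<phi> R S"
  shows "restrict \<phi> (pos R) \<in> lbij R S" and "\<And>x. x \<in> pos R \<Longrightarrow> \<phi> (pairing R x) = pairing S (\<phi> x)"
proof -
  interpret R: one_negative R g n by fact
  interpret S: one_negative S g n by fact
  have b: "bij_betw \<phi> R.H S.H" using assms(3) by (simp add: is_iso_def)
  have iso: "\<phi> (s1 R x) = s1 S (\<phi> x)" "\<phi> (s2 R x) = s2 S (\<phi> x)" "direction S (\<phi> x) = direction R x"
    if "x \<in> R.H" for x using assms(3) that by (auto simp: is_iso_def)
  have P: "\<phi> x \<in> pos S \<longleftrightarrow> x \<in> pos R" if "x \<in> R.H" for x
    using iso(3)[OF that] bij_betw_apply[OF b that] that by (simp add: pos_def)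
  have PH: "x \<in> R.H" if "x \<in> pos R" for x using that by (simp add: pos_def)
  have "bij_betw \<phi> (pos R) (pos S)"
  proof (rule bij_betw_subset[OF b R.H_split(3)])
    show "\<phi> ` pos R = pos S"
    proof (intro equalityI subsetI)
      fix y assume "y \<in> pos S"
      then have "y \<in> \<phi> ` R.H" using b S.H_split by (auto simp: bij_betw_def)
      then show "y \<in> \<phi> ` pos R" using P \<open>y \<in> pos S\<close> by auto
    qed (use P PH in auto)
  qed
  then have "bij_betw (restrict \<phi> (pos R)) (pos R) (pos S)" by (simp add: bij_betw_def inj_on_def image_def)
  moreover have "\<phi> (bperm R x) = bperm S (\<phi> x)" if "x \<in> pos R" for x
    using that P[OF PH[OF that]] iso(2)[OF PH[OF that]] by (simp add: bperm_def)
  moreover have "blabel S (\<phi> x) = blabel R x" if "x \<in> pos R" for x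
  proof -
    have rg: "ribbon_graph R" using R.of_type by (simp add: of_type_def)
    have "blabel S (\<phi> x) = label S (\<phi> ` orbit (s2 R) x)"
      using is_iso_orbit[OF assms(3) rg PH[OF that]] by (simp add: blabel_def)
    also have "\<dots> = label R (orbit (s2 R) x)"
      using assms(3) PH[OF that] by (simp add: is_iso_def boundaries_def)
    finally show ?thesis by (simp add: blabel_def)
  qed
  ultimately show "restrict \<phi> (pos R) \<in> lbij R S"
    using P PH permutes_in_image[OF R.bperm_permutes] by (simp add: lbij_def labelled_bijections_def)
  fix x assume x: "x \<in> pos R"
  note c = PH[OF x] R.in_H(2)[OF PH[OF x]] R.in_H(3)[OF R.in_H(2)[OF PH[OF x]]]
    R.in_H(2)[OF R.in_H(3)[OF R.in_H(2)[OF PH[OF x]]]]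
  show "\<phi> (pairing R x) = pairing S (\<phi> x)"
    using x P[OF c(1)] by (simp add: pairing_def iso c)
qed

text \<open>On negative half-edges the value is forced by compatibility with \<open>s1\<close>.
  Being the identity elsewhere makes it eligible for \<open>Aut\<close> when
  \<open>R = S\<close>.\<close>

definition extend_iso where
  "extend_iso R S h x = (if x \<in> pos R then h x else if x \<in> half_edges R then s1 S (h (s1 R x)) else x)"

lemma iso_of_lbij:
  assumes "one_negative R g n" "one_negative S g n" and h: "h \<in> lbij R S"
    and pair: "\<And>x. x \<in> pos R \<Longrightarrow> h (pairing R x) = pairing S (h x)"
  shows "is_iso (extend_iso R S h) R S"
proof -
  interpret R: one_negative R g n by fact
  interpret S: one_negative S g n by fact
  let ?\<phi> = "extend_iso R S h"
  have b: "bij_betw h (pos R) (pos S)" and hs: "\<And>x. x \<in> pos R \<Longrightarrow> h (bperm R x) = bperm S (h x)"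
    and hl: "\<And>x. x \<in> pos R \<Longrightarrow> blabel S (h x) = blabel R x"
    using h by (auto simp: lbij_def labelled_bijections_def)
  have hP: "h x \<in> pos S" if "x \<in> pos R" for x using b that by (rule bij_betw_apply)
  have eP: "?\<phi> x = h x" if "x \<in> pos R" for x using that by (simp add: extend_iso_def)
  have eM: "?\<phi> x = s1 S (h (s1 R x))" if "x \<in> neg R" for x
    using that R.H_split by (auto simp: extend_iso_def)
  have inP: "?\<phi> x \<in> pos S" if "x \<in> pos R" for x using eP hP that by simp
  have inM: "?\<phi> x \<in> neg S" if "x \<in> neg R" for x using eM hP R.s1_swap S.s1_swap that by simp
  have s1s1: "s1 R (s1 R x) = x" if "x \<in> neg R" for x using R.rg(5) R.H_split(4) that by auto
  have s1s1P: "s1 R (s1 R x) = x" if "x \<in> pos R" for x using R.rg(5) R.H_split(3) that by auto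
  have s1s1': "s1 S (s1 S x) = x" if "x \<in> pos S" for x using S.rg(5) S.H_split(3) that by auto
  have s1s1M': "s1 S (s1 S x) = x" if "x \<in> neg S" for x using S.rg(5) S.H_split(4) that by auto
  have bM: "bij_betw ?\<phi> (neg R) (neg S)"
  proof -
    have "bij_betw (s1 R) (neg R) (pos R)"
      by (rule bij_betw_byWitness[where f' = "s1 R"]) (use R.s1_swap s1s1 s1s1P in auto)
    moreover have "bij_betw (s1 S) (pos S) (neg S)"
      by (rule bij_betw_byWitness[where f' = "s1 S"]) (use S.s1_swap s1s1' s1s1M' in auto)
    ultimately have "bij_betw (s1 S \<circ> (h \<circ> s1 R)) (neg R) (neg S)" using b by (blast intro: bij_betw_trans)
    moreover have "bij_betw ?\<phi> (neg R) (neg S) = bij_betw (s1 S \<circ> (h \<circ> s1 R)) (neg R) (neg S)"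
      by (rule bij_betw_cong) (simp add: eM)
    ultimately show ?thesis by simp
  qed
  have "bij_betw ?\<phi> (pos R) (pos S) = bij_betw h (pos R) (pos S)"
    by (rule bij_betw_cong) (simp add: eP)
  then have bij: "bij_betw ?\<phi> R.H S.H"
    unfolding R.H_split(1) S.H_split(1) using b bM S.H_split(2) by (intro bij_betw_combine) auto
  have s1: "?\<phi> (s1 R x) = s1 S (?\<phi> x)" if x: "x \<in> R.H" for x
  proof (cases "x \<in> pos R")
    case True
    then show ?thesis using eM[of "s1 R x"] R.s1_swap s1s1P eP by simp
  next
    case False
    then have "x \<in> neg R" using x R.H_split(1) by auto
    then show ?thesis using eP[of "s1 R x"] R.s1_swap eM s1s1' hP by simp
  qed
  \<comment> \<open>The action of \<open>s2\<close> on negative half-edges, conjugated by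
    \<open>s1\<close>, is \<open>inv (bperm R) \<circ> pairing R\<close>; compatibility with
    \<open>bperm\<close> and \<open>pairing\<close> therefore gives compatibility with it.\<close>
  have gam: "h (s1 R (s2 R (s1 R x))) = s1 S (s2 S (s1 S (h x)))" if x: "x \<in> pos R" for x
  proof -
    let ?y = "s1 R (s2 R (s1 R x))"
    have y: "?y \<in> pos R" using x R.s1_swap R.s2_keep by simp
    have "bperm R ?y = pairing R x" using x y by (simp add: bperm_def pairing_def)
    then have "bperm S (h ?y) = pairing S (h x)" using hs[OF y] pair[OF x] by simp
    then have "h ?y = inv (bperm S) (pairing S (h x))" using S.bperm_permutes by (metis permutes_inverses(2))
    then show ?thesis using S.bperm_inv_pairing[OF hP[OF x]] by simp
  qed
  have s2: "?\<phi> (s2 R x) = s2 S (?\<phi> x)" if x: "x \<in> R.H" for x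
  proof (cases "x \<in> pos R")
    case True
    then show ?thesis using hs[OF True] eP R.s2_keep(1)[OF True] hP by (simp add: bperm_def)
  next
    case False
    then have M: "x \<in> neg R" using x R.H_split(1) by auto
    then have x1: "s1 R x \<in> pos R" using R.s1_swap by simp
    have "?\<phi> (s2 R x) = s1 S (h (s1 R (s2 R (s1 R (s1 R x)))))" using eM R.s2_keep(2)[OF M] s1s1[OF M] by simp
    also have "\<dots> = s1 S (s1 S (s2 S (s1 S (h (s1 R x)))))" using gam[OF x1] by simp
    also have "\<dots> = s2 S (s1 S (h (s1 R x)))"
      using s1s1M' S.s2_keep(2) S.s1_swap(1) hP[OF x1] by simp
    finally show ?thesis using eM[OF M] by simp
  qed
  \<comment> \<open>\<open>s0\<close> is the inverse of \<open>s2 \<circ> s1\<close>, so this case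
    follows from the other two permutations.\<close>
  have s0: "?\<phi> (s0 R x) = s0 S (?\<phi> x)" if x: "x \<in> R.H" for x
  proof -
    have y: "s0 R x \<in> R.H" "s1 R (s0 R x) \<in> R.H" using R.in_H x by auto
    have "s2 R (s1 R (s0 R x)) = x" using fun_cong[OF R.rg(7), of x] by simp
    then have "?\<phi> x = s2 S (s1 S (?\<phi> (s0 R x)))" using s2[OF y(2)] s1[OF y(1)] by simp
    then show ?thesis using S.s0_s2_s1 by simp
  qed
  have dr: "direction S (?\<phi> x) = direction R x" if x: "x \<in> R.H" for x
  proof (cases "x \<in> pos R")
    case True then show ?thesis using inP[OF True] by (simp add: pos_def)
  next
    case False
    then have M: "x \<in> neg R" using x R.H_split(1) by auto
    then show ?thesis using inM[OF M] by (simp add: neg_def)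
  qed
  have "label S (?\<phi> ` B) = label R B" if B: "B \<in> boundaries R" for B
  proof -
    obtain x where x: "x \<in> R.H" "B = orbit (s2 R) x" using B by (auto simp: boundaries_def)
    have e: "?\<phi> ` B = orbit (s2 S) (?\<phi> x)" unfolding x(2)
      by (rule orbit_image[OF x(1), symmetric]) (use R.in_H s2 in auto)
    show ?thesis
    proof (cases "x \<in> pos R")
      case True
      then show ?thesis using hl[OF True] eP[OF True] e x by (simp add: blabel_def)
    next
      case False
      then have M: "x \<in> neg R" using x R.H_split(1) by auto
      then show ?thesis using S.label_M[OF inM[OF M]] R.label_M[OF M] e x by simp
    qed
  qed
  then show ?thesis using bij s0 s1 s2 dr by (simp add: is_iso_def)
qed

section \<open>Realisations of a gluing by ribbon graphs, and orbit counting\<close>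

definition realises ::
  "'a set \<Rightarrow> ('a \<Rightarrow> 'a) \<Rightarrow> ('a \<Rightarrow> nat) \<Rightarrow> ('h, 'z) directed_ribbon_graph_scheme \<Rightarrow> ('a \<Rightarrow> 'a) \<Rightarrow> ('a \<Rightarrow> 'h) \<Rightarrow> bool" where
  "realises X \<sigma> c R \<tau> h \<longleftrightarrow> h \<in> labelled_bijections X \<sigma> c (pos R) (bperm R) (blabel R) \<and>
     (\<forall>x\<in>X. h (\<tau> x) = pairing R (h x))"

lemma card_eq_sum_fibres:
  assumes "finite K" shows "card K = (\<Sum>t\<in>f ` K. card {h \<in> K. f h = t})"
  using sum.image_gen[OF assms, of "\<lambda>_. 1::nat" f] by simp

text \<open>The composite of \<open>k\<close> with the inverse of \<open>h\<close> respects
  \<open>bperm\<close>, \<open>pairing\<close> and the labels on positive half-edges, and it extends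
  through \<open>s1\<close>. So a gluing determines its realisation up to isomorphism.\<close>

lemma realises_unique_iso:
  assumes R: "one_negative R g n" and S: "one_negative S g n"
    and X: "\<sigma> permutes X" "\<tau> permutes X" and h: "realises X \<sigma> c R \<tau> h" and k: "realises X \<sigma> c S \<tau> k"
  obtains \<phi> where "is_iso \<phi> R S" "\<And>x. x \<in> X \<Longrightarrow> \<phi> (h x) = k x"
    "\<And>y. y \<notin> half_edges R \<Longrightarrow> \<phi> y = y"
proof -
  interpret R: one_negative R g n by fact
  interpret S: one_negative S g n by fact
  have hl: "h \<in> labelled_bijections X \<sigma> c (pos R) (bperm R) (blabel R)"
    and hp: "\<And>x. x \<in> X \<Longrightarrow> h (\<tau> x) = pairing R (h x)" using h by (auto simp: realises_def)
  have kl: "k \<in> labelled_bijections X \<sigma> c (pos S) (bperm S) (blabel S)"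
    and kp: "\<And>x. x \<in> X \<Longrightarrow> k (\<tau> x) = pairing S (k x)" using k by (auto simp: realises_def)
  have b: "bij_betw h X (pos R)" using hl by (simp add: labelled_bijections_def)
  define u where "u = (\<lambda>y\<in>pos R. k ((\<lambda>y\<in>pos R. inv_into X h y) y))"
  have u: "u \<in> lbij R S" unfolding lbij_def u_def
    by (rule labelled_bijections_trans[OF labelled_bijections_sym[OF hl X(1) R.bperm_permutes] kl R.bperm_permutes])
  have hX: "h x \<in> pos R" if "x \<in> X" for x using b that by (rule bij_betw_apply)
  have uh: "u (h x) = k x" if "x \<in> X" for x
    using that hX bij_betw_inv_into_left[OF b] by (simp add: u_def)
  have "u (pairing R y) = pairing S (u y)" if "y \<in> pos R" for y
  proof -
    have "y \<in> h ` X" using b that by (simp add: bij_betw_def)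
    then obtain x where x: "x \<in> X" "y = h x" by auto
    have "\<tau> x \<in> X" using x X(2) by (simp add: permutes_in_image)
    then show ?thesis using hp[OF x(1)] kp[OF x(1)] uh x by metis
  qed
  from iso_of_lbij[OF R S u this] have "is_iso (extend_iso R S u) R S" .
  moreover have "extend_iso R S u (h x) = k x" if "x \<in> X" for x using hX uh that by (simp add: extend_iso_def)
  moreover have "extend_iso R S u y = y" if "y \<notin> half_edges R" for y
    using that R.H_split by (auto simp: extend_iso_def)
  ultimately show ?thesis using that by blast
qed

lemma realises_iso:
  assumes R: "one_negative R g n" and S: "one_negative S g n"
    and X: "\<sigma> permutes X" "\<tau> permutes X" and h: "realises X \<sigma> c R \<tau> h" and \<phi>: "is_iso \<phi> R S"
  shows "realises X \<sigma> c S \<tau> (\<lambda>x\<in>X. \<phi> (h x))"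
proof -
  have hl: "h \<in> labelled_bijections X \<sigma> c (pos R) (bperm R) (blabel R)"
    and hp: "\<And>x. x \<in> X \<Longrightarrow> h (\<tau> x) = pairing R (h x)" using h by (auto simp: realises_def)
  have hX: "h x \<in> pos R" if "x \<in> X" for x using hl that by (auto simp: labelled_bijections_def)
  note r = lbij_of_iso[OF R S \<phi>]
  have "(\<lambda>x\<in>X. restrict \<phi> (pos R) (h x)) \<in> labelled_bijections X \<sigma> c (pos S) (bperm S) (blabel S)"
    by (rule labelled_bijections_trans[OF hl r(1)[unfolded lbij_def] X(1)])
  moreover have "(\<lambda>x\<in>X. restrict \<phi> (pos R) (h x)) = (\<lambda>x\<in>X. \<phi> (h x))" using hX by auto
  ultimately show ?thesis using hX hp r(2) X(2) by (simp add: realises_def permutes_in_image)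
qed

text \<open>Orbit counting: the labelled bijections \<open>X \<rightarrow> P\<close> form a torsor under the centraliser of \<open>\<sigma>\<close>, and two of
  them pull \<open>pairing R\<close> back to the same \<open>\<tau>\<close> iff they differ by an automorphism of \<open>R\<close>.\<close>

lemma card_realisable_gluings:
  assumes R: "one_negative R g n" and X: "labelled X \<sigma> c (sizes n R)"
  shows "card {\<tau> \<in> gluings X \<sigma>. \<exists>h. realises X \<sigma> c R \<tau> h} * card (Aut R) = prod_list (sizes n R)"
proof -
  interpret R: one_negative R g n by fact
  define K where "K = labelled_bijections X \<sigma> c (pos R) (bperm R) (blabel R)"
  have X': "finite X" "\<sigma> permutes X" using X by (auto simp: labelled_def)
  have finK: "finite K"
    by (rule finite_subset[of _ "X \<rightarrow>\<^sub>E pos R"]) (use X'(1) R.finP in \<open>auto simp: K_def labelled_bijections_def intro: finite_PiE\<close>)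
  define pull where "pull h x = (if x \<in> X then inv_into X h (pairing R (h x)) else x)" for h x
  have hb: "bij_betw h X (pos R)" if "h \<in> K" for h using that by (simp add: K_def labelled_bijections_def)
  have hX: "h x \<in> pos R" if "h \<in> K" "x \<in> X" for h x using hb[OF that(1)] that(2) by (rule bij_betw_apply)
  have pull: "h (pull h x) = pairing R (h x)" "pull h x \<in> X" if "h \<in> K" "x \<in> X" for h x
  proof -
    have "pairing R (h x) \<in> pos R" using hX[OF that] R.pairing_involution(3) by simp
    then show "h (pull h x) = pairing R (h x)" "pull h x \<in> X"
      using that bij_betw_inv_into_right[OF hb[OF that(1)]] bij_betw_apply[OF bij_betw_inv_into[OF hb[OF that(1)]]]
      by (simp_all add: pull_def)
  qed
  have pull_unique: "\<tau> = pull h" if "h \<in> K" "\<tau> permutes X" "\<And>x. x \<in> X \<Longrightarrow> h (\<tau> x) = pairing R (h x)" for h \<tau>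
  proof
    fix x show "\<tau> x = pull h x"
    proof (cases "x \<in> X")
      case True
      then have "\<tau> x \<in> X" "h (\<tau> x) = h (pull h x)" using that pull(1)[OF that(1) True] by (simp_all add: permutes_in_image)
      then show ?thesis using pull(2)[OF that(1) True] bij_betw_imp_inj_on[OF hb[OF that(1)]] by (simp add: inj_on_def)
    next
      case False then show ?thesis using that(2) by (simp add: pull_def permutes_def)
    qed
  qed
  have pull_perm: "pull h permutes X" if h: "h \<in> K" for h
  proof (rule bij_imp_permutes)
    have "inj_on (pull h) X"
    proof (rule inj_onI)
      fix x y assume xy: "x \<in> X" "y \<in> X" "pull h x = pull h y"
      then have "pairing R (h x) = pairing R (h y)" using pull(1)[OF h] by metis
      then have "h x = h y" using permutes_inj[OF R.pairing_permutes] by (simp add: inj_def)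
      then show "x = y" using bij_betw_imp_inj_on[OF hb[OF h]] xy by (simp add: inj_on_def)
    qed
    moreover have "pull h ` X \<subseteq> X" using pull(2)[OF h] by auto
    ultimately show "bij_betw (pull h) X X" using endo_inj_surj[OF X'(1)] unfolding bij_betw_def by blast
  qed (simp add: pull_def)
  have pull_real: "realises X \<sigma> c R (pull h) h" if "h \<in> K" for h
    using that pull(1) by (simp add: realises_def K_def)
  have pull_glue: "pull h \<in> gluings X \<sigma>" if h: "h \<in> K" for h
  proof -
    have "\<And>x. x \<in> X \<Longrightarrow> h (\<sigma> x) = bperm R (h x)" using h by (simp add: K_def labelled_bijections_def)
    from gluings_conjugate[OF X' R.finP R.bperm_permutes hb[OF h] this pull_perm[OF h] R.pairing_permutes]
    show ?thesis using pull(1)[OF h] R.pairing_gluing by simp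
  qed
  have im: "{\<tau> \<in> gluings X \<sigma>. \<exists>h. realises X \<sigma> c R \<tau> h} = pull ` K"
  proof (intro equalityI subsetI)
    fix \<tau> assume "\<tau> \<in> {\<tau> \<in> gluings X \<sigma>. \<exists>h. realises X \<sigma> c R \<tau> h}"
    then obtain h where h: "\<tau> \<in> gluings X \<sigma>" "realises X \<sigma> c R \<tau> h" by blast
    then have "h \<in> K" "\<tau> permutes X" "\<And>x. x \<in> X \<Longrightarrow> h (\<tau> x) = pairing R (h x)"
      by (auto simp: realises_def K_def gluings_def)
    from pull_unique[OF this] \<open>h \<in> K\<close> show "\<tau> \<in> pull ` K" by auto
  qed (use pull_glue pull_real in blast)
  \<comment> \<open>Composing a fixed \<open>h0\<close> with automorphisms fills the fibre exactly
    once: an automorphism is determined on the positive half-edges, as \<open>s1\<close> transfers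
    it to the negative ones, and any two members of the fibre differ by one.\<close>
  have fib: "card {h \<in> K. pull h = \<tau>} = card (Aut R)" if "\<tau> \<in> pull ` K" for \<tau>
  proof -
    from that obtain h0 where h0: "h0 \<in> K" "\<tau> = pull h0" by auto
    have h0P: "h0 ` X = pos R" using hb[OF h0(1)] by (simp add: bij_betw_def)
    have tp: "\<tau> permutes X" using pull_perm h0 by simp
    have ext: "h x = undefined" if "h \<in> K" "x \<notin> X" for h x
      using that by (auto simp: K_def labelled_bijections_def PiE_def extensional_def)
    have "bij_betw (\<lambda>\<phi>. \<lambda>x\<in>X. \<phi> (h0 x)) (Aut R) {h \<in> K. pull h = \<tau>}"
      unfolding bij_betw_def
    proof
      show "inj_on (\<lambda>\<phi>. \<lambda>x\<in>X. \<phi> (h0 x)) (Aut R)"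
      proof (rule inj_onI)
        fix \<phi> \<psi> assume A: "\<phi> \<in> Aut R" "\<psi> \<in> Aut R" and eq: "(\<lambda>x\<in>X. \<phi> (h0 x)) = (\<lambda>x\<in>X. \<psi> (h0 x))"
        have P: "\<phi> y = \<psi> y" if "y \<in> pos R" for y
        proof -
          obtain x where "x \<in> X" "y = h0 x" using \<open>y \<in> pos R\<close> h0P by auto
          then show ?thesis using fun_cong[OF eq, of x] by simp
        qed
        show "\<phi> = \<psi>"
        proof
          fix y
          consider "y \<in> pos R" | "y \<in> neg R" | "y \<notin> R.H" using R.H_split(1) by blast
          then show "\<phi> y = \<psi> y"
          proof cases
            case 2
            then have y: "s1 R y \<in> pos R" "s1 R y \<in> R.H" "s1 R (s1 R y) = y"
              using R.s1_swap R.H_split R.rg(5) by auto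
            have "\<phi> (s1 R (s1 R y)) = s1 R (\<phi> (s1 R y))" "\<psi> (s1 R (s1 R y)) = s1 R (\<psi> (s1 R y))"
              using A y(2) by (simp_all add: Aut_def is_iso_def)
            then show ?thesis using P[OF y(1)] y(3) by simp
          next
            case 3 then show ?thesis using A by (simp add: Aut_def permutes_def)
          qed (rule P)
        qed
      qed
      show "(\<lambda>\<phi>. \<lambda>x\<in>X. \<phi> (h0 x)) ` Aut R = {h \<in> K. pull h = \<tau>}"
      proof (intro equalityI subsetI)
        fix h assume "h \<in> (\<lambda>\<phi>. \<lambda>x\<in>X. \<phi> (h0 x)) ` Aut R"
        then obtain \<phi> where \<phi>: "\<phi> \<in> Aut R" "h = (\<lambda>x\<in>X. \<phi> (h0 x))" by auto
        have "realises X \<sigma> c R \<tau> h" unfolding \<phi>(2)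
          by (rule realises_iso[OF R R X'(2) tp]) (use pull_real h0 \<phi>(1) in \<open>auto simp: Aut_def\<close>)
        then have "h \<in> K" "\<And>x. x \<in> X \<Longrightarrow> h (\<tau> x) = pairing R (h x)" by (auto simp: realises_def K_def)
        then show "h \<in> {h \<in> K. pull h = \<tau>}" using pull_unique[OF _ tp] by auto
      next
        fix h assume "h \<in> {h \<in> K. pull h = \<tau>}"
        then have h: "h \<in> K" "pull h = \<tau>" by auto
        have "realises X \<sigma> c R \<tau> h0" "realises X \<sigma> c R \<tau> h"
          using pull_real[OF h0(1)] pull_real[OF h(1)] h0(2) h(2) by simp_all
        from realises_unique_iso[OF R R X'(2) tp this] obtain \<phi> where \<phi>: "is_iso \<phi> R R"
          "\<And>x. x \<in> X \<Longrightarrow> \<phi> (h0 x) = h x" "\<And>y. y \<notin> R.H \<Longrightarrow> \<phi> y = y" by metis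
        have "\<phi> permutes R.H" using \<phi>(1,3) by (intro bij_imp_permutes) (auto simp: is_iso_def)
        then have "\<phi> \<in> Aut R" using \<phi> by (simp add: Aut_def)
        moreover have "h = (\<lambda>x\<in>X. \<phi> (h0 x))"
          using \<phi>(2) ext[OF h(1)] by (auto simp: fun_eq_iff)
        ultimately show "h \<in> (\<lambda>\<phi>. \<lambda>x\<in>X. \<phi> (h0 x)) ` Aut R" by blast
      qed
    qed
    then show ?thesis by (simp add: bij_betw_same_card)
  qed
  have "prod_list (sizes n R) = card K"
    unfolding K_def by (rule card_labelled_bijections[OF X R.labelled_pos, symmetric])
  also have "\<dots> = (\<Sum>\<tau>\<in>pull ` K. card {h \<in> K. pull h = \<tau>})" by (rule card_eq_sum_fibres[OF finK])
  also have "\<dots> = card (pull ` K) * card (Aut R)" using fib by simp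
  finally show ?thesis using im by simp
qed

section \<open>Building a ribbon graph from a gluing\<close>

lemma card_equal_orbits:
  assumes "finite X" "f permutes X" "\<And>x. x \<in> X \<Longrightarrow> card (orbit f x) = d"
  shows "card X = d * card (orbit f ` X)"
proof -
  have "card X = sum_mset (orbit_sizes X f)" by (rule sum_orbit_sizes[OF assms(1,2), symmetric])
  also have "\<dots> = (\<Sum>B\<in>orbit f ` X. card B)" by (simp add: orbit_sizes_def sum_unfold_sum_mset)
  also have "\<dots> = (\<Sum>B\<in>orbit f ` X. d)" using assms(3) by (intro sum.cong) auto
  finally show ?thesis by simp
qed

text \<open>The point \<open>x\<close> becomes the edge with positive half-edge \<open>2 x\<close> and negative half-edge \<open>2 x + 1\<close>.\<close>

lemma ex_realisation:
  fixes X :: "nat set"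
  assumes X: "labelled X \<sigma> c ks" and t: "\<tau> \<in> gluings X \<sigma>" and n: "length ks = n" "n \<ge> 1"
    and N: "int (card X) = 2 * (2 * int g - 1 + int n)"
  shows "\<exists>(R :: nat directed_ribbon_graph) h. one_negative R g n \<and> realises X \<sigma> c R \<tau> h"
proof -
  have fX: "finite X" and sp: "\<sigma> permutes X" and cX: "c ` X = {..<n}" using X n by (auto simp: labelled_def)
  have tp: "\<tau> permutes X" and tt: "\<And>x. x \<in> X \<Longrightarrow> \<tau> (\<tau> x) = x" "\<And>x. x \<in> X \<Longrightarrow> \<tau> x \<noteq> x"
    and tr: "\<And>x y. x \<in> X \<Longrightarrow> y \<in> X \<Longrightarrow> y \<in> orbit (inv \<sigma> \<circ> \<tau>) x" using t by (auto simp: gluings_def)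
  have "0 \<in> c ` X" unfolding cX using n(2) by simp
  then have Xne: "X \<noteq> {}" by auto
  define \<gamma> where "\<gamma> = inv \<sigma> \<circ> \<tau>"
  have gp: "\<gamma> permutes X" unfolding \<gamma>_def by (rule permutes_compose[OF tp permutes_inv[OF sp]])
  have sg: "\<sigma> (\<gamma> x) = \<tau> x" for x using sp by (simp add: \<gamma>_def permutes_inverses)
  define P where "P = (\<lambda>x. 2 * x) ` X"
  define M where "M = (\<lambda>x. 2 * x + 1) ` X"
  define H where "H = P \<union> M"
  define f1 where "f1 y = (if y \<in> H then (if even y then y + 1 else y - 1) else y)" for y
  \<comment> \<open>On odd numbers \<open>f2\<close> has to be \<open>\<gamma>\<close>, so that
    conjugating by \<open>f1\<close> moves the negative boundary walk to
    \<open>inv \<sigma> \<circ> \<tau>\<close> on the even ones. It is then a single cycle.\<close>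
  define f2 where "f2 y = (if y \<in> H then (if even y then 2 * \<sigma> (y div 2) else 2 * \<gamma> (y div 2) + 1) else y)" for y
  have sX: "\<sigma> x \<in> X" "\<gamma> x \<in> X" "\<tau> x \<in> X" if "x \<in> X" for x
    using that sp gp tp by (simp_all add: permutes_in_image)
  have inH: "2 * x \<in> H" "2 * x + 1 \<in> H" if "x \<in> X" for x using that by (auto simp: H_def P_def M_def)
  have caseH: "\<exists>x\<in>X. y = 2 * x \<or> y = 2 * x + 1" if "y \<in> H" for y using that by (auto simp: H_def P_def M_def)
  have finH: "finite H" using fX by (simp add: H_def P_def M_def)
  have f1e: "f1 (2 * x) = 2 * x + 1" "f1 (2 * x + 1) = 2 * x" if "x \<in> X" for x
    using inH[OF that] by (simp_all add: f1_def)
  have f2e: "f2 (2 * x) = 2 * \<sigma> x" "f2 (2 * x + 1) = 2 * \<gamma> x + 1" if "x \<in> X" for x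
    using inH[OF that] by (simp_all add: f2_def)
  have f1p: "f1 permutes H"
  proof (rule bij_imp_permutes)
    have inv: "f1 (f1 y) = y" and cl: "f1 y \<in> H" if "y \<in> H" for y
    proof -
      obtain x where x: "x \<in> X" "y = 2 * x \<or> y = 2 * x + 1" using caseH[OF \<open>y \<in> H\<close>] by blast
      show "f1 (f1 y) = y" using x(2) f1e[OF x(1)] by (elim disjE) (simp_all only:)
      show "f1 y \<in> H" using x(2) f1e[OF x(1)] inH[OF x(1)] by (elim disjE) (simp_all only:)
    qed
    have "f1 ` H \<subseteq> H" using cl by (rule image_subsetI)
    then show "bij_betw f1 H H" using inv by (intro bij_betw_byWitness[where f' = f1]) blast+
  qed (simp add: f1_def)
  have f2p: "f2 permutes H"
  proof (rule bij_imp_permutes)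
    have "inj_on f2 H"
    proof (rule inj_onI)
      fix y z assume yz: "y \<in> H" "z \<in> H" "f2 y = f2 z"
      have odd: "2 * a \<noteq> 2 * b + (1::nat)" for a b by presburger
      have inj: "\<sigma> a = \<sigma> b \<longleftrightarrow> a = b" "\<gamma> a = \<gamma> b \<longleftrightarrow> a = b" for a b
        by (rule inj_eq[OF permutes_inj[OF sp]], rule inj_eq[OF permutes_inj[OF gp]])
      obtain a where a: "a \<in> X" "y = 2 * a \<or> y = 2 * a + 1" using caseH[OF yz(1)] by auto
      obtain b where b: "b \<in> X" "z = 2 * b \<or> z = 2 * b + 1" using caseH[OF yz(2)] by auto
      show "y = z" using a b yz(3) f2e odd[of "\<sigma> a" "\<gamma> b"] odd[of "\<sigma> b" "\<gamma> a"] by (auto simp: inj)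
    qed
    moreover have "f2 ` H \<subseteq> H"
    proof (rule image_subsetI)
      fix y assume "y \<in> H"
      then obtain x where x: "x \<in> X" "y = 2 * x \<or> y = 2 * x + 1" using caseH by blast
      show "f2 y \<in> H" using x(2) f2e[OF x(1)] inH[OF sX(1)[OF x(1)]] inH[OF sX(2)[OF x(1)]]
        by (elim disjE) (simp_all only:)
    qed
    ultimately show "bij_betw f2 H H" using endo_inj_surj[OF finH] unfolding bij_betw_def by blast
  qed (simp add: f2_def)
  define f0 where "f0 = inv (f2 \<circ> f1)"
  have f21: "f2 \<circ> f1 permutes H" by (rule permutes_compose[OF f1p f2p])
  have f0p: "f0 permutes H" unfolding f0_def by (rule permutes_inv[OF f21])
  \<comment> \<open>The minimum serves as a representative of the orbit: its parity tells the
    direction, and all members of a positive orbit have the same label. The only negative boundary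
    gets label 0.\<close>
  define lb where "lb B = (let m = Min B in if even m then c (m div 2) else 0)" for B :: "nat set"
  define R :: "nat directed_ribbon_graph" where
    "R = \<lparr>half_edges = H, s0 = f0, s1 = f1, s2 = f2, direction = (\<lambda>y. if even y then 1 else -1), label = lb\<rparr>"
  have Rs: "half_edges R = H" "s0 R = f0" "s1 R = f1" "s2 R = f2"
    "direction R = (\<lambda>y. if even y then 1 else -1)" "label R = lb" by (simp_all add: R_def)
  have rgR: "ribbon_graph R"
  proof -
    have "f2 \<circ> f1 \<circ> f0 = id" unfolding f0_def by (rule permutes_inv_o(1)[OF f21])
    moreover have "f1 (f1 y) = y \<and> f1 y \<noteq> y" if "y \<in> H" for y using caseH[OF that] f1e by auto
    ultimately show ?thesis using finH f0p f1p f2p by (simp add: ribbon_graph_def Rs)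
  qed
  have dR: "is_direction R" unfolding is_direction_def Rs
  proof
    fix y assume "y \<in> H"
    then obtain x where x: "x \<in> X" "y = 2 * x \<or> y = 2 * x + 1" using caseH by blast
    from x(2) show "(if even y then 1 else - 1) \<in> {1, - 1 :: int} \<and>
      (if even (f2 y) then 1 else - 1 :: int) = (if even y then 1 else - 1) \<and>
      (if even (f1 y) then 1 else - 1 :: int) = - (if even y then 1 else - 1)"
    proof
      assume "y = 2 * x" then show ?thesis by (simp only: f1e(1)[OF x(1)] f2e(1)[OF x(1)]) simp
    next
      assume "y = 2 * x + 1" then show ?thesis by (simp only: f1e(2)[OF x(1)] f2e(2)[OF x(1)]) simp
    qed
  qed
  have posR: "pos R = P" and negR: "neg R = M"
    by (auto simp: pos_def neg_def Rs H_def P_def M_def)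
  have oP: "orbit f2 (2 * x) = (\<lambda>x. 2 * x) ` orbit \<sigma> x" if "x \<in> X" for x
    by (rule orbit_image[OF that]) (use f2e sX in auto)
  have gX: "orbit \<gamma> x = X" if "x \<in> X" for x
    using orbit_in[OF fX gp that] tr[OF that] by (auto simp: \<gamma>_def)
  have oM: "orbit f2 (2 * x + 1) = M" if "x \<in> X" for x
  proof -
    have "orbit f2 (2 * x + 1) = (\<lambda>x. 2 * x + 1) ` orbit \<gamma> x"
      by (rule orbit_image[OF that]) (use f2e sX in auto)
    then show ?thesis using gX[OF that] by (simp add: M_def)
  qed
  have lbP: "lb ((\<lambda>x. 2 * x) ` orbit \<sigma> x) = c x" if "x \<in> X" for x
  proof -
    have "finite (orbit \<sigma> x)" "orbit \<sigma> x \<noteq> {}" using finite_orbit_in[OF fX sp] orbit_refl[OF fX sp] by auto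
    then have "Min ((\<lambda>x. 2 * x) ` orbit \<sigma> x) \<in> (\<lambda>x. 2 * x) ` orbit \<sigma> x" by (intro Min_in) auto
    then obtain y where y: "y \<in> orbit \<sigma> x" "Min ((\<lambda>x. 2 * x) ` orbit \<sigma> x) = 2 * y" by auto
    then have "c y = c x" using labelled_orbit[OF X that] by auto
    then show ?thesis using y by (simp add: lb_def)
  qed
  have lbM: "lb M = 0"
  proof -
    have "Min M \<in> M" using fX Xne by (intro Min_in) (auto simp: M_def)
    then have "odd (Min M)" by (auto simp: M_def)
    then show ?thesis by (simp add: lb_def Let_def)
  qed
  have posb: "pos_boundaries R = (\<lambda>x. (\<lambda>x. 2 * x) ` orbit \<sigma> x) ` X"
  proof (intro equalityI subsetI)
    fix B assume "B \<in> pos_boundaries R"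
    then obtain y where y: "y \<in> H" "B = orbit f2 y" and d: "\<forall>z\<in>B. even z"
      by (auto simp: pos_boundaries_def boundaries_def Rs split: if_splits)
    have "y \<in> B" using y orbit_refl[OF finH f2p] by simp
    then have "even y" using d by auto
    then obtain x where "x \<in> X" "y = 2 * x" using caseH[OF y(1)] by auto
    then show "B \<in> (\<lambda>x. (\<lambda>x. 2 * x) ` orbit \<sigma> x) ` X" using oP y by auto
  next
    fix B assume "B \<in> (\<lambda>x. (\<lambda>x. 2 * x) ` orbit \<sigma> x) ` X"
    then obtain x where x: "x \<in> X" "B = (\<lambda>x. 2 * x) ` orbit \<sigma> x" by auto
    then have "\<forall>z\<in>B. even z" by auto
    moreover have "B = orbit f2 (2 * x)" using oP x by simp
    then have "B \<in> boundaries R" using inH(1)[OF x(1)] by (simp add: boundaries_def Rs)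
    ultimately show "B \<in> pos_boundaries R" by (simp add: pos_boundaries_def Rs)
  qed
  have negb: "neg_boundaries R = {M}"
  proof (intro equalityI subsetI)
    fix B assume "B \<in> neg_boundaries R"
    then obtain y where y: "y \<in> H" "B = orbit f2 y" and d: "\<forall>z\<in>B. odd z"
      by (auto simp: neg_boundaries_def boundaries_def Rs split: if_splits)
    have "y \<in> B" using y orbit_refl[OF finH f2p] by simp
    then have "odd y" using d by auto
    then obtain x where "x \<in> X" "y = 2 * x + 1" using caseH[OF y(1)] by auto
    then show "B \<in> {M}" using oM y by auto
  next
    fix B assume "B \<in> {M}"
    then have B: "B = M" by simp
    obtain x where "x \<in> X" using Xne by auto
    then have "M \<in> boundaries R" using oM inH by (auto simp: boundaries_def Rs intro!: image_eqI[of _ _ "2 * x + 1"])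
    then show "B \<in> neg_boundaries R" unfolding B by (auto simp: neg_boundaries_def Rs M_def)
  qed
  have labP: "bij_betw (label R) (pos_boundaries R) {..<n}"
    unfolding bij_betw_def posb Rs
  proof
    show "inj_on lb ((\<lambda>x. (\<lambda>x. 2 * x) ` orbit \<sigma> x) ` X)"
    proof (rule inj_onI)
      fix A B assume A: "A \<in> (\<lambda>x. (\<lambda>x. 2 * x) ` orbit \<sigma> x) ` X" and B: "B \<in> (\<lambda>x. (\<lambda>x. 2 * x) ` orbit \<sigma> x) ` X" and e: "lb A = lb B"
      obtain x where x: "x \<in> X" "A = (\<lambda>x. 2 * x) ` orbit \<sigma> x" using A by auto
      obtain y where y: "y \<in> X" "B = (\<lambda>x. 2 * x) ` orbit \<sigma> y" using B by auto
      have "c x = c y" using e lbP x y by simp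
      then show "A = B" using labelled_orbit_eq_iff[OF X x(1) y(1)] x y by simp
    qed
    show "lb ` (\<lambda>x. (\<lambda>x. 2 * x) ` orbit \<sigma> x) ` X = {..<n}"
      unfolding image_image cX[symmetric] using lbP by (intro image_cong) auto
  qed
  have labM: "bij_betw (label R) (neg_boundaries R) {..<1}"
    unfolding negb Rs using lbM by (auto simp: bij_betw_def)
  have step: "f2 (f1 (2 * x)) = 2 * \<gamma> x + 1" "f2 (f1 (2 * x + 1)) = 2 * \<sigma> x" if "x \<in> X" for x
    using that f1e f2e by simp_all
  \<comment> \<open>The inverse square of \<open>f0\<close> on positive half-edges is
    \<open>\<sigma> \<circ> \<gamma> = \<tau>\<close>. Its fixed point free square root of the
    identity is what forces vertices of degree 4: the orbit length divides 4 but not 2.\<close>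
  have g4: "((f2 \<circ> f1) ^^ 2) (2 * x) = 2 * \<tau> x" if "x \<in> X" for x
    using that step sX sg by (simp add: numeral_2_eq_2)
  have cO4: "card (orbit f0 (2 * x)) = 4" if x: "x \<in> X" for x
  proof -
    let ?f = "f2 \<circ> f1"
    note per = funpow_eq_iff_card_orbit_dvd(1)[OF finH f21, of 0 _ "2 * x", simplified]
    have "(?f ^^ 4) (2 * x) = (?f ^^ 2) ((?f ^^ 2) (2 * x))" using funpow_add[of 2 2 ?f] by simp
    then have "(?f ^^ 4) (2 * x) = 2 * x" using g4 sX tt x by simp
    then have d4: "card (orbit ?f (2 * x)) dvd 4" using per[of 4] by simp
    have "(?f ^^ 2) (2 * x) \<noteq> 2 * x" using g4 tt x by simp
    then have d2: "\<not> card (orbit ?f (2 * x)) dvd 2" using per[of 2] by simp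
    let ?c = "card (orbit ?f (2 * x))"
    have "?c \<le> 4" using d4 by (simp add: dvd_imp_le)
    then have "?c = 0 \<or> ?c = 1 \<or> ?c = 2 \<or> ?c = 3 \<or> ?c = 4" by linarith
    then have "?c = 4" using d4 d2 by (elim disjE) auto
    then show ?thesis unfolding f0_def by (simp add: orbit_inv_perm[OF finH f21])
  qed
  have all4: "card (orbit f0 y) = 4" if "y \<in> H" for y
  proof -
    from caseH[OF \<open>y \<in> H\<close>] obtain x where x: "x \<in> X" "y = 2 * x \<or> y = 2 * x + 1" by auto
    show ?thesis
    proof (cases "y = 2 * x")
      case True then show ?thesis using cO4 x by simp
    next
      case False
      then have y: "y = 2 * x + 1" using x by simp
      have "2 * \<sigma> x \<in> orbit (f2 \<circ> f1) y" using orbit.base[of "f2 \<circ> f1" y] step x y by simp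
      then have "orbit (f2 \<circ> f1) (2 * \<sigma> x) = orbit (f2 \<circ> f1) y" by (rule orbit_eq_orbit[OF finH f21])
      then show ?thesis using cO4[OF sX(1)[OF x(1)]] unfolding f0_def by (simp add: orbit_inv_perm[OF finH f21])
    qed
  qed
  have fourR: "four_valent R" unfolding four_valent_def vertices_def Rs using all4 by auto
  have gen: "(\<lambda>y. f (u y)) \<in> generated_group {s0 R, s1 R, s2 R}"
    if "u \<in> generated_group {s0 R, s1 R, s2 R}" "f \<in> {s0 R, s1 R, s2 R}" for f u
    using generated_group.gen[OF that(2,1)] by (simp add: o_def)
  have conn: "connected_ribbon R"
  proof -
    let ?G = "generated_group {s0 R, s1 R, s2 R}"
    have reach_orb: "\<exists>u\<in>?G. u y = z" if "z \<in> orbit f2 y" for y z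
      using that
    proof induction
      case base
      show ?case using gen[OF generated_group.one, of f2] by (auto simp: Rs)
    next
      case (step z)
      then obtain u where "u \<in> ?G" "u y = z" by auto
      then show ?case using gen[of u f2] by (intro bexI[of _ "\<lambda>y. f2 (u y)"]) (auto simp: Rs)
    qed
    \<comment> \<open>Everything is joined through the negative boundary: \<open>f1\<close> leads
      from positive half-edges into \<open>M\<close> and back, and \<open>f2\<close> is transitive
      on \<open>M\<close>.\<close>
    have "\<exists>u\<in>?G. u y = z" if y: "y \<in> H" and z: "z \<in> H" for y z
    proof -
      have "\<exists>u\<in>?G. u y \<in> M"
      proof (cases "y \<in> M")
        case True then show ?thesis using generated_group.one by (intro bexI[of _ id]) auto
      next
        case False
        then have "f1 y \<in> M" using caseH[OF y] f1e by (auto simp: M_def)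
        then show ?thesis using gen[OF generated_group.one, of f1] by (intro bexI[of _ "\<lambda>y. f1 (id y)"]) (auto simp: Rs)
      qed
      then obtain u where u: "u \<in> ?G" "u y \<in> M" by auto
      have to_M: "\<exists>v\<in>?G. v y = w" if w: "w \<in> M" for w
      proof -
        have "w \<in> orbit f2 (u y)" using u(2) w oM by (auto simp: M_def)
        then show ?thesis
        proof induction
          case base then show ?case using gen[OF u(1), of f2] by (intro bexI[of _ "\<lambda>y. f2 (u y)"]) (auto simp: Rs)
        next
          case (step w)
          then obtain v where "v \<in> ?G" "v y = w" by auto
          then show ?case using gen[of v f2] by (intro bexI[of _ "\<lambda>y. f2 (v y)"]) (auto simp: Rs)
        qed
      qed
      show ?thesis
      proof (cases "z \<in> M")
        case True then show ?thesis using to_M by simp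
      next
        case False
        then obtain x where x: "x \<in> X" "z = 2 * x" using z by (auto simp: H_def P_def)
        obtain v where v: "v \<in> ?G" "v y = 2 * x + 1" using to_M[of "2 * x + 1"] x by (auto simp: M_def)
        then show ?thesis using gen[OF v(1), of f1] f1e x by (intro bexI[of _ "\<lambda>y. f1 (v y)"]) (auto simp: Rs)
      qed
    qed
    then show ?thesis by (simp add: connected_ribbon_def Rs)
  qed
  have cardH: "card H = 2 * card X"
  proof -
    have "P \<inter> M = {}" unfolding P_def M_def by (auto, presburger)
    moreover have "card P = card X" "card M = card X" unfolding P_def M_def by (auto intro!: card_image simp: inj_on_def)
    ultimately show ?thesis using fX by (simp add: H_def card_Un_disjoint P_def M_def)
  qed
  have genus: "has_genus R g"
  proof -
    have V: "card H = 4 * card (vertices R)" unfolding vertices_def Rs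
      by (rule card_equal_orbits[OF finH f0p all4])
    have c2: "card (orbit f1 y) = 2" if "y \<in> H" for y
    proof -
      have f11: "f1 (f1 y) = y" "f1 y \<noteq> y" using rgR that by (auto simp: ribbon_graph_def Rs)
      have "orbit f1 y = {y, f1 y}"
      proof
        show "orbit f1 y \<subseteq> {y, f1 y}" by (rule orbit_least) (use f11 in auto)
        show "{y, f1 y} \<subseteq> orbit f1 y" using orbit_refl[OF finH f1p, of y] orbit.base[of f1 y] by simp
      qed
      then show ?thesis using f11 by simp
    qed
    have E: "card H = 2 * card (edges R)" unfolding edges_def Rs
      by (rule card_equal_orbits[OF finH f1p c2])
    have "boundaries R = pos_boundaries R \<union> neg_boundaries R"
    proof (intro equalityI subsetI)
      fix B assume "B \<in> boundaries R"
      then obtain y where y: "y \<in> H" "B = orbit f2 y" by (auto simp: boundaries_def Rs)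
      then show "B \<in> pos_boundaries R \<union> neg_boundaries R" unfolding posb negb using caseH[OF y(1)] oP oM by auto
    qed (auto simp: pos_boundaries_def neg_boundaries_def)
    moreover have "pos_boundaries R \<inter> neg_boundaries R = {}"
    proof -
      have "M \<notin> pos_boundaries R" using Xne by (auto simp: pos_boundaries_def Rs M_def)
      then show ?thesis using negb by auto
    qed
    moreover have "card (pos_boundaries R) = n" using bij_betw_same_card[OF labP] by simp
    ultimately have F: "card (boundaries R) = n + 1"
      using fX by (subst \<open>boundaries R = _\<close>, subst card_Un_disjoint) (auto simp: posb negb)
    show ?thesis unfolding has_genus_def using conn V E F N cardH by simp
  qed
  have one: "one_negative R g n"
    by standard (use rgR dR genus labP labM fourR in \<open>simp_all add: of_type_def\<close>)
  define h where "h = (\<lambda>x\<in>X. 2 * x)"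
  have bij: "bij_betw h X P" unfolding h_def P_def by (auto simp: bij_betw_def inj_on_def)
  have "h \<in> labelled_bijections X \<sigma> c (pos R) (bperm R) (blabel R)"
  proof -
    have "h (\<sigma> x) = bperm R (h x) \<and> blabel R (h x) = c x" if "x \<in> X" for x
      using that sX f2e oP lbP by (simp add: h_def bperm_def posR Rs blabel_def) (simp add: P_def)
    moreover have "h \<in> X \<rightarrow>\<^sub>E P" by (auto simp: h_def P_def)
    ultimately show ?thesis using bij by (simp add: labelled_bijections_def posR)
  qed
  moreover have "h (\<tau> x) = pairing R (h x)" if "x \<in> X" for x
  proof -
    have "2 * x \<in> P" using that by (simp add: P_def)
    then show ?thesis using that sX step sg by (simp add: h_def pairing_def posR Rs)
  qed
  ultimately have "realises X \<sigma> c R \<tau> h" by (simp add: realises_def)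
  then show ?thesis using one by blast
qed

section \<open>Boundary lengths and the volume of the space of metrics\<close>

context one_negative
begin

definition pos_half :: "'h set \<Rightarrow> 'h" where "pos_half e = inv_into P (orbit (s1 R)) e"
definition elabel :: "'h set \<Rightarrow> nat" where "elabel e = blabel R (pos_half e)"
text \<open>Every edge has exactly one positive side, and \<open>elabel\<close> names the boundary
  component there. The positive boundary lengths are thus sums over disjoint sets of edges.\<close>

definition side_sum :: "('h set \<Rightarrow> real) \<Rightarrow> nat \<Rightarrow> real" where
  "side_sum m i = (\<Sum>e | e \<in> edges R \<and> elabel e = i. m e)"

lemma finite_edges: "finite (edges R)" using rg(1) by (simp add: edges_def)

lemma elabel_orbit: "y \<in> P \<Longrightarrow> elabel (orbit (s1 R) y) = blabel R y"
  by (simp add: elabel_def pos_half_def bij_betw_inv_into_left[OF edges_bij])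

lemma blabel_image: "blabel R ` P = {..<n}"
  using labelled_pos by (simp add: labelled_def length_sizes)

lemma edge_ex: assumes "e \<in> edges R" obtains y where "y \<in> P" "e = orbit (s1 R) y"
proof -
  have "e \<in> orbit (s1 R) ` P" using assms edges_bij by (simp add: bij_betw_def)
  then show ?thesis using that by auto
qed

lemma edges_labelled_bij:
  "bij_betw (orbit (s1 R)) {y \<in> P. blabel R y = i} {e \<in> edges R. elabel e = i}"
proof (rule bij_betw_subset[OF edges_bij])
  show "orbit (s1 R) ` {y \<in> P. blabel R y = i} = {e \<in> edges R. elabel e = i}"
  proof (intro equalityI subsetI)
    fix e assume "e \<in> {e \<in> edges R. elabel e = i}"
    then have e: "e \<in> edges R" "elabel e = i" by auto
    from e(1) obtain y where "y \<in> P" "e = orbit (s1 R) y" by (rule edge_ex)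
    then show "e \<in> orbit (s1 R) ` {y \<in> P. blabel R y = i}" using elabel_orbit e by auto
  qed (use bij_betw_apply[OF edges_bij] elabel_orbit in auto)
qed auto

lemma elabel_less: "e \<in> edges R \<Longrightarrow> elabel e < n"
  by (erule edge_ex) (use elabel_orbit blabel_image in auto)

lemma card_elabel: "i < n \<Longrightarrow> card {e \<in> edges R. elabel e = i} = sizes n R ! i"
  using bij_betw_same_card[OF edges_labelled_bij[of i]] by (simp add: sizes_def)

lemma boundary_length_pos:
  assumes "\<beta> \<in> pos_boundaries R" shows "boundary_length R m \<beta> = side_sum m (label R \<beta>)"
proof -
  obtain x where x: "x \<in> P" "\<beta> = orbit (s2 R) x" using assms by (auto simp: pos_boundaries_eq)
  have l: "label R \<beta> = blabel R x" using x by (simp add: blabel_def)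
  have "y \<in> H \<and> orbit (s2 R) y = \<beta> \<longleftrightarrow> y \<in> P \<and> blabel R y = blabel R x" for y
  proof
    assume y: "y \<in> H \<and> orbit (s2 R) y = \<beta>"
    then have "y \<in> orbit (s2 R) x" using x orbit_refl[OF rg(1,4), of y] by simp
    then show "y \<in> P \<and> blabel R y = blabel R x" using orbit_s2_P[OF x(1)] y x by (auto simp: blabel_def)
  next
    assume y: "y \<in> P \<and> blabel R y = blabel R x"
    then have "orbit (s2 R) y = orbit (s2 R) x"
      using labelled_orbit_eq_iff[OF labelled_pos, of y x] x orbit_bperm by simp
    then show "y \<in> H \<and> orbit (s2 R) y = \<beta>" using y x H_split by auto
  qed
  then have "boundary_length R m \<beta> = (\<Sum>y | y \<in> P \<and> blabel R y = blabel R x. m (orbit (s1 R) y))"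
    unfolding boundary_length_def by simp
  also have "\<dots> = side_sum m (blabel R x)"
    unfolding side_sum_def using sum.reindex_bij_betw[OF edges_labelled_bij, of m] by simp
  finally show ?thesis by (simp add: l)
qed

text \<open>Every edge has exactly one negative side, and all of these lie on the same boundary
  component; its length is the total length of all edges.\<close>

lemma boundary_length_neg:
  assumes "\<beta> \<in> neg_boundaries R" shows "boundary_length R m \<beta> = (\<Sum>i<n. side_sum m i)"
proof -
  obtain x where x: "x \<in> M" "\<beta> = orbit (s2 R) x" using assms by (auto simp: neg_boundaries_eq)
  have b: "\<beta> = M" using x orbit_M by simp
  have "y \<in> H \<and> orbit (s2 R) y = \<beta> \<longleftrightarrow> y \<in> M" for y
    using orbit_M[of y] orbit_refl[OF rg(1,4), of y] H_split(4) b by auto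
  then have "boundary_length R m \<beta> = (\<Sum>y\<in>M. m (orbit (s1 R) y))" unfolding boundary_length_def by simp
  also have "\<dots> = (\<Sum>y\<in>P. m (orbit (s1 R) (s1 R y)))"
    by (rule sum.reindex_bij_witness[of _ "s1 R" "s1 R"]) (use s1_swap rg(5) H_split in auto)
  also have "\<dots> = (\<Sum>y\<in>P. m (orbit (s1 R) y))"
  proof (rule sum.cong)
    fix y assume "y \<in> P"
    then have y: "y \<in> H" using H_split by auto
    show "m (orbit (s1 R) (s1 R y)) = m (orbit (s1 R) y)"
      using orbit_s1[OF y] orbit_s1[OF in_H(2)[OF y]] rg(5)[OF y] by (simp add: insert_commute)
  qed simp
  also have "\<dots> = (\<Sum>e\<in>edges R. m e)" by (rule sum.reindex_bij_betw[OF edges_bij])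
  also have "\<dots> = (\<Sum>i<n. side_sum m i)" unfolding side_sum_def
    using sum.group[OF finite_edges, of "{..<n}" elabel m] elabel_less by (simp add: image_subset_iff)
  finally show ?thesis .
qed

lemma pos_label: "i < n \<longleftrightarrow> (\<exists>\<beta>\<in>pos_boundaries R. label R \<beta> = i)"
proof -
  have "label R ` pos_boundaries R = {..<n}" using label_bij(1) by (simp add: pos_boundaries_eq bij_betw_def)
  then have "i < n \<longleftrightarrow> i \<in> label R ` pos_boundaries R" by simp
  then show ?thesis by (simp add: image_iff eq_commute)
qed

lemma boundaries_split: "boundaries R = pos_boundaries R \<union> neg_boundaries R"
  unfolding pos_boundaries_eq neg_boundaries_eq boundaries_def image_Un[symmetric] H_split(1)[symmetric] ..

lemma length_kernel_iff: "m \<in> length_kernel R \<longleftrightarrow> m \<in> edge_space R \<and> (\<forall>i<n. side_sum m i = 0)"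
proof
  assume m: "m \<in> length_kernel R"
  have "side_sum m i = 0" if "i < n" for i
    using m that pos_label boundary_length_pos[of _ m] boundaries_split by (auto simp: length_kernel_def)
  then show "m \<in> edge_space R \<and> (\<forall>i<n. side_sum m i = 0)" using m by (simp add: length_kernel_def)
next
  assume m: "m \<in> edge_space R \<and> (\<forall>i<n. side_sum m i = 0)"
  then show "m \<in> length_kernel R"
    using pos_label boundary_length_pos[of _ m] boundary_length_neg[of _ m]
    by (auto simp: length_kernel_def boundaries_split)
qed

lemma Met_iff:
  assumes L: "length L = n"
  shows "m \<in> Met R L [sum_list L] \<longleftrightarrow> m \<in> edge_space R \<and> (\<forall>e\<in>edges R. m e > 0) \<and> (\<forall>i<n. side_sum m i = L ! i)"
proof -
  have 1: "(\<forall>\<beta>\<in>pos_boundaries R. boundary_length R m \<beta> = L ! label R \<beta>) \<longleftrightarrow> (\<forall>i<n. side_sum m i = L ! i)"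
    using pos_label boundary_length_pos[of _ m] by auto
  have 2: "boundary_length R m \<beta> = [sum_list L] ! label R \<beta>" if "\<beta> \<in> neg_boundaries R" "\<forall>i<n. side_sum m i = L ! i" for \<beta>
  proof -
    have "label R \<beta> = 0" using that(1) label_M by (auto simp: neg_boundaries_eq)
    then show ?thesis using boundary_length_neg[OF that(1), of m] that(2) L
      by (simp add: sum_list_sum_nth atLeast0LessThan)
  qed
  show ?thesis using 1 2 by (auto simp: Met_def)
qed

text \<open>Leave out one edge \<open>\<epsilon> i\<close> beside each positive boundary component;
  the lengths of the others are free coordinates. The omitted length is the slack in the bound
  \<open>L ! i\<close>, so its positivity is the strict simplex inequality, and
  \<open>sizes n R ! i - 1\<close> coordinates remain for the label \<open>i\<close>.\<close>

theorem kernel_volume_Met: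
  assumes L: "length L = n" "\<And>i. i < n \<Longrightarrow> L ! i > 0"
  shows "kernel_volume R (Met R L [sum_list L]) =
    (\<Prod>i<n. (L ! i) ^ (sizes n R ! i - 1) / fact (sizes n R ! i - 1))"
proof -
  have "\<exists>y. y \<in> P \<and> blabel R y = i" if "i < n" for i
  proof -
    have "i \<in> blabel R ` P" using that blabel_image by simp
    then show ?thesis by auto
  qed
  then obtain a where a: "\<And>i. i < n \<Longrightarrow> a i \<in> P \<and> blabel R (a i) = i" by metis
  define \<epsilon> where "\<epsilon> i = orbit (s1 R) (a i)" for i
  have \<epsilon>: "\<epsilon> i \<in> edges R" "elabel (\<epsilon> i) = i" if "i < n" for i
    using a[OF that] elabel_orbit H_split by (auto simp: \<epsilon>_def edges_def)
  define I where "I = edges R - \<epsilon> ` {..<n}"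
  have finI: "finite I" using finite_edges by (simp add: I_def)
  have split: "{e \<in> edges R. elabel e = i} = insert (\<epsilon> i) {e \<in> I. elabel e = i}" "\<epsilon> i \<notin> I" if "i < n" for i
    using \<epsilon> that by (auto simp: I_def)
  have side: "side_sum m i = m (\<epsilon> i) + (\<Sum>e | e \<in> I \<and> elabel e = i. m e)" if "i < n" for m i
    unfolding side_sum_def using split[OF that] finI by simp
  have edge_cases: "e \<in> I \<or> (\<exists>i<n. e = \<epsilon> i) \<or> e \<notin> edges R" for e by (auto simp: I_def)
  interpret kernel_coordinates R I
  proof
    show "finite I" by (rule finI)
    show "bij_betw (\<lambda>m. restrict m I) (length_kernel R) (I \<rightarrow>\<^sub>E UNIV)"
      unfolding bij_betw_def
    proof
      show "inj_on (\<lambda>m. restrict m I) (length_kernel R)"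
      proof (rule inj_onI)
        fix m m' assume m: "m \<in> length_kernel R" "m' \<in> length_kernel R" and eq: "restrict m I = restrict m' I"
        have e: "m e = m' e" if "e \<in> I" for e using fun_cong[OF eq, of e] that by simp
        have s: "(\<Sum>e | e \<in> I \<and> elabel e = i. m e) = (\<Sum>e | e \<in> I \<and> elabel e = i. m' e)" for i
          using e by (intro sum.cong) auto
        have "m (\<epsilon> i) = m' (\<epsilon> i)" if "i < n" for i
        proof -
          have "side_sum m i = 0" "side_sum m' i = 0" using m that by (auto simp: length_kernel_iff)
          then show ?thesis using side[OF that, of m] side[OF that, of m'] s[of i] by simp
        qed
        moreover have "m e = m' e" if "e \<notin> edges R" for e using m that by (simp add: length_kernel_iff edge_space_def)
        ultimately show "m = m'" using e edge_cases by (metis ext)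
      qed
      show "(\<lambda>m. restrict m I) ` length_kernel R = I \<rightarrow>\<^sub>E UNIV"
      proof (intro equalityI subsetI)
        fix v :: "'h set \<Rightarrow> real" assume v: "v \<in> I \<rightarrow>\<^sub>E UNIV"
        define m where "m e = (if e \<in> I then v e else if e \<in> edges R then - (\<Sum>e' | e' \<in> I \<and> elabel e' = elabel e. v e') else 0)" for e
        have "side_sum m i = 0" if "i < n" for i
        proof -
          have "(\<Sum>e | e \<in> I \<and> elabel e = i. m e) = (\<Sum>e | e \<in> I \<and> elabel e = i. v e)"
            by (intro sum.cong) (auto simp: m_def)
          then show ?thesis using side[OF that, of m] \<epsilon>[OF that] split(2)[OF that] by (simp add: m_def)
        qed
        moreover have "m \<in> edge_space R" by (auto simp: edge_space_def m_def I_def)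
        ultimately have "m \<in> length_kernel R" by (simp add: length_kernel_iff)
        moreover have "restrict m I = v" using v by (auto simp: m_def fun_eq_iff PiE_def extensional_def)
        ultimately show "v \<in> (\<lambda>m. restrict m I) ` length_kernel R" by auto
      qed auto
    qed
    fix m e assume m: "m \<in> length_kernel R" and int: "\<And>e. e \<in> I \<Longrightarrow> m e \<in> \<int>"
    consider "e \<in> I" | i where "i < n" "e = \<epsilon> i" | "e \<notin> edges R" using edge_cases by blast
    then show "m e \<in> \<int>"
    proof cases
      case 2
      have "side_sum m i = 0" using m 2 by (simp add: length_kernel_iff)
      then have "m e = - (\<Sum>e | e \<in> I \<and> elabel e = i. m e)" using side[OF 2(1), of m] 2 by simp
      also have "\<dots> \<in> \<int>" using int by (intro Ints_minus Ints_sum) auto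
      finally show ?thesis .
    next
      case 3 then show ?thesis using m by (simp add: length_kernel_iff edge_space_def)
    qed (rule int)
  qed
  define Q where "Q = simplices I elabel {..<n} ((!) L)"
  have ek: "elabel ` I \<subseteq> {..<n}" using elabel_less by (auto simp: I_def)
  have spos: "sizes n R ! i > 0" if "i < n" for i
    using sizes_pos length_sizes that by (metis gr0I nth_mem)
  \<comment> \<open>Distributing each \<open>L ! i\<close> equally over its edges gives a metric, so
    the origin chosen in \<open>kernel_volume\<close> is a point of \<open>Met\<close>.\<close>
  define m0 where "m0 e = (if e \<in> edges R then L ! elabel e / real (sizes n R ! elabel e) else 0)" for e
  have "side_sum m0 i = L ! i" if "i < n" for i
  proof -
    have "side_sum m0 i = (\<Sum>e | e \<in> edges R \<and> elabel e = i. L ! i / real (sizes n R ! i))"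
      unfolding side_sum_def by (intro sum.cong) (auto simp: m0_def)
    then show ?thesis using card_elabel[OF that] spos[OF that] by simp
  qed
  moreover have "m0 e > 0" if "e \<in> edges R" for e
    using elabel_less[OF that] L(2) spos that by (simp add: m0_def)
  moreover have "m0 \<in> edge_space R" by (simp add: m0_def edge_space_def)
  ultimately have "m0 \<in> Met R L [sum_list L]" by (simp add: Met_iff[OF L(1)])
  then have ne: "Met R L [sum_list L] \<noteq> {}" by auto
  have "kernel_volume R (Met R L [sum_list L]) = measure (lebesgue_on_funs I) Q"
  proof (rule kernel_volume_eq[OF ne])
    show "Q \<in> sets (lebesgue_on_funs I)" unfolding Q_def by (rule sets_simplices[OF finI]) simp
    fix p m assume p: "p \<in> Met R L [sum_list L]" and m: "m \<in> length_kernel R"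
    let ?q = "\<lambda>e. p e + m e"
    have es: "?q \<in> edge_space R" using p m by (simp add: Met_iff[OF L(1)] length_kernel_iff edge_space_def)
    have ss: "side_sum ?q i = L ! i" if "i < n" for i
      using p m that by (simp add: Met_iff[OF L(1)] length_kernel_iff side_sum_def sum.distrib)
    have qe: "?q (\<epsilon> i) = L ! i - (\<Sum>e | e \<in> I \<and> elabel e = i. ?q e)" if "i < n" for i
      using side[OF that, of ?q] ss[OF that] by simp
    have "?q \<in> Met R L [sum_list L] \<longleftrightarrow> (\<forall>e\<in>edges R. ?q e > 0)"
      using es ss by (simp add: Met_iff[OF L(1)])
    also have "\<dots> \<longleftrightarrow> (\<forall>e\<in>I. ?q e > 0) \<and> (\<forall>i<n. ?q (\<epsilon> i) > 0)"
      using \<epsilon>(1) edge_cases by (auto simp: I_def)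
    also have "\<dots> \<longleftrightarrow> (\<forall>e\<in>I. ?q e > 0) \<and> (\<forall>i<n. (\<Sum>e | e \<in> I \<and> elabel e = i. ?q e) < L ! i)"
      using qe by auto
    also have "\<dots> \<longleftrightarrow> (\<lambda>e\<in>I. ?q e) \<in> Q"
    proof -
      have "(\<Sum>e | e \<in> I \<and> elabel e = i. (\<lambda>e\<in>I. ?q e) e) = (\<Sum>e | e \<in> I \<and> elabel e = i. ?q e)" for i
        by (intro sum.cong) auto
      then show ?thesis by (auto simp: Q_def simplices_def)
    qed
    finally show "?q \<in> Met R L [sum_list L] \<longleftrightarrow> (\<lambda>e\<in>I. ?q e) \<in> Q" .
  qed
  also have "\<dots> = (\<Prod>i<n. (L ! i) ^ card {e \<in> I. elabel e = i} / fact (card {e \<in> I. elabel e = i}))"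
  proof -
    have "(\<Prod>i<n. (L ! i) ^ card {e \<in> I. elabel e = i} / fact (card {e \<in> I. elabel e = i})) \<ge> 0"
      using L(2) by (intro prod_nonneg) (auto intro!: divide_nonneg_nonneg zero_le_power less_imp_le)
    then show ?thesis
      unfolding measure_def Q_def using emeasure_simplices[OF finI _ ek, of "(!) L"] L(2) by simp
  qed
  also have "\<dots> = (\<Prod>i<n. (L ! i) ^ (sizes n R ! i - 1) / fact (sizes n R ! i - 1))"
  proof (rule prod.cong)
    fix i assume "i \<in> {..<n}"
    then have i: "i < n" by simp
    have "sizes n R ! i = Suc (card {e \<in> I. elabel e = i})"
      unfolding card_elabel[OF i, symmetric] split(1)[OF i] using split(2)[OF i] finI by simp
    then show "(L ! i) ^ card {e \<in> I. elabel e = i} / fact (card {e \<in> I. elabel e = i}) =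
      (L ! i) ^ (sizes n R ! i - 1) / fact (sizes n R ! i - 1)" by simp
  qed simp
  finally show ?thesis .
qed

end

section \<open>From the sum over isomorphism classes to a sum over gluings\<close>

definition iso_rel :: "nat \<Rightarrow> nat \<Rightarrow> (nat directed_ribbon_graph \<times> nat directed_ribbon_graph) set" where
  "iso_rel g n = {(R, S). R \<in> four_valent_graphs g n 1 \<and> S \<in> four_valent_graphs g n 1 \<and> (\<exists>\<phi>. is_iso \<phi> R S)}"

lemma four_valent_graphs_iff: "R \<in> four_valent_graphs g n 1 \<longleftrightarrow> one_negative R g n"
  by (auto simp: four_valent_graphs_def one_negative_def)

lemma iso_rel_iff:
  "(R, S) \<in> iso_rel g n \<longleftrightarrow> one_negative R g n \<and> one_negative S g n \<and> (\<exists>\<phi>. is_iso \<phi> R S)"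
  unfolding iso_rel_def by (simp only: mem_Collect_eq case_prod_conv four_valent_graphs_iff)

lemma equiv_iso_rel: "equiv (four_valent_graphs g n 1) (iso_rel g n)"
proof (rule equivI)
  have rg: "ribbon_graph R" if "R \<in> four_valent_graphs g n 1" for R
    using that by (simp add: four_valent_graphs_def of_type_def)
  show "iso_rel g n \<subseteq> four_valent_graphs g n 1 \<times> four_valent_graphs g n 1" by (auto simp: iso_rel_def)
  show "refl_on (four_valent_graphs g n 1) (iso_rel g n)"
    using is_iso_refl by (auto simp: refl_on_def iso_rel_def)
  show "sym (iso_rel g n)" unfolding sym_def iso_rel_def using is_iso_sym rg by blast
  show "trans (iso_rel g n)" unfolding trans_def iso_rel_def using is_iso_trans rg by blast
qed

lemma finite_lists_sum: "finite {ks :: nat list. length ks = n \<and> sum_list ks = N}"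
proof (rule finite_subset)
  show "{ks. length ks = n \<and> sum_list ks = N} \<subseteq> {ks. set ks \<subseteq> {..N} \<and> length ks = n}"
    using member_le_sum_list by auto
qed (rule finite_lists_length_eq, simp)

text \<open>Fix one model permutation for every composition \<open>ks\<close> and let
  \<open>D\<close> be the set of all pairs of a composition and a gluing of its model. By orbit
  counting a class is hit by \<open>prod_list ks / card (Aut R)\<close> pairs. Giving each pair the
  volume divided by \<open>prod_list ks\<close> therefore makes the sum over \<open>D\<close> equal
  to \<open>V\<close>.\<close>

theorem V_eq_sum_gl:
  assumes n: "n \<ge> 1" and L: "length L = n" "\<And>i. i < n \<Longrightarrow> L ! i > 0"
  shows "V g n 1 L [sum_list L] =
    (\<Sum>ks | length ks = n \<and> sum_list ks = 2 * (2 * g + n - 1).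
       real (gl (mset ks)) * (\<Prod>i<n. (L ! i) ^ (ks ! i - 1) / fact (ks ! i)))"
proof -
  define N where "N = 2 * (2 * g + n - 1)"
  have Ni: "int N = 2 * (2 * int g - 1 + int n)" using n by (simp add: N_def)
  define FV where "FV = (four_valent_graphs g n 1 :: nat directed_ribbon_graph set)"
  have FV: "R \<in> FV \<longleftrightarrow> one_negative R g n" for R unfolding FV_def by (rule four_valent_graphs_iff)
  have eq: "equiv FV (iso_rel g n)" unfolding FV_def by (rule equiv_iso_rel)
  define KS where "KS = {ks :: nat list. length ks = n \<and> sum_list ks = N}"
  define KS0 where "KS0 = {ks \<in> KS. 0 \<notin> set ks}"
  have finKS: "finite KS" unfolding KS_def by (rule finite_lists_sum)
  have finKS0: "finite KS0" using finKS by (simp add: KS0_def)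
  have "\<forall>ks. \<exists>(X :: nat set) \<sigma> c. 0 \<notin> set ks \<longrightarrow> labelled X \<sigma> c ks" using ex_labelled by blast
  then obtain X :: "nat list \<Rightarrow> nat set" and \<sigma> c where can: "\<And>ks. 0 \<notin> set ks \<Longrightarrow> labelled (X ks) (\<sigma> ks) (c ks) ks"
    by metis
  define G where "G ks = gluings (X ks) (\<sigma> ks)" for ks
  define D where "D = Sigma KS0 G"
  have lab: "labelled (X ks) (\<sigma> ks) (c ks) ks" if "ks \<in> KS0" for ks using can that by (simp add: KS0_def)
  have perm: "finite (X ks)" "\<sigma> ks permutes X ks" if "ks \<in> KS0" for ks using lab[OF that] by (auto simp: labelled_def)
  have finG: "finite (G ks)" if "ks \<in> KS0" for ks using finite_gluings perm[OF that] by (simp add: G_def)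
  have finD: "finite D" unfolding D_def using finKS0 finG by (rule finite_SigmaI)
  have tperm: "\<tau> permutes X ks" if "\<tau> \<in> G ks" for \<tau> ks using that by (simp add: G_def gluings_def)
  have cardX: "card (X ks) = N" if "ks \<in> KS0" for ks
    using sum_orbit_sizes[OF perm[OF that]] labelled_orbit_sizes[OF lab[OF that]] that
    by (simp add: KS0_def KS_def sum_mset_sum_list)
  have "\<exists>R \<in> FV. \<exists>h. realises (X (fst d)) (\<sigma> (fst d)) (c (fst d)) R (snd d) h" if "d \<in> D" for d
  proof -
    have d: "fst d \<in> KS0" "snd d \<in> gluings (X (fst d)) (\<sigma> (fst d))" using that by (auto simp: D_def G_def)
    have "length (fst d) = n" using d by (simp add: KS0_def KS_def)
    from ex_realisation[OF lab[OF d(1)] d(2) this n] show ?thesis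
      using cardX[OF d(1)] Ni FV by metis
  qed
  then obtain Rep where Rep: "\<And>d. d \<in> D \<Longrightarrow> Rep d \<in> FV"
    "\<And>d. d \<in> D \<Longrightarrow> \<exists>h. realises (X (fst d)) (\<sigma> (fst d)) (c (fst d)) (Rep d) (snd d) h" by metis
  define F where "F d = iso_rel g n `` {Rep d}" for d
  define rep where "rep C = (SOME R. R \<in> C)" for C :: "nat directed_ribbon_graph set"
  have rep: "rep C \<in> FV" "C = iso_rel g n `` {rep C}" if C: "C \<in> FV // iso_rel g n" for C
  proof -
    have "rep C \<in> C" using in_quotient_imp_non_empty[OF eq C] by (simp add: rep_def some_in_eq)
    then show "rep C \<in> FV" "C = iso_rel g n `` {rep C}"
      using in_quotient_imp_subset[OF eq C] Image_singleton_iff quotient_eq_iff[OF eq C] 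
        equiv_class_eq_iff[OF eq] C by (auto elim!: quotientE intro: equiv_class_eq[OF eq] dest: equivE)
  qed
  define fib where "fib R = {\<tau> \<in> G (sizes n R). \<exists>h. realises (X (sizes n R)) (\<sigma> (sizes n R)) (c (sizes n R)) R \<tau> h}" for R :: "nat directed_ribbon_graph"
  have szKS: "sizes n R \<in> KS0" if "R \<in> FV" for R
  proof -
    interpret one_negative R g n using that FV by simp
    have "int (card (pos R)) = int N" using card_pos Ni by simp
    then show ?thesis using sum_sizes length_sizes sizes_pos by (simp add: KS0_def KS_def)
  qed
  \<comment> \<open>The composition is recovered from the graph as its boundary sizes, and
    isomorphic graphs realise the same gluings.\<close>
  have fibre: "{d \<in> D. F d = iso_rel g n `` {R}} = {sizes n R} \<times> fib R" if R: "R \<in> FV" for R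
  proof (intro equalityI subsetI)
    fix d assume "d \<in> {d \<in> D. F d = iso_rel g n `` {R}}"
    then have d: "d \<in> D" "iso_rel g n `` {Rep d} = iso_rel g n `` {R}" by (auto simp: F_def)
    obtain ks \<tau> where kt: "d = (ks, \<tau>)" by (cases d)
    have ks: "ks \<in> KS0" "\<tau> \<in> G ks" using d(1) kt by (auto simp: D_def)
    obtain h where h: "realises (X ks) (\<sigma> ks) (c ks) (Rep d) \<tau> h" using Rep(2)[OF d(1)] kt by auto
    have "(Rep d, R) \<in> iso_rel g n" using eq_equiv_class[OF d(2) eq R] .
    then obtain \<phi> where \<phi>: "is_iso \<phi> (Rep d) R" by (auto simp: iso_rel_iff)
    have o: "one_negative (Rep d) g n" "one_negative R g n" using Rep(1)[OF d(1)] R FV by auto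
    have r: "realises (X ks) (\<sigma> ks) (c ks) R \<tau> (\<lambda>x\<in>X ks. \<phi> (h x))"
      by (rule realises_iso[OF o perm(2)[OF ks(1)] tperm[OF ks(2)] h \<phi>])
    have "ks = sizes n R"
      by (rule labelled_bijections_sizes[OF _ lab[OF ks(1)] one_negative.labelled_pos[OF o(2)]])
         (use r in \<open>auto simp: realises_def\<close>)
    then show "d \<in> {sizes n R} \<times> fib R" using r ks kt by (auto simp: fib_def)
  next
    fix d assume "d \<in> {sizes n R} \<times> fib R"
    then obtain \<tau> where d: "d = (sizes n R, \<tau>)" "\<tau> \<in> fib R" by auto
    have t: "\<tau> \<in> G (sizes n R)" using d by (simp add: fib_def)
    have dD: "d \<in> D" using d t szKS[OF R] by (simp add: D_def)
    obtain h where h: "realises (X (sizes n R)) (\<sigma> (sizes n R)) (c (sizes n R)) R \<tau> h" using d by (auto simp: fib_def)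
    obtain k where k: "realises (X (sizes n R)) (\<sigma> (sizes n R)) (c (sizes n R)) (Rep d) \<tau> k" using Rep(2)[OF dD] d by auto
    have o: "one_negative (Rep d) g n" "one_negative R g n" using Rep(1)[OF dD] R FV by auto
    from realises_unique_iso[OF o perm(2)[OF szKS[OF R]] tperm[OF t] k h]
    obtain \<phi> where "is_iso \<phi> (Rep d) R" by metis
    then have "(Rep d, R) \<in> iso_rel g n" using o by (auto simp: iso_rel_iff)
    then show "d \<in> {d \<in> D. F d = iso_rel g n `` {R}}"
      using dD equiv_class_eq[OF eq] by (simp add: F_def)
  qed
  have fibcard: "card (fib R) * card (Aut R) = prod_list (sizes n R)" if "R \<in> FV" for R
    unfolding fib_def G_def using card_realisable_gluings[of R g n] FV that lab[OF szKS[OF that]] by simp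
  have plpos: "prod_list ks > 0" if "ks \<in> KS0" for ks :: "nat list"
    using that by (simp add: KS0_def prod_list_zero_iff gr0_conv_Suc[symmetric] neq0_conv[symmetric] del: neq0_conv)
  \<comment> \<open>Orbit counting gives every class a nonempty fibre. As \<open>D\<close> is
    finite, there are only finitely many classes, so the sum defining \<open>V\<close> is a genuine
    one.\<close>
  have FD: "F ` D = FV // iso_rel g n"
  proof (intro equalityI subsetI)
    fix C assume "C \<in> F ` D"
    then show "C \<in> FV // iso_rel g n" using Rep(1) by (auto simp: F_def intro: quotientI)
  next
    fix C assume C: "C \<in> FV // iso_rel g n"
    have "card (fib (rep C)) \<noteq> 0" using fibcard[OF rep(1)[OF C]] plpos[OF szKS[OF rep(1)[OF C]]] by (metis mult_0 less_irrefl)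
    then have "fib (rep C) \<noteq> {}" by auto
    then have "{d \<in> D. F d = C} \<noteq> {}" using fibre[OF rep(1)[OF C]] rep(2)[OF C] by auto
    then show "C \<in> F ` D" by auto
  qed
  \<comment> \<open>The volume has \<open>(ks ! i - 1)!\<close> in the denominator; dividing by the
    additional factor \<open>ks ! i\<close> produces \<open>(ks ! i)!\<close>.\<close>
  define v where "v ks = (\<Prod>i<n. (L ! i) ^ (ks ! i - 1) / fact (ks ! i))" for ks :: "nat list"
  have vw: "v ks * real (prod_list ks) = (\<Prod>i<n. (L ! i) ^ (ks ! i - 1) / fact (ks ! i - 1))" if "ks \<in> KS0" for ks
  proof -
    have len: "length ks = n" using that by (simp add: KS0_def KS_def)
    have "real (prod_list ks) = (\<Prod>i<n. real (ks ! i))"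
      using len by (simp add: prod.list_conv_set_nth atLeast0LessThan)
    then have "v ks * real (prod_list ks) = (\<Prod>i<n. (L ! i) ^ (ks ! i - 1) / fact (ks ! i) * real (ks ! i))"
      by (simp only: v_def prod.distrib)
    also have "\<dots> = (\<Prod>i<n. (L ! i) ^ (ks ! i - 1) / fact (ks ! i - 1))"
    proof (rule prod.cong)
      fix i assume "i \<in> {..<n}"
      then have "ks ! i \<noteq> 0" using that len by (metis (mono_tags, lifting) KS0_def lessThan_iff mem_Collect_eq nth_mem)
      then obtain k where "ks ! i = Suc k" by (metis not0_implies_Suc)
      then show "(L ! i) ^ (ks ! i - 1) / fact (ks ! i) * real (ks ! i) = (L ! i) ^ (ks ! i - 1) / fact (ks ! i - 1)"
        by (simp add: field_simps del: of_nat_Suc)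
    qed simp
    finally show ?thesis .
  qed
  have "V g n 1 L [sum_list L] = (\<Sum>C\<in>FV // iso_rel g n.
      1 / real (card (Aut (rep C))) * kernel_volume (rep C) (Met (rep C) L [sum_list L]))"
    by (simp add: V_def iso_classes_def FV_def iso_rel_def rep_def Let_def)
  also have "\<dots> = (\<Sum>C\<in>FV // iso_rel g n. \<Sum>d | d \<in> D \<and> F d = C. v (fst d))"
  proof (rule sum.cong)
    fix C assume C: "C \<in> FV // iso_rel g n"
    let ?R = "rep C"
    have R: "?R \<in> FV" by (rule rep(1)[OF C])
    have A: "real (card (fib ?R)) * real (card (Aut ?R)) = real (prod_list (sizes n ?R))"
      using fibcard[OF R] by (metis of_nat_mult)
    have "real (prod_list (sizes n ?R)) > 0" using plpos[OF szKS[OF R]] by simp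
    then have A0: "real (card (Aut ?R)) \<noteq> 0" using A by (metis mult_zero_right less_irrefl)
    have "(\<Sum>d | d \<in> D \<and> F d = C. v (fst d)) = (\<Sum>d\<in>{sizes n ?R} \<times> fib ?R. v (fst d))"
      using fibre[OF R] rep(2)[OF C] by simp
    also have "\<dots> = (\<Sum>d\<in>{sizes n ?R} \<times> fib ?R. v (sizes n ?R))" by (intro sum.cong) auto
    also have "\<dots> = real (card (fib ?R)) * v (sizes n ?R)" by (simp add: card_cartesian_product)
    also have "\<dots> = 1 / real (card (Aut ?R)) * (v (sizes n ?R) * real (prod_list (sizes n ?R)))"
      using A0 by (simp add: A[symmetric])
    also have "v (sizes n ?R) * real (prod_list (sizes n ?R)) = kernel_volume ?R (Met ?R L [sum_list L])"
      using vw[OF szKS[OF R]] one_negative.kernel_volume_Met[of ?R g n, OF _ L] R FV by simp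
    finally show "1 / real (card (Aut ?R)) * kernel_volume ?R (Met ?R L [sum_list L]) = (\<Sum>d | d \<in> D \<and> F d = C. v (fst d))"
      by simp
  qed simp
  also have "\<dots> = (\<Sum>d\<in>D. v (fst d))" unfolding FD[symmetric] by (rule sum.image_gen[OF finD, symmetric])
  also have "\<dots> = (\<Sum>ks\<in>KS0. \<Sum>\<tau>\<in>G ks. v ks)"
    unfolding D_def using finKS0 finG by (subst sum.Sigma) (auto intro!: sum.cong)
  also have "\<dots> = (\<Sum>ks\<in>KS0. real (gl (mset ks)) * v ks)"
    using card_gluings_eq_gl[OF perm] labelled_orbit_sizes[OF lab] by (intro sum.cong) (auto simp: G_def)
  also have "\<dots> = (\<Sum>ks\<in>KS. real (gl (mset ks)) * v ks)"
    by (rule sum.mono_neutral_left) (use finKS gl_zero in \<open>auto simp: KS0_def\<close>)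
  finally show ?thesis by (simp add: KS_def N_def v_def)
qed

section \<open>The recursion for the volume polynomials\<close>

definition del :: "nat \<Rightarrow> 'a list \<Rightarrow> 'a list" where
  "del i xs = take i xs @ drop (Suc i) xs"

definition ins :: "nat \<Rightarrow> 'a \<Rightarrow> 'a list \<Rightarrow> 'a list" where
  "ins i x xs = take i xs @ x # drop i xs"

lemma length_del: "i < length xs \<Longrightarrow> length (del i xs) = length xs - 1"
  by (simp add: del_def)

lemma length_ins: "length (ins i x xs) = Suc (length xs)"
  by (simp add: ins_def)

lemma ins_del: "i < length xs \<Longrightarrow> ins i (xs ! i) (del i xs) = xs"
  by (simp add: ins_def del_def id_take_nth_drop[symmetric])

lemma del_ins: "i \<le> length xs \<Longrightarrow> del i (ins i x xs) = xs"
  by (simp add: ins_def del_def)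

lemma nth_ins: "i \<le> length xs \<Longrightarrow> ins i x xs ! i = x"
  by (simp add: ins_def nth_append)

lemma mset_ins: "mset (ins i x xs) = add_mset x (mset xs)"
proof -
  have "mset (ins i x xs) = add_mset x (mset (take i xs) + mset (drop i xs))" unfolding ins_def by simp
  then show ?thesis by (simp only: mset_append[symmetric] append_take_drop_id)
qed

lemma mset_del: "i < length xs \<Longrightarrow> mset xs = add_mset (xs ! i) (mset (del i xs))"
  using mset_ins[of i "xs ! i" "del i xs"] ins_del[of i xs] by simp

lemma del_less: "i < length xs \<Longrightarrow> j < i \<Longrightarrow> del i xs ! j = xs ! j"
  by (simp add: del_def nth_append)

lemma del_ge: "i < length xs \<Longrightarrow> j \<ge> i \<Longrightarrow> j < length xs - 1 \<Longrightarrow> del i xs ! j = xs ! Suc j"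
  by (simp add: del_def nth_append min_def)

lemma nths_compl_singleton: "i < length xs \<Longrightarrow> nths xs (- {i}) = del i xs"
proof (induction xs arbitrary: i)
  case (Cons x xs)
  show ?case
  proof (cases i)
    case 0
    have "{j. Suc j \<noteq> 0} = (UNIV :: nat set)" by simp
    then show ?thesis using 0 by (simp add: nths_Cons del_def nths_all)
  next
    case (Suc k)
    have "{j. Suc j \<noteq> Suc k} = - {k}" by auto
    then show ?thesis using Suc Cons by (simp add: nths_Cons del_def)
  qed
qed simp

text \<open>\<open>j\<close> is a position in the list from which entry \<open>i\<close> has already
  been removed; the conditional translates it back to a position in \<open>xs\<close>.\<close>

lemma nths_compl_pair:
  assumes "i < length xs" "j < length xs - 1"
  shows "nths xs (- {i, if j < i then j else Suc j}) = del j (del i xs)"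
  using assms
proof (induction xs arbitrary: i j)
  case (Cons x xs)
  show ?case
  proof (cases i)
    case 0
    have "{k. Suc k \<noteq> 0 \<and> Suc k \<noteq> Suc j} = - {j}" by auto
    then show ?thesis using 0 Cons.prems nths_compl_singleton[of j xs] by (simp add: nths_Cons del_def[of 0])
  next
    case (Suc i')
    have d: "del i (x # xs) = x # del i' xs" using Suc by (simp add: del_def)
    show ?thesis
    proof (cases j)
      case 0
      have "{k. Suc k \<noteq> Suc i' \<and> Suc k \<noteq> 0} = - {i'}" by auto
      moreover have "del 0 (del i (x # xs)) = del i' xs" unfolding d by (simp add: del_def[of 0])
      ultimately show ?thesis using 0 Suc Cons.prems nths_compl_singleton[of i' xs] by (simp add: nths_Cons)
    next
      case (Suc j')
      have "{k. Suc k \<noteq> Suc i' \<and> Suc k \<noteq> (if j < i then j else Suc j)} = - {i', if j' < i' then j' else Suc j'}"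
        using Suc \<open>i = Suc i'\<close> by auto
      moreover have "del j (del i (x # xs)) = x # del j' (del i' xs)" unfolding d Suc by (simp add: del_def[of "Suc j'"] del_def[of j'])
      ultimately show ?thesis using Suc \<open>i = Suc i'\<close> Cons.prems Cons.IH[of i' j'] by (simp add: nths_Cons)
    qed
  qed
qed simp

section \<open>Weighted sums over compositions\<close>

definition comps :: "nat \<Rightarrow> nat \<Rightarrow> nat list set" where
  "comps n N = {ks. length ks = n \<and> sum_list ks = N}"

lemma finite_comps: "finite (comps n N)"
proof (rule finite_subset)
  show "comps n N \<subseteq> {ks. set ks \<subseteq> {..N} \<and> length ks = n}"
    unfolding comps_def using member_le_sum_list by auto
qed (rule finite_lists_length_eq, simp)

lemma sum_list_del: "i < length ks \<Longrightarrow> sum_list ks = ks ! i + sum_list (del i (ks :: nat list))"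
  using arg_cong[OF mset_del[of i ks], of sum_mset] by (simp add: sum_mset_sum_list)

lemma sum_list_ins: "sum_list (ins i k ks) = k + sum_list (ks :: nat list)"
  using arg_cong[OF mset_ins[of i k ks], of sum_mset] by (simp add: sum_mset_sum_list)

lemma sum_comps_Suc:
  assumes "i \<le> n"
  shows "(\<Sum>ks\<in>comps (Suc n) N. f (ks ! i) (del i ks)) = (\<Sum>k\<le>N. \<Sum>ks\<in>comps n (N - k). f k ks)"
proof -
  have "(\<Sum>ks\<in>comps (Suc n) N. f (ks ! i) (del i ks)) = (\<Sum>(k, ks)\<in>Sigma {..N} (\<lambda>k. comps n (N - k)). f k ks)"
  proof (rule sum.reindex_bij_witness[of _ "\<lambda>(k, ks). ins i k ks" "\<lambda>ks. (ks ! i, del i ks)"])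
    fix ks assume ks: "ks \<in> comps (Suc n) N"
    then have i: "i < length ks" and l: "length ks = Suc n" using assms by (auto simp: comps_def)
    show "(case (ks ! i, del i ks) of (k, ks) \<Rightarrow> ins i k ks) = ks" using ins_del[OF i] by simp
    have "sum_list ks = ks ! i + sum_list (del i ks)" by (rule sum_list_del[OF i])
    then show "(ks ! i, del i ks) \<in> Sigma {..N} (\<lambda>k. comps n (N - k))"
      using ks length_del[OF i] l by (simp add: comps_def)
  next
    fix p assume p: "p \<in> Sigma {..N} (\<lambda>k. comps n (N - k))"
    obtain k ks where kp: "p = (k, ks)" by (cases p)
    then have l: "length ks = n" "k + sum_list ks = N" using p by (auto simp: comps_def)
    show "(case p of (k, ks) \<Rightarrow> ins i k ks) \<in> comps (Suc n) N"
      using l kp by (simp add: comps_def length_ins sum_list_ins)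
    show "((case p of (k, ks) \<Rightarrow> ins i k ks) ! i, del i (case p of (k, ks) \<Rightarrow> ins i k ks)) = p"
      using l kp assms by (simp add: nth_ins del_ins)
  qed simp
  then show ?thesis using finite_comps by (simp add: sum.Sigma)
qed

text \<open>At \<open>k = 0\<close> truncated subtraction makes this 1. Such values are harmless,
  since they are always accompanied by a vanishing \<open>gl\<close> or by the factor
  \<open>k\<close>.\<close>

definition wt :: "real \<Rightarrow> nat \<Rightarrow> real" where "wt x k = x ^ (k - 1) / fact k"
text \<open>Divided powers, for which neither the binomial theorem nor the beta integral has
  coefficients.\<close>

definition dpow :: "real \<Rightarrow> nat \<Rightarrow> real" where "dpow x k = x ^ k / fact k"
definition weight :: "real list \<Rightarrow> nat list \<Rightarrow> real" where
  "weight L ks = (\<Prod>i<length L. wt (L ! i) (ks ! i))"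

text \<open>The volume polynomial, indexed by the number \<open>N\<close> of positive half-edges
  instead of the genus. In this form the split terms make sense even when their genus would be
  negative.\<close>

definition pol :: "nat \<Rightarrow> real list \<Rightarrow> real" where
  "pol N L = (\<Sum>ks\<in>comps (length L) N. real (gl (mset ks)) * weight L ks)"

lemma mult_wt: "x * wt x k = dpow x k" if "k > 0"
  using that by (cases k) (simp_all add: wt_def dpow_def)

lemma index_wt: "real k * wt x k = (if k = 0 then 0 else dpow x (k - 1))"
  by (cases k) (simp_all add: wt_def dpow_def field_simps del: of_nat_Suc)

lemma weight_Cons: "weight (x # L) (k # ks) = wt x k * weight L ks"
  unfolding weight_def by (simp add: prod.lessThan_Suc_shift del: prod.lessThan_Suc)

lemma weight_append: "length L = length ks \<Longrightarrow> weight (L @ L') (ks @ ks') = weight L ks * weight L' ks'"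
proof (induction L arbitrary: ks)
  case Nil then show ?case by (simp add: weight_def[of "[]"])
next
  case (Cons x L) then show ?case by (cases ks) (simp_all add: weight_Cons)
qed

lemma weight_del:
  assumes "i < length L" "length ks = length L"
  shows "weight L ks = wt (L ! i) (ks ! i) * weight (del i L) (del i ks)"
proof -
  have "L = take i L @ (L ! i) # drop (Suc i) L" "ks = take i ks @ (ks ! i) # drop (Suc i) ks"
    using id_take_nth_drop[of i L] id_take_nth_drop[of i ks] assms by auto
  then have "weight L ks = weight (take i L @ (L ! i) # drop (Suc i) L) (take i ks @ (ks ! i) # drop (Suc i) ks)" by simp
  also have "\<dots> = weight (take i L) (take i ks) * (wt (L ! i) (ks ! i) * weight (drop (Suc i) L) (drop (Suc i) ks))"
    using assms by (subst weight_append) (simp_all add: weight_Cons)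
  also have "\<dots> = wt (L ! i) (ks ! i) * weight (del i L) (del i ks)"
    unfolding del_def using assms by (subst weight_append) simp_all
  finally show ?thesis .
qed

lemma sum_weight_Cons:
  "(\<Sum>ks\<in>comps (Suc (length L)) N. f (mset ks) * weight (x # L) ks) =
    (\<Sum>k\<le>N. \<Sum>ks\<in>comps (length L) (N - k). f (add_mset k (mset ks)) * (wt x k * weight L ks))"
proof -
  have "(\<Sum>ks\<in>comps (Suc (length L)) N. f (mset ks) * weight (x # L) ks) =
    (\<Sum>ks\<in>comps (Suc (length L)) N. f (add_mset (ks ! 0) (mset (del 0 ks))) * (wt x (ks ! 0) * weight L (del 0 ks)))"
  proof (rule sum.cong)
    fix ks assume "ks \<in> comps (Suc (length L)) N"
    then have l: "length ks = Suc (length L)" by (simp add: comps_def)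
    show "f (mset ks) * weight (x # L) ks = f (add_mset (ks ! 0) (mset (del 0 ks))) * (wt x (ks ! 0) * weight L (del 0 ks))"
      using weight_del[of 0 "x # L" ks] mset_del[of 0 ks] l by (simp add: del_def)
  qed simp
  also have "\<dots> = (\<Sum>k\<le>N. \<Sum>ks\<in>comps (length L) (N - k). f (add_mset k (mset ks)) * (wt x k * weight L ks))"
    by (rule sum_comps_Suc) simp
  finally show ?thesis .
qed

lemma pol_Cons:
  "pol N (x # L) = (\<Sum>k\<le>N. \<Sum>ks\<in>comps (length L) (N - k). real (gl (add_mset k (mset ks))) * (wt x k * weight L ks))"
  unfolding pol_def using sum_weight_Cons[where f = "\<lambda>M. real (gl M)"] by simp

lemma dpow_binomial: "dpow (x + y) c = (\<Sum>p\<le>c. dpow x p * dpow y (c - p))"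
proof -
  have "dpow (x + y) c = (\<Sum>p\<le>c. (of_nat (c choose p)) * x ^ p * y ^ (c - p)) / fact c"
    by (simp add: dpow_def binomial_ring)
  also have "\<dots> = (\<Sum>p\<le>c. dpow x p * dpow y (c - p))"
    unfolding sum_divide_distrib
    by (intro sum.cong) (simp_all add: dpow_def binomial_fact field_simps)
  finally show ?thesis .
qed

lemma dpow_derivative: "((\<lambda>t. dpow t (Suc k)) has_real_derivative dpow t k) (at t)"
proof -
  have "((\<lambda>t. t ^ Suc k / fact (Suc k)) has_real_derivative real (Suc k) * t ^ k / fact (Suc k)) (at t)"
    by (auto intro!: derivative_eq_intros simp del: power_Suc of_nat_Suc fact_Suc)
  then show ?thesis by (simp add: dpow_def field_simps del: of_nat_Suc power_Suc)
qed

text \<open>Euler's beta integral. The induction step integrates by parts, moving one power from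
  \<open>x - t\<close> to \<open>t\<close>; the boundary terms vanish because both exponents there
  are positive.\<close>

lemma dpow_convolution:
  assumes "x \<ge> 0" shows "((\<lambda>t. dpow t a * dpow (x - t) b) has_integral dpow x (a + b + 1)) {0..x}"
proof (induction a arbitrary: b)
  case 0
  have "((\<lambda>t. - dpow (x - t) (Suc b)) has_real_derivative dpow (x - t) b) (at t within {0..x})" for t
  proof -
    have "((\<lambda>t. x - t) has_real_derivative - 1) (at t)" by (auto intro!: derivative_eq_intros)
    from DERIV_chain2[OF dpow_derivative this]
    have "((\<lambda>t. - dpow (x - t) (Suc b)) has_real_derivative dpow (x - t) b) (at t)"
      using DERIV_minus by fastforce
    then show ?thesis by (rule has_field_derivative_at_within)
  qed
  then have "((\<lambda>t. dpow (x - t) b) has_integral (- dpow (x - x) (Suc b) - - dpow (x - 0) (Suc b))) {0..x}"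
    using assms by (intro fundamental_theorem_of_calculus) (auto simp: has_real_derivative_iff_has_vector_derivative)
  then show ?case by (simp add: dpow_def)
next
  case (Suc a)
  have IH: "((\<lambda>t. dpow t a * dpow (x - t) (Suc b)) has_integral dpow x (a + Suc b + 1)) {0..x}" by (rule Suc.IH)
  have "((\<lambda>t. dpow t (Suc a) * dpow (x - t) (Suc b)) has_real_derivative
      dpow t a * dpow (x - t) (Suc b) - dpow t (Suc a) * dpow (x - t) b) (at t within {0..x})" for t
  proof -
    have "((\<lambda>t. x - t) has_real_derivative - 1) (at t)" by (auto intro!: derivative_eq_intros)
    from DERIV_chain2[OF dpow_derivative this]
    have "((\<lambda>t. dpow (x - t) (Suc b)) has_real_derivative dpow (x - t) b * - 1) (at t)" .
    from DERIV_mult[OF dpow_derivative this]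
    have "((\<lambda>t. dpow t (Suc a) * dpow (x - t) (Suc b)) has_real_derivative
      dpow t a * dpow (x - t) (Suc b) - dpow t (Suc a) * dpow (x - t) b) (at t)"
      by (simp add: algebra_simps)
    then show ?thesis by (rule has_field_derivative_at_within)
  qed
  then have "((\<lambda>t. dpow t a * dpow (x - t) (Suc b) - dpow t (Suc a) * dpow (x - t) b) has_integral
      (dpow x (Suc a) * dpow (x - x) (Suc b) - dpow 0 (Suc a) * dpow (x - 0) (Suc b))) {0..x}"
    using assms by (intro fundamental_theorem_of_calculus) (auto simp: has_real_derivative_iff_has_vector_derivative)
  then have "((\<lambda>t. dpow t a * dpow (x - t) (Suc b) - dpow t (Suc a) * dpow (x - t) b) has_integral 0) {0..x}"
    by (simp add: dpow_def)
  from has_integral_diff[OF IH this] show ?case by simp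
qed

text \<open>The factor \<open>x + y\<close> turns \<open>wt (x + y) c\<close> into a divided power,
  and the binomial theorem spreads it over the ways in which a merged cycle of length
  \<open>c\<close> can arise from cycles of lengths \<open>k\<close> and \<open>b\<close> with
  \<open>k + b - 2 = c\<close>.\<close>

lemma pol_merge:
  assumes N: "N \<ge> 2"
  shows "(x + y) * pol (N - 2) ((x + y) # L) =
    (\<Sum>k\<le>N. \<Sum>b\<le>N - k. \<Sum>ks\<in>comps (length L) (N - k - b).
       real (gl (add_mset (k + b - 2) (mset ks))) * (real k * wt x k) * (real b * wt y b) * weight L ks)"
proof -
  define H where "H c p = (\<Sum>ks\<in>comps (length L) (N - 2 - c). real (gl (add_mset c (mset ks))) * dpow x p * dpow y (c - p) * weight L ks)" for c p
  define Q where "Q k b = (\<Sum>ks\<in>comps (length L) (N - k - b).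
       real (gl (add_mset (k + b - 2) (mset ks))) * (real k * wt x k) * (real b * wt y b) * weight L ks)" for k b
  have "(x + y) * pol (N - 2) ((x + y) # L) =
    (\<Sum>c\<le>N - 2. \<Sum>ks\<in>comps (length L) (N - 2 - c). real (gl (add_mset c (mset ks))) * dpow (x + y) c * weight L ks)"
    unfolding pol_Cons sum_distrib_left
  proof (intro sum.cong refl)
    fix c ks
    show "(x + y) * (real (gl (add_mset c (mset ks))) * (wt (x + y) c * weight L ks)) =
      real (gl (add_mset c (mset ks))) * dpow (x + y) c * weight L ks"
    proof (cases "c = 0")
      case True then show ?thesis by (simp add: gl_zero)
    next
      case False then show ?thesis using mult_wt[of c "x + y"] by (simp add: mult_ac)
    qed
  qed
  also have "\<dots> = (\<Sum>c\<le>N - 2. \<Sum>p\<le>c. H c p)"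
  proof (rule sum.cong)
    fix c
    show "(\<Sum>ks\<in>comps (length L) (N - 2 - c). real (gl (add_mset c (mset ks))) * dpow (x + y) c * weight L ks) = (\<Sum>p\<le>c. H c p)"
      unfolding H_def by (subst sum.swap) (simp add: dpow_binomial sum_distrib_left sum_distrib_right mult_ac)
  qed simp
  also have "\<dots> = (\<Sum>(c, p)\<in>Sigma {..N - 2} (\<lambda>c. {..c}). H c p)" by (simp add: sum.Sigma)
  \<comment> \<open>Put \<open>k = p + 1\<close> and \<open>b = c - p + 1\<close>: then
    \<open>dpow x p\<close> and \<open>dpow y (c - p)\<close> are \<open>k * wt x k\<close> and
    \<open>b * wt y b\<close>.\<close>
  also have "\<dots> = (\<Sum>(k, b)\<in>Sigma {1..N} (\<lambda>k. {1..N - k}). Q k b)"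
  proof (rule sum.reindex_bij_witness[of _ "\<lambda>(k, b). (k + b - 2, k - 1)" "\<lambda>(c, p). (p + 1, c - p + 1)"])
    fix cp assume cp: "cp \<in> Sigma {..N - 2} (\<lambda>c. {..c})"
    obtain c p where e: "cp = (c, p)" by (cases cp)
    have c: "c \<le> N - 2" "p \<le> c" using cp e by auto
    show "(case case cp of (c, p) \<Rightarrow> (p + 1, c - p + 1) of (k, b) \<Rightarrow> (k + b - 2, k - 1)) = cp" using c e by simp
    show "(case cp of (c, p) \<Rightarrow> (p + 1, c - p + 1)) \<in> Sigma {1..N} (\<lambda>k. {1..N - k})" using c e N by auto
    have "N - Suc p - Suc (c - p) = N - 2 - c" using c by simp
    then show "(case case cp of (c, p) \<Rightarrow> (p + 1, c - p + 1) of (k, b) \<Rightarrow> Q k b) = (case cp of (c, p) \<Rightarrow> H c p)"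
      using c by (simp add: e Q_def H_def index_wt del: of_nat_Suc of_nat_add)
  next
    fix kb assume kb: "kb \<in> Sigma {1..N} (\<lambda>k. {1..N - k})"
    obtain k b where e: "kb = (k, b)" by (cases kb)
    have c: "1 \<le> k" "1 \<le> b" "k + b \<le> N" using kb e by auto
    show "(case case kb of (k, b) \<Rightarrow> (k + b - 2, k - 1) of (c, p) \<Rightarrow> (p + 1, c - p + 1)) = kb" using c e by simp
    show "(case kb of (k, b) \<Rightarrow> (k + b - 2, k - 1)) \<in> Sigma {..N - 2} (\<lambda>c. {..c})" using c e by auto
  qed
  also have "\<dots> = (\<Sum>(k, b)\<in>Sigma {..N} (\<lambda>k. {..N - k}). Q k b)"
  proof (rule sum.mono_neutral_left)
    show "\<forall>p\<in>Sigma {..N} (\<lambda>k. {..N - k}) - Sigma {1..N} (\<lambda>k. {1..N - k}). (case p of (k, b) \<Rightarrow> Q k b) = 0"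
    proof
      fix p assume p: "p \<in> Sigma {..N} (\<lambda>k. {..N - k}) - Sigma {1..N} (\<lambda>k. {1..N - k})"
      obtain k b where e: "p = (k, b)" by (cases p)
      have "k = 0 \<or> b = 0" using p by (auto simp: e)
      then have "Q k b = 0" by (auto simp: Q_def)
      then show "(case p of (k, b) \<Rightarrow> Q k b) = 0" by (simp add: e)
    qed
  qed auto
  also have "\<dots> = (\<Sum>k\<le>N. \<Sum>b\<le>N - k. Q k b)" by (simp add: sum.Sigma)
  finally show ?thesis by (simp add: Q_def)
qed

text \<open>The factors \<open>y\<close> and \<open>x - y\<close> turn the first two weights into
  divided powers of orders \<open>a\<close> and \<open>b\<close>. Their convolution is
  \<open>dpow x (a + b + 1)\<close>, which equals \<open>k * wt x k\<close> for
  \<open>k = a + b + 2\<close>; the split position is \<open>r = a + 1\<close>.\<close>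

lemma pol_split:
  assumes N: "N \<ge> 2" and x: "x \<ge> 0"
  shows "((\<lambda>y. pol (N - 2) (y # (x - y) # L) * (y * (x - y))) has_integral
    (\<Sum>k\<le>N. \<Sum>ks\<in>comps (length L) (N - k). \<Sum>r=1..<k.
       real (gl ({#r - 1, k - r - 1#} + mset ks)) * (real k * wt x k) * weight L ks)) {0..x}"
proof -
  define C where "C a b ks = real (gl (add_mset a (add_mset b (mset ks)))) * weight L ks" for a b and ks :: "nat list"
  have p: "pol (N - 2) (y # (x - y) # L) * (y * (x - y)) =
    (\<Sum>a\<le>N - 2. \<Sum>b\<le>N - 2 - a. \<Sum>ks\<in>comps (length L) (N - 2 - a - b). C a b ks * (dpow y a * dpow (x - y) b))" for y
  proof -
    have "pol (N - 2) (y # (x - y) # L) = (\<Sum>a\<le>N - 2. wt y a *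
       (\<Sum>ks\<in>comps (Suc (length L)) (N - 2 - a). real (gl (add_mset a (mset ks))) * weight ((x - y) # L) ks))"
      unfolding pol_Cons by (simp add: sum_distrib_left mult_ac)
    also have "\<dots> = (\<Sum>a\<le>N - 2. wt y a * (\<Sum>b\<le>N - 2 - a. \<Sum>ks\<in>comps (length L) (N - 2 - a - b).
       real (gl (add_mset a (add_mset b (mset ks)))) * (wt (x - y) b * weight L ks)))"
      by (intro sum.cong refl arg_cong2[where f = "(*)"] sum_weight_Cons[where f = "\<lambda>M. real (gl (add_mset _ M))"])
    finally have "pol (N - 2) (y # (x - y) # L) * (y * (x - y)) =
      (\<Sum>a\<le>N - 2. \<Sum>b\<le>N - 2 - a. \<Sum>ks\<in>comps (length L) (N - 2 - a - b).
        C a b ks * ((y * wt y a) * ((x - y) * wt (x - y) b)))"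
      by (simp add: C_def sum_distrib_left sum_distrib_right mult_ac)
    also have "\<dots> = (\<Sum>a\<le>N - 2. \<Sum>b\<le>N - 2 - a. \<Sum>ks\<in>comps (length L) (N - 2 - a - b).
        C a b ks * (dpow y a * dpow (x - y) b))"
    proof (intro sum.cong refl)
      fix a b ks
      show "C a b ks * ((y * wt y a) * ((x - y) * wt (x - y) b)) = C a b ks * (dpow y a * dpow (x - y) b)"
      proof (cases "a = 0 \<or> b = 0")
        case True then have "C a b ks = 0" by (auto simp: C_def gl_zero)
        then show ?thesis by simp
      qed (simp add: mult_wt)
    qed
    finally show ?thesis .
  qed
  define E where "E a b = (\<Sum>ks\<in>comps (length L) (N - 2 - a - b). C a b ks * dpow x (a + b + 1))" for a b
  have "((\<lambda>y. pol (N - 2) (y # (x - y) # L) * (y * (x - y))) has_integral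
    (\<Sum>a\<le>N - 2. \<Sum>b\<le>N - 2 - a. E a b)) {0..x}"
    unfolding p E_def
    by (intro has_integral_sum finite_comps finite_atMost has_integral_mult_right dpow_convolution[OF x])
  also have "(\<Sum>a\<le>N - 2. \<Sum>b\<le>N - 2 - a. E a b) = (\<Sum>(a, b)\<in>Sigma {..N - 2} (\<lambda>a. {..N - 2 - a}). E a b)"
    by (simp add: sum.Sigma)
  also have "\<dots> = (\<Sum>(k, r)\<in>Sigma {..N} (\<lambda>k. {1..<k}). E (r - 1) (k - r - 1))"
  proof (rule sum.reindex_bij_witness[of _ "\<lambda>(k, r). (r - 1, k - r - 1)" "\<lambda>(a, b). (a + b + 2, a + 1)"])
    fix ab assume ab: "ab \<in> Sigma {..N - 2} (\<lambda>a. {..N - 2 - a})"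
    obtain a b where e: "ab = (a, b)" by (cases ab)
    have c: "a + b \<le> N - 2" using ab e by auto
    show "(case case ab of (a, b) \<Rightarrow> (a + b + 2, a + 1) of (k, r) \<Rightarrow> (r - 1, k - r - 1)) = ab" using e by simp
    show "(case ab of (a, b) \<Rightarrow> (a + b + 2, a + 1)) \<in> Sigma {..N} (\<lambda>k. {1..<k})" using c e N by auto
    show "(case case ab of (a, b) \<Rightarrow> (a + b + 2, a + 1) of (k, r) \<Rightarrow> E (r - 1) (k - r - 1)) = (case ab of (a, b) \<Rightarrow> E a b)"
      using e by simp
  next
    fix kr assume kr: "kr \<in> Sigma {..N} (\<lambda>k. {1..<k})"
    obtain k r where e: "kr = (k, r)" by (cases kr)
    have c: "1 \<le> r" "r < k" "k \<le> N" using kr e by auto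
    show "(case case kr of (k, r) \<Rightarrow> (r - 1, k - r - 1) of (a, b) \<Rightarrow> (a + b + 2, a + 1)) = kr" using c e by simp
    show "(case kr of (k, r) \<Rightarrow> (r - 1, k - r - 1)) \<in> Sigma {..N - 2} (\<lambda>a. {..N - 2 - a})" using c e by auto
  qed
  also have "\<dots> = (\<Sum>k\<le>N. \<Sum>r=1..<k. E (r - 1) (k - r - 1))" by (simp add: sum.Sigma)
  also have "\<dots> = (\<Sum>k\<le>N. \<Sum>ks\<in>comps (length L) (N - k). \<Sum>r=1..<k.
       real (gl ({#r - 1, k - r - 1#} + mset ks)) * (real k * wt x k) * weight L ks)"
  proof (rule sum.cong)
    fix k assume k: "k \<in> {..N}"
    have "E (r - 1) (k - r - 1) = (\<Sum>ks\<in>comps (length L) (N - k).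
       real (gl ({#r - 1, k - r - 1#} + mset ks)) * (real k * wt x k) * weight L ks)" if r: "r \<in> {1..<k}" for r
    proof -
      have "N - 2 - (r - 1) - (k - r - 1) = N - k" "r - 1 + (k - r - 1) + 1 = k - 1" "k \<noteq> 0" using r k by auto
      then show ?thesis unfolding E_def C_def by (simp only: index_wt if_False) (simp add: mult_ac)
    qed
    then show "(\<Sum>r=1..<k. E (r - 1) (k - r - 1)) = (\<Sum>ks\<in>comps (length L) (N - k). \<Sum>r=1..<k.
       real (gl ({#r - 1, k - r - 1#} + mset ks)) * (real k * wt x k) * weight L ks)"
      by (subst sum.swap) simp
  qed simp
  finally show ?thesis .
qed

section \<open>The recursion for the volume polynomials\<close>

lemma sum_mset_nth: "(\<Sum>b\<in>#mset ks. f b) = (\<Sum>j<length ks. f (ks ! j))"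
  by (metis (no_types, lifting) atLeast0LessThan length_map lessThan_iff mset_map nth_map sum.cong sum_list_sum_nth sum_mset_sum_list)

text \<open>The factor \<open>k\<close> counts the choices of the deleted point in its cycle. It
  also extends the identity to \<open>k = 0\<close>, where both sides vanish.\<close>

lemma gl_recursion_list:
  assumes "k + sum_list ks > 2"
  shows "real k * real (gl (add_mset k (mset ks))) =
    (\<Sum>r=1..<k. real k * real (gl ({#r - 1, k - r - 1#} + mset ks))) +
    (\<Sum>j<length ks. real k * real (ks ! j) * real (gl (add_mset (k + ks ! j - 2) (mset (del j ks)))))"
proof (cases "k = 0")
  case False
  have "gl (add_mset k (mset ks)) = (\<Sum>r=1..<k. gl ({#r - 1, k - r - 1#} + mset ks)) +
    (\<Sum>b\<in>#mset ks. b * gl (add_mset (k + b - 2) (mset ks - {#b#})))"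
    by (rule gl_recursion) (use False assms in \<open>auto simp: sum_mset_sum_list\<close>)
  also have "(\<Sum>b\<in>#mset ks. b * gl (add_mset (k + b - 2) (mset ks - {#b#}))) =
    (\<Sum>j<length ks. ks ! j * gl (add_mset (k + ks ! j - 2) (mset (del j ks))))"
    unfolding sum_mset_nth by (intro sum.cong) (simp_all add: mset_del)
  finally show ?thesis by (simp add: sum_distrib_left algebra_simps)
qed simp

text \<open>Each list \<open>ks\<close> in \<open>pol N L\<close> has \<open>N = \<Sum>\<^sub>i ks ! i\<close>; the summand \<open>i\<close> is rewritten with the recursion for
  \<open>gl\<close> at the \<open>i\<close>-th cycle.\<close>

theorem pol_recursion:
  assumes N: "N > 2" and L: "\<And>i. i < length L \<Longrightarrow> L ! i \<ge> 0"
  shows "real N * pol N L = (\<Sum>i<length L.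
     integral {0..L ! i} (\<lambda>y. pol (N - 2) (y # (L ! i - y) # del i L) * (y * (L ! i - y))) +
     (\<Sum>j<length L - 1. (L ! i + del i L ! j) * pol (N - 2) ((L ! i + del i L ! j) # del j (del i L))))"
proof -
  define n where "n = length L - 1"
  define T where "T i = (\<Sum>k\<le>N. \<Sum>ks\<in>comps n (N - k). real k * real (gl (add_mset k (mset ks))) * (wt (L ! i) k * weight (del i L) ks))" for i
  have "real N * pol N L = (\<Sum>ks\<in>comps (length L) N. \<Sum>i<length L. real (ks ! i) * real (gl (mset ks)) * weight L ks)"
    unfolding pol_def sum_distrib_left
  proof (rule sum.cong)
    fix ks assume "ks \<in> comps (length L) N"
    then have "length ks = length L" "N = sum_list ks" by (auto simp: comps_def)
    then have e: "real N = (\<Sum>i<length L. real (ks ! i))" by (simp add: sum_list_sum_nth atLeast0LessThan)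
    show "real N * (real (gl (mset ks)) * weight L ks) = (\<Sum>i<length L. real (ks ! i) * real (gl (mset ks)) * weight L ks)"
      unfolding e sum_distrib_right by (simp add: mult_ac)
  qed simp
  also have "\<dots> = (\<Sum>i<length L. \<Sum>ks\<in>comps (length L) N. real (ks ! i) * real (gl (mset ks)) * weight L ks)"
    by (rule sum.swap)
  also have "\<dots> = (\<Sum>i<length L. T i)"
  proof (rule sum.cong)
    fix i assume "i \<in> {..<length L}"
    then have i: "i < length L" by simp
    then have n: "length L = Suc n" by (simp add: n_def)
    have "(\<Sum>ks\<in>comps (length L) N. real (ks ! i) * real (gl (mset ks)) * weight L ks) =
      (\<Sum>ks\<in>comps (Suc n) N. real (ks ! i) * real (gl (add_mset (ks ! i) (mset (del i ks)))) *
         (wt (L ! i) (ks ! i) * weight (del i L) (del i ks)))"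
    proof (rule sum.cong)
      fix ks assume "ks \<in> comps (Suc n) N"
      then have l: "length ks = length L" using n by (simp add: comps_def)
      show "real (ks ! i) * real (gl (mset ks)) * weight L ks = real (ks ! i) * real (gl (add_mset (ks ! i) (mset (del i ks)))) *
         (wt (L ! i) (ks ! i) * weight (del i L) (del i ks))"
        using mset_del[of i ks] weight_del[OF i l] i l by simp
    qed (simp add: n)
    also have "\<dots> = T i" unfolding T_def using i n
      by (intro sum_comps_Suc[where f = "\<lambda>k ks. real k * real (gl (add_mset k (mset ks))) * (wt (L ! i) k * weight (del i L) ks)"]) simp
    finally show "(\<Sum>ks\<in>comps (length L) N. real (ks ! i) * real (gl (mset ks)) * weight L ks) = T i" .
  qed simp
  also have "\<dots> = (\<Sum>i<length L.
     integral {0..L ! i} (\<lambda>y. pol (N - 2) (y # (L ! i - y) # del i L) * (y * (L ! i - y))) +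
     (\<Sum>j<n. (L ! i + del i L ! j) * pol (N - 2) ((L ! i + del i L ! j) # del j (del i L))))"
  proof (rule sum.cong)
    fix i assume "i \<in> {..<length L}"
    then have i: "i < length L" by simp
    define x where "x = L ! i"
    define L' where "L' = del i L"
    have lL: "length L' = n" using length_del[OF i] by (simp add: L'_def n_def)
    have x0: "x \<ge> 0" using L[OF i] by (simp add: x_def)
    define M where "M j k ks = real k * real (ks ! j) * real (gl (add_mset (k + ks ! j - 2) (mset (del j ks)))) * (wt x k * weight L' ks)"
      for j k and ks :: "nat list"
    have "T i = (\<Sum>k\<le>N. \<Sum>ks\<in>comps n (N - k).
       (\<Sum>r=1..<k. real (gl ({#r - 1, k - r - 1#} + mset ks)) * (real k * wt x k) * weight L' ks) + (\<Sum>j<n. M j k ks))"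
      unfolding T_def x_def[symmetric] L'_def[symmetric]
    proof (intro sum.cong refl)
      fix k ks assume k: "k \<in> {..N}" and ks: "ks \<in> comps n (N - k)"
      then have s: "k + sum_list ks > 2" and l: "length ks = n" using N by (auto simp: comps_def)
      show "real k * real (gl (add_mset k (mset ks))) * (wt x k * weight L' ks) =
        (\<Sum>r=1..<k. real (gl ({#r - 1, k - r - 1#} + mset ks)) * (real k * wt x k) * weight L' ks) + (\<Sum>j<n. M j k ks)"
        unfolding gl_recursion_list[OF s] M_def l distrib_right sum_distrib_right
        by (intro arg_cong2[where f = "(+)"] sum.cong) (simp_all add: mult_ac)
    qed
    also have "\<dots> = (\<Sum>k\<le>N. \<Sum>ks\<in>comps n (N - k). \<Sum>r=1..<k. real (gl ({#r - 1, k - r - 1#} + mset ks)) * (real k * wt x k) * weight L' ks)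
       + (\<Sum>k\<le>N. \<Sum>ks\<in>comps n (N - k). \<Sum>j<n. M j k ks)"
      by (simp only: sum.distrib)
    also have "(\<Sum>k\<le>N. \<Sum>ks\<in>comps n (N - k). \<Sum>r=1..<k. real (gl ({#r - 1, k - r - 1#} + mset ks)) * (real k * wt x k) * weight L' ks)
       = integral {0..x} (\<lambda>y. pol (N - 2) (y # (x - y) # L') * (y * (x - y)))"
      using integral_unique[OF pol_split[of N x L']] N x0 lL by simp
    also have "(\<Sum>k\<le>N. \<Sum>ks\<in>comps n (N - k). \<Sum>j<n. M j k ks) = (\<Sum>j<n. \<Sum>k\<le>N. \<Sum>ks\<in>comps n (N - k). M j k ks)"
      by (subst sum.swap[of _ "{..<n}"]) (intro sum.cong refl sum.swap)
    also have "\<dots> = (\<Sum>j<n. (x + L' ! j) * pol (N - 2) ((x + L' ! j) # del j L'))"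
    proof (rule sum.cong)
      fix j assume "j \<in> {..<n}"
      then have j: "j < n" by simp
      then obtain m where m: "n = Suc m" by (cases n) auto
      have lm: "length (del j L') = m" using length_del[of j L'] lL j m by simp
      have "(\<Sum>ks\<in>comps n (N - k). M j k ks) = (\<Sum>b\<le>N - k. \<Sum>ks\<in>comps m (N - k - b).
         real (gl (add_mset (k + b - 2) (mset ks))) * (real k * wt x k) * (real b * wt (L' ! j) b) * weight (del j L') ks)" for k
      proof -
        have "(\<Sum>ks\<in>comps n (N - k). M j k ks) = (\<Sum>ks\<in>comps (Suc m) (N - k).
           real (gl (add_mset (k + ks ! j - 2) (mset (del j ks)))) * (real k * wt x k) * (real (ks ! j) * wt (L' ! j) (ks ! j)) * weight (del j L') (del j ks))"
        proof (rule sum.cong)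
          fix ks assume "ks \<in> comps (Suc m) (N - k)"
          then have "length ks = length L'" using lL m by (simp add: comps_def)
          then show "M j k ks = real (gl (add_mset (k + ks ! j - 2) (mset (del j ks)))) * (real k * wt x k) * (real (ks ! j) * wt (L' ! j) (ks ! j)) * weight (del j L') (del j ks)"
            unfolding M_def using weight_del[of j L' ks] j lL by (simp add: mult_ac)
        qed (simp add: m)
        also have "\<dots> = (\<Sum>b\<le>N - k. \<Sum>ks\<in>comps m (N - k - b).
           real (gl (add_mset (k + b - 2) (mset ks))) * (real k * wt x k) * (real b * wt (L' ! j) b) * weight (del j L') ks)"
          using j m by (intro sum_comps_Suc[where f = "\<lambda>b ks. real (gl (add_mset (k + b - 2) (mset ks))) * (real k * wt x k) * (real b * wt (L' ! j) b) * weight (del j L') ks"]) simp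
        finally show ?thesis .
      qed
      then show "(\<Sum>k\<le>N. \<Sum>ks\<in>comps n (N - k). M j k ks) = (x + L' ! j) * pol (N - 2) ((x + L' ! j) # del j L')"
        using pol_merge[of N x "L' ! j" "del j L'"] N lm by simp
    qed simp
    finally show "T i = integral {0..L ! i} (\<lambda>y. pol (N - 2) (y # (L ! i - y) # del i L) * (y * (L ! i - y))) +
     (\<Sum>j<n. (L ! i + del i L ! j) * pol (N - 2) ((L ! i + del i L ! j) # del j (del i L)))"
      by (simp add: x_def L'_def)
  qed simp
  finally show ?thesis by (simp add: n_def)
qed

section \<open>The volume functions\<close>

lemma Vcirc_eq_pol:
  assumes "n \<ge> 1" "L \<in> pos_vectors n"
  shows "Vcirc g n L = pol (2 * (2 * g + n - 1)) L"
proof -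
  have L: "length L = n" "\<And>i. i < n \<Longrightarrow> L ! i > 0" using assms by (auto simp: pos_vectors_def)
  show ?thesis
    unfolding Vcirc_def pol_def comps_def weight_def wt_def L(1) using L by (rule V_eq_sum_gl[OF assms(1)])
qed

lemma pol_eq_0_of_many_boundaries:
  assumes "2 * length L > N + 2" shows "pol N L = 0"
  unfolding pol_def
proof (rule sum.neutral, rule ballI)
  fix ks assume "ks \<in> comps (length L) N"
  then have "gl (mset ks) = 0"
    using assms by (intro gl_eq_0_of_many_boundaries) (simp add: comps_def sum_mset_sum_list)
  then show "real (gl (mset ks)) * weight L ks = 0" by simp
qed

text \<open>A composition \<open>ks\<close> contributes the monomial with exponents
  \<open>ks ! i - 1\<close>, so the degree is \<open>N - n\<close>. Compositions with a zero entry
  drop out, as \<open>gl\<close> vanishes there, and subtracting 1 from each entry is then a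
  bijection onto the exponent vectors.\<close>

lemma homogeneous_polynomial_Vcirc:
  assumes n: "n \<ge> 1" "2 * g + n \<ge> 2"
  shows "homogeneous_polynomial n (4 * g + n - 2) (Vcirc g n)"
proof -
  define N where "N = 2 * (2 * g + n - 1)"
  define d where "d = 4 * g + n - 2"
  have Nd: "N = d + n" using n by (simp add: N_def d_def)
  define c where "c \<alpha> = real (gl (mset (map Suc \<alpha>))) * (\<Prod>i<n. 1 / fact (Suc (\<alpha> ! i)))" for \<alpha>
  have "\<exists>\<alpha>. length \<alpha> = n \<and> sum_list \<alpha> = d \<and> c \<alpha> \<noteq> 0"
  proof -
    obtain M where M: "size M = n" "sum_mset M + 2 = 2 * (2 * g + n)" "gl M > 0" using ex_gl_pos[OF n] by auto
    obtain ks where ks: "mset ks = M" using ex_mset by auto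
    have nz: "0 \<notin> set ks" using M(3) gl_zero[of M] ks by auto
    define \<alpha> where "\<alpha> = map (\<lambda>k. k - 1) ks"
    have S: "map Suc \<alpha> = ks" unfolding \<alpha>_def map_map by (rule map_idI) (use nz in \<open>auto intro: Suc_pred gr0I\<close>)
    have l: "length \<alpha> = n" using M ks by (auto simp: \<alpha>_def)
    have "sum_list (map Suc \<alpha>) = sum_list \<alpha> + length \<alpha>" by (induction \<alpha>) auto
    then have "sum_list \<alpha> + n = sum_list ks" using S l by simp
    also have "\<dots> = N" using M ks by (simp add: N_def sum_mset_sum_list[symmetric])
    finally have "sum_list \<alpha> = d" using Nd by simp
    moreover have "c \<alpha> \<noteq> 0" using M(3) ks S by (simp add: c_def)
    ultimately show ?thesis using l by blast
  qed
  moreover have "Vcirc g n L = (\<Sum>\<alpha> | length \<alpha> = n \<and> sum_list \<alpha> = d. c \<alpha> * (\<Prod>i<n. (L ! i) ^ (\<alpha> ! i)))"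
    if L: "L \<in> pos_vectors n" for L
  proof -
    have l: "length L = n" using L by (simp add: pos_vectors_def)
    have sumS: "sum_list (map Suc \<alpha>) = sum_list \<alpha> + length \<alpha>" for \<alpha> by (induction \<alpha>) auto
    have "Vcirc g n L = (\<Sum>ks\<in>comps n N. real (gl (mset ks)) * weight L ks)"
      using Vcirc_eq_pol[OF n(1) L] by (simp add: pol_def l N_def)
    also have "\<dots> = (\<Sum>ks\<in>{ks \<in> comps n N. 0 \<notin> set ks}. real (gl (mset ks)) * weight L ks)"
      by (rule sum.mono_neutral_right) (use finite_comps gl_zero in auto)
    also have "\<dots> = (\<Sum>\<alpha> | length \<alpha> = n \<and> sum_list \<alpha> = d. c \<alpha> * (\<Prod>i<n. (L ! i) ^ (\<alpha> ! i)))"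
    proof (rule sum.reindex_bij_witness[of _ "map Suc" "map (\<lambda>k. k - 1)"])
      fix ks assume ks: "ks \<in> {ks \<in> comps n N. 0 \<notin> set ks}"
      then have l': "length ks = n" "sum_list ks = N" and nz: "0 \<notin> set ks" by (auto simp: comps_def)
      show S: "map Suc (map (\<lambda>k. k - 1) ks) = ks" unfolding map_map
        by (rule map_idI) (use nz in \<open>auto intro: Suc_pred gr0I\<close>)
      have "sum_list (map (\<lambda>k. k - 1) ks) + n = N" using sumS[of "map (\<lambda>k. k - 1) ks"] S l' by simp
      then show "map (\<lambda>k. k - 1) ks \<in> {\<alpha>. length \<alpha> = n \<and> sum_list \<alpha> = d}" using l' Nd by simp
      have "(\<Prod>i<n. 1 / fact (Suc (map (\<lambda>k. k - 1) ks ! i))) * (\<Prod>i<n. (L ! i) ^ (map (\<lambda>k. k - 1) ks ! i)) = weight L ks"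
        unfolding weight_def l prod.distrib[symmetric]
      proof (rule prod.cong)
        fix i assume "i \<in> {..<n}"
        then have i: "i < length ks" using l' by simp
        then have "ks ! i \<noteq> 0" using nz by (metis nth_mem)
        then show "1 / fact (Suc (map (\<lambda>k. k - 1) ks ! i)) * (L ! i) ^ (map (\<lambda>k. k - 1) ks ! i) = wt (L ! i) (ks ! i)"
          using i by (simp add: wt_def del: fact_Suc)
      qed simp
      then show "c (map (\<lambda>k. k - 1) ks) * (\<Prod>i<n. (L ! i) ^ (map (\<lambda>k. k - 1) ks ! i)) = real (gl (mset ks)) * weight L ks"
        unfolding c_def S by (simp only: mult.assoc)
    next
      fix \<alpha> :: "nat list" assume a: "\<alpha> \<in> {\<alpha>. length \<alpha> = n \<and> sum_list \<alpha> = d}"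
      show "map (\<lambda>k. k - 1) (map Suc \<alpha>) = \<alpha>" by (simp add: map_idI)
      show "map Suc \<alpha> \<in> {ks \<in> comps n N. 0 \<notin> set ks}" using a sumS[of \<alpha>] Nd by (auto simp: comps_def)
    qed
    finally show ?thesis .
  qed
  ultimately show ?thesis unfolding homogeneous_polynomial_def d_def[symmetric] by blast
qed

lemma sum_pairs_del:
  fixes h :: "'a \<Rightarrow> 'a \<Rightarrow> 'a list \<Rightarrow> real"
  assumes "length L = n"
  shows "(\<Sum>(i, j) | i < n \<and> j < n \<and> i \<noteq> j. h (L ! i) (L ! j) (nths L (- {i, j}))) =
    (\<Sum>i<n. \<Sum>j<n - 1. h (L ! i) (del i L ! j) (del j (del i L)))"
proof -
  have "(\<Sum>i<n. \<Sum>j<n - 1. h (L ! i) (del i L ! j) (del j (del i L))) =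
    (\<Sum>(i, j)\<in>{..<n} \<times> {..<n - 1}. h (L ! i) (del i L ! j) (del j (del i L)))"
    by (simp add: sum.cartesian_product)
  also have "\<dots> = (\<Sum>(i, j) | i < n \<and> j < n \<and> i \<noteq> j. h (L ! i) (L ! j) (nths L (- {i, j})))"
  proof (rule sum.reindex_bij_witness[of _ "\<lambda>(i, j). (i, if j < i then j else j - 1)"
        "\<lambda>(i, j). (i, if j < i then j else Suc j)"])
    fix p assume "p \<in> {..<n} \<times> {..<n - 1}"
    then obtain i j where p: "p = (i, j)" "i < n" "j < n - 1" by auto
    show "(case case p of (i, j) \<Rightarrow> (i, if j < i then j else Suc j) of (i, j) \<Rightarrow> (i, if j < i then j else j - 1)) = p"
      using p by auto
    show "(case p of (i, j) \<Rightarrow> (i, if j < i then j else Suc j)) \<in> {(i, j). i < n \<and> j < n \<and> i \<noteq> j}"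
      using p by auto
    have "L ! (if j < i then j else Suc j) = del i L ! j" using p assms by (simp add: del_less del_ge)
    then show "(case case p of (i, j) \<Rightarrow> (i, if j < i then j else Suc j) of (i, j) \<Rightarrow> h (L ! i) (L ! j) (nths L (- {i, j}))) =
      (case p of (i, j) \<Rightarrow> h (L ! i) (del i L ! j) (del j (del i L)))"
      using nths_compl_pair[of i L j] p assms by simp
  next
    fix p assume "p \<in> {(i, j). i < n \<and> j < n \<and> i \<noteq> j}"
    then obtain i j where p: "p = (i, j)" "i < n" "j < n" "i \<noteq> j" by auto
    show "(case case p of (i, j) \<Rightarrow> (i, if j < i then j else j - 1) of (i, j) \<Rightarrow> (i, if j < i then j else Suc j)) = p"
      using p by auto
    show "(case p of (i, j) \<Rightarrow> (i, if j < i then j else j - 1)) \<in> {..<n} \<times> {..<n - 1}"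
      using p by auto
  qed
  finally show ?thesis by simp
qed

lemma set_del_subset: "set (del i xs) \<subseteq> set xs"
  unfolding del_def using set_take_subset[of i xs] set_drop_subset[of "Suc i" xs] by auto

theorem theorem5:
  fixes g n :: nat
  assumes "n \<ge> 1" and "2 * int g - 1 + int n \<ge> 1"
  shows "homogeneous_polynomial n (4 * g + n - 2) (Vcirc g n) \<and>
    (2 * int g - 1 + int n \<ge> 2 \<longrightarrow>
      (\<forall>L\<in>pos_vectors n.
        (2 * real g + real n - 1) * Vcirc g n L =
          1 / 2 * (\<Sum>(i, j) | i < n \<and> j < n \<and> i \<noteq> j.
            (L ! i + L ! j) * Vcirc g (n - 1) ((L ! i + L ! j) # nths L (- {i, j})))
          + (if g = 0 then 0 else
              1 / 2 * (\<Sum>i<n. integral {0..L ! i} (\<lambda>x.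
                Vcirc (g - 1) (n + 1) (x # (L ! i - x) # nths L (- {i})) * (x * (L ! i - x)))))))"
proof (intro conjI impI ballI)
  show "homogeneous_polynomial n (4 * g + n - 2) (Vcirc g n)"
    using assms by (intro homogeneous_polynomial_Vcirc) auto
next
  fix L assume big: "2 * int g - 1 + int n \<ge> 2" and Lp: "L \<in> pos_vectors n"
  have L: "length L = n" "\<And>x. x \<in> set L \<Longrightarrow> x > 0" using Lp by (auto simp: pos_vectors_def)
  then have Li: "\<And>i. i < n \<Longrightarrow> L ! i > 0" by simp
  \<comment> \<open>\<open>N - 2\<close> is the number of positive half-edges both for
    \<open>(g, n - 1)\<close> and for \<open>(g - 1, n + 1)\<close>, so one polynomial family serves
    both sums.\<close>
  define N where "N = 2 * (2 * g + n - 1)"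
  have N2: "N > 2" and NR: "real N = 2 * (2 * real g + real n - 1)" using big assms(1) by (auto simp: N_def of_nat_diff)
  have merge: "(\<Sum>(i, j) | i < n \<and> j < n \<and> i \<noteq> j.
      (L ! i + L ! j) * Vcirc g (n - 1) ((L ! i + L ! j) # nths L (- {i, j}))) =
    (\<Sum>i<n. \<Sum>j<n - 1. (L ! i + del i L ! j) * pol (N - 2) ((L ! i + del i L ! j) # del j (del i L)))"
    unfolding sum_pairs_del[OF L(1), of "\<lambda>a b l. (a + b) * Vcirc g (n - 1) ((a + b) # l)"]
  proof (intro sum.cong refl)
    fix i j assume ij: "i \<in> {..<n}" "j \<in> {..<n - 1}"
    then have i: "i < length L" and j: "j < length (del i L)" using L by (auto simp: length_del)
    have "del i L ! j \<in> set (del i L)" using j by (rule nth_mem)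
    then have "del i L ! j > 0" using L(2) set_del_subset[of i L] by auto
    moreover have "x > 0" if "x \<in> set (del j (del i L))" for x
      using that L(2) set_del_subset[of j "del i L"] set_del_subset[of i L] by auto
    moreover have "length (del j (del i L)) = n - 2" using length_del[OF j] length_del[OF i] L(1) by simp
    ultimately have "(L ! i + del i L ! j) # del j (del i L) \<in> pos_vectors (n - 1)"
      using Li[of i] ij by (auto simp: pos_vectors_def)
    from Vcirc_eq_pol[OF _ this, of g] ij
    show "(L ! i + del i L ! j) * Vcirc g (n - 1) ((L ! i + del i L ! j) # del j (del i L)) =
      (L ! i + del i L ! j) * pol (N - 2) ((L ! i + del i L ! j) # del j (del i L))"
      by (simp add: N_def diff_mult_distrib2)
  qed
  have split: "(\<Sum>i<n. integral {0..L ! i} (\<lambda>y. pol (N - 2) (y # (L ! i - y) # del i L) * (y * (L ! i - y)))) =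
    (if g = 0 then 0 else (\<Sum>i<n. integral {0..L ! i} (\<lambda>x.
                Vcirc (g - 1) (n + 1) (x # (L ! i - x) # nths L (- {i})) * (x * (L ! i - x)))))"
  proof (cases "g = 0")
    case True
    \<comment> \<open>For \<open>g = 0\<close> there would be \<open>n + 1\<close> cycles on
      \<open>2 * n - 4\<close> points, too many for any gluing.\<close>
    have "pol (N - 2) (y # (L ! i - y) # del i L) = 0" if "i < n" for i y
      using that L(1) True by (intro pol_eq_0_of_many_boundaries) (simp add: length_del N_def)
    then show ?thesis using True by simp
  next
    case False
    have "integral {0..L ! i} (\<lambda>y. pol (N - 2) (y # (L ! i - y) # del i L) * (y * (L ! i - y))) =
      integral {0..L ! i} (\<lambda>x. Vcirc (g - 1) (n + 1) (x # (L ! i - x) # nths L (- {i})) * (x * (L ! i - x)))"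
      if i: "i < n" for i
    proof (rule integral_cong)
      fix y assume y: "y \<in> {0..L ! i}"
      show "pol (N - 2) (y # (L ! i - y) # del i L) * (y * (L ! i - y)) =
        Vcirc (g - 1) (n + 1) (y # (L ! i - y) # nths L (- {i})) * (y * (L ! i - y))"
      \<comment> \<open>At the endpoints the argument is not a positive vector, so
        \<open>Vcirc\<close> is not identified with \<open>pol\<close> there; the factor
        \<open>y * (L ! i - y)\<close> vanishes instead.\<close>
      proof (cases "y = 0 \<or> y = L ! i")
        case False
        then have "y # (L ! i - y) # del i L \<in> pos_vectors (n + 1)"
          using y i L set_del_subset[of i L] by (auto simp: pos_vectors_def length_del)
        from Vcirc_eq_pol[OF _ this, of "g - 1"] show ?thesis
          using \<open>g \<noteq> 0\<close> nths_compl_singleton[of i L] i L(1) by (simp add: N_def diff_mult_distrib2)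
      qed auto
    qed
    then show ?thesis using False by simp
  qed
  define A where "A = (\<Sum>i<n. integral {0..L ! i} (\<lambda>y. pol (N - 2) (y # (L ! i - y) # del i L) * (y * (L ! i - y))))"
  define B where "B = (\<Sum>i<n. \<Sum>j<n - 1. (L ! i + del i L ! j) * pol (N - 2) ((L ! i + del i L ! j) # del j (del i L)))"
  have "real N * pol N L = A + B"
    using pol_recursion[OF N2, of L] Li L(1) by (simp add: less_imp_le sum.distrib A_def B_def)
  then have "2 * ((2 * real g + real n - 1) * pol N L) = A + B" unfolding NR by (simp only: mult.assoc)
  then have "(2 * real g + real n - 1) * Vcirc g n L = 1 / 2 * B + 1 / 2 * A"
    unfolding Vcirc_eq_pol[OF assms(1) Lp] N_def[symmetric] by simp
  then show "(2 * real g + real n - 1) * Vcirc g n L =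
          1 / 2 * (\<Sum>(i, j) | i < n \<and> j < n \<and> i \<noteq> j.
            (L ! i + L ! j) * Vcirc g (n - 1) ((L ! i + L ! j) # nths L (- {i, j})))
          + (if g = 0 then 0 else
              1 / 2 * (\<Sum>i<n. integral {0..L ! i} (\<lambda>x.
                Vcirc (g - 1) (n + 1) (x # (L ! i - x) # nths L (- {i})) * (x * (L ! i - x)))))"
    unfolding merge B_def[symmetric] A_def split by (simp split: if_split)
qed

end
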